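(* Assume (A1)–(A5) hold; $p:\mathbb{R}\times X\to X$ satisfies $\|p(t,u)-p(s,v)\|\le L_p(|s-t|+\|u-v\|)$ for some $L_p\ge0$ and $\|p(s,u)\|\le C_1\|u\|+C_2$ for some $C_1,C_2\ge0$ and all arguments; and $G:\mathbb{R}\times X\times X\to X$ is continuous and locally Lipschitz in its second and third arguments, i.e. for every $R>0$ there is $L_{G,R}>0$ with $\|G(t,u^1,v^1)-G(t,u^2,v^2)\|\le L_{G,R}(\|u^1-u^2\|+\|v^1-v^2\|)$ for all $t>a$ and $\|u^i\|,\|v^i\|\le R$. Then for every $\varphi\in C$ the problem $\frac{du}{dt}+Au=B(t,u_t)$, $t\ge a$, $u_a=\varphi$, possesses a unique mild solution on an interval of the form $[a,b)$ with $a<b\le+\infty$. The solution depends continuously on the initial data: if $\varphi^n,\varphi\in C$ and $\|\varphi^n-\varphi\|_C\to0$, then $\|u^n_t-u_t\|_C\to0$ for every $t\in[a,b)$, where $u^n$ is the unique mild solution with initial function $\varphi^n$ and $u$ the one with initial function $\varphi$.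
   Context: Let $X$ be a Banach space with norm $\|\cdot\|$, $r>0$, $a\in\mathbb{R}$, and $C=C([-r,0];X)$ with the supremum norm $\|\cdot\|_C$. For a continuous $u$ on $[a-r,b)$ and $t\in[a,b)$, $u_t(\theta)=u(t+\theta)$, $\theta\in[-r,0]$. Let $A$ be the infinitesimal generator of a compact $C_0$-semigroup $\{e^{-At}\}_{t\ge0}$ on $X$ with $\|e^{-At}\|\le e^{\omega t}$, $t\ge0$, for a fixed $\omega\in\mathbb{R}$. The nonlinearity is $B(t,\psi)=G(t,\psi(0),F(t,\psi))$ with $F(t,\psi)=\int_{-r}^0p(t,\psi(\theta))\,dg(\theta,t,\psi)$ (Stieltjes integral in $\theta$), $g:[-r,0]\times\mathbb{R}\times C\to\mathbb{R}$. (A1): for every $(t,\varphi)$, $g(\cdot,t,\varphi)$ has bounded variation on $[-r,0]$ with $V_{-r}^0g(\cdot,t,\varphi)\le M_{Vg}$, a constant independent of $(t,\varphi)$. Write $g=g_d+g_c$, $g_d(\cdot,t,\varphi)$ the jump (step-function) part and $g_c=g_{ac}+g_s$ the continuous part (absolutely continuous plus singular continuous) of $g(\cdot,t,\varphi)$. (A2): for each $\theta$, $(t,\varphi)\mapsto g_c(\theta,t,\varphi)$ is continuous on $\mathbb{R}\times C$. (A3): the jump points of $g_d(\cdot,t,\varphi)$ are $\theta_k=-\eta_k(t,\varphi)$ with jumps $h_k(t,\varphi)=g_d(\theta_k+0,t,\varphi)-g_d(\theta_k-0,t,\varphi)$, where $\eta_k:\mathbb{R}\times C\to[0,r]$ and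 $h_k:\mathbb{R}\times C\to\mathbb{R}$ are continuous, and $\sum_kh_k(t,\varphi)$ converges absolutely and uniformly on bounded subsets of $\mathbb{R}\times C$. (A4): there is $L_{Vg_c}\ge0$ such that for all $t^1,t^2\ge a$ and $\varphi,\psi\in C$, the total variation on $[-r,0]$ of $\theta\mapsto g_c(\theta,t^1,\varphi)-g_c(\theta,t^2,\psi)$ is at most $L_{Vg_c}(|t^1-t^2|+\|\varphi-\psi\|_C)$. (A5): there is a continuous function $\eta_{ign}:[a,\infty)\to(0,\infty)$ such that for all $t\ge a$ and all $\varphi^1,\varphi^2\in C$ with $\varphi^1(\theta)=\varphi^2(\theta)$ for all $\theta\in[-r,-\eta_{ign}(t)]$, one has $\eta_k(t,\varphi^1)=\eta_k(t,\varphi^2)$ and $h_k(t,\varphi^1)=h_k(t,\varphi^2)$ for all $k$. A mild solution on $[a-r,T]$ is $u\in C([a-r,T];X)$ with $u_a=\varphi$ and $u(t)=e^{-A(t-a)}\varphi(0)+\int_a^te^{-A(t-s)}B(s,u_s)\,ds$ for $t\in[a,T]$; a mild solution on $[a,b)$ is a function on $[a-r,b)$ that is a mild solution on $[a-r,T]$ for every $T\in[a,b)$. *)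

theory Defs
  imports "HOL-Analysis.Analysis" "HOL-Library.Extended_Real"
begin

text \<open>Elements of C are represented as functions real => X that are continuous on
  [-r,0] and vanish outside [-r,0] (canonical representative).\<close>

definition Cspace :: "real \<Rightarrow> (real \<Rightarrow> 'x::real_normed_vector) set" where
  "Cspace r = {\<psi>. continuous_on {-r..0} \<psi> \<and> (\<forall>\<theta>. \<theta> \<notin> {-r..0} \<longrightarrow> \<psi> \<theta> = 0)}"

definition normC :: "real \<Rightarrow> (real \<Rightarrow> 'x::real_normed_vector) \<Rightarrow> real" where
  "normC r \<psi> = Sup ((\<lambda>\<theta>. norm (\<psi> \<theta>)) ` {-r..0})"

definition seg :: "real \<Rightarrow> (real \<Rightarrow> 'x::real_normed_vector) \<Rightarrow> real \<Rightarrow> real \<Rightarrow> 'x" where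
  "seg r u t = (\<lambda>\<theta>. if \<theta> \<in> {-r..0} then u (t + \<theta>) else 0)"

definition contRC :: "real \<Rightarrow> (real \<Rightarrow> (real \<Rightarrow> 'x::real_normed_vector) \<Rightarrow> 'y::metric_space) \<Rightarrow> bool" where
  "contRC r f = (\<forall>t \<phi>. \<phi> \<in> Cspace r \<longrightarrow> (\<forall>\<epsilon>>0. \<exists>\<delta>>0. \<forall>s \<psi>. \<psi> \<in> Cspace r \<and> \<bar>s - t\<bar> < \<delta>
      \<and> normC r (\<psi> - \<phi>) < \<delta> \<longrightarrow> dist (f s \<psi>) (f t \<phi>) < \<epsilon>))"

definition variation_le :: "(real \<Rightarrow> real) \<Rightarrow> real \<Rightarrow> real \<Rightarrow> real \<Rightarrow> bool" where
  "variation_le f a b M = (\<forall>(x::nat \<Rightarrow> real) n. x 0 = a \<and> x n = b \<and> (\<forall>i<n. x i \<le> x (Suc i))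
      \<longrightarrow> (\<Sum>i<n. \<bar>f (x (Suc i)) - f (x i)\<bar>) \<le> M)"

definition tagged_partition :: "real \<Rightarrow> real \<Rightarrow> real \<Rightarrow> (nat \<Rightarrow> real) \<Rightarrow> (nat \<Rightarrow> real) \<Rightarrow> nat \<Rightarrow> bool" where
  "tagged_partition a b \<delta> x \<xi> n = (x 0 = a \<and> x n = b \<and>
      (\<forall>i<n. x i < x (Suc i) \<and> x (Suc i) - x i < \<delta> \<and> x i \<le> \<xi> i \<and> \<xi> i \<le> x (Suc i)))"

definition has_RS_integral ::
  "(real \<Rightarrow> 'x::real_normed_vector) \<Rightarrow> (real \<Rightarrow> real) \<Rightarrow> real \<Rightarrow> real \<Rightarrow> 'x \<Rightarrow> bool" where
  "has_RS_integral f g a b I = (\<forall>\<epsilon>>0. \<exists>\<delta>>0. \<forall>x \<xi> n. tagged_partition a b \<delta> x \<xi> n \<longrightarrow>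
      norm ((\<Sum>i<n. (g (x (Suc i)) - g (x i)) *\<^sub>R f (\<xi> i)) - I) < \<epsilon>)"

definition RS_integral ::
  "(real \<Rightarrow> 'x::real_normed_vector) \<Rightarrow> (real \<Rightarrow> real) \<Rightarrow> real \<Rightarrow> real \<Rightarrow> 'x" where
  "RS_integral f g a b = (THE I. has_RS_integral f g a b I)"

definition rlim :: "(real \<Rightarrow> real) \<Rightarrow> real \<Rightarrow> real" where
  "rlim f \<theta> = Lim (at_right \<theta>) f"

definition llim :: "(real \<Rightarrow> real) \<Rightarrow> real \<Rightarrow> real" where
  "llim f \<theta> = Lim (at_left \<theta>) f"

text \<open>Jump (saltus) part of a BV function f on [a,b] (standard Jordan/Natanson convention):
  s(a) = 0, s(theta) = (f(a+) - f(a)) + sum_{a<s<theta} (f(s+) - f(s-)) + (f(theta) - f(theta-)).\<close>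
definition jump_part :: "real \<Rightarrow> (real \<Rightarrow> real) \<Rightarrow> real \<Rightarrow> real" where
  "jump_part a f \<theta> = (if \<theta> \<le> a then 0 else
      (rlim f a - f a) + infsum (\<lambda>s. rlim f s - llim f s) {a<..<\<theta>} + (f \<theta> - llim f \<theta>))"

definition cont_part :: "real \<Rightarrow> (real \<Rightarrow> real) \<Rightarrow> real \<Rightarrow> real" where
  "cont_part a f \<theta> = f \<theta> - jump_part a f \<theta>"

text \<open>Two-sided jump d(theta+0) - d(theta-0) of a function d on [a,b], with the conventions
  d(a-0) = d(a), d(b+0) = d(b).\<close>
definition jump_at :: "real \<Rightarrow> real \<Rightarrow> (real \<Rightarrow> real) \<Rightarrow> real \<Rightarrow> real" where
  "jump_at a b d \<theta> = (if \<theta> < b then rlim d \<theta> else d b) - (if a < \<theta> then llim d \<theta> else d a)"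

text \<open>S t stands for e^{-At}: a C_0-semigroup of bounded linear operators, compact for t>0,
  with norm bound e^{omega t}.\<close>
definition compact_C0_semigroup :: "(real \<Rightarrow> 'x::banach \<Rightarrow> 'x) \<Rightarrow> real \<Rightarrow> bool" where
  "compact_C0_semigroup S \<omega> =
     ((\<forall>t\<ge>0. bounded_linear (S t)) \<and> S 0 = id \<and>
      (\<forall>t\<ge>0. \<forall>s\<ge>0. S (t + s) = S t \<circ> S s) \<and>
      (\<forall>x. continuous_on {0..} (\<lambda>t. S t x)) \<and>
      (\<forall>t>0. compact (closure (S t ` cball 0 1))) \<and>
      (\<forall>t\<ge>0. \<forall>x. norm (S t x) \<le> exp (\<omega> * t) * norm x))"

definition mild_solution ::
  "(real \<Rightarrow> 'x::banach \<Rightarrow> 'x) \<Rightarrow> (real \<Rightarrow> (real \<Rightarrow> 'x) \<Rightarrow> 'x) \<Rightarrow> real \<Rightarrow> real \<Rightarrow> (real \<Rightarrow> 'x)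
     \<Rightarrow> real \<Rightarrow> (real \<Rightarrow> 'x) \<Rightarrow> bool" where
  "mild_solution S B r a \<phi> T u =
     (a \<le> T \<and> continuous_on {a - r..T} u \<and> (\<forall>\<theta>\<in>{-r..0}. u (a + \<theta>) = \<phi> \<theta>) \<and>
      (\<forall>t\<in>{a..T}. ((\<lambda>s. S (t - s) (B s (seg r u s))) has_integral (u t - S (t - a) (\<phi> 0))) {a..t}))"

definition mild_solution_on ::
  "(real \<Rightarrow> 'x::banach \<Rightarrow> 'x) \<Rightarrow> (real \<Rightarrow> (real \<Rightarrow> 'x) \<Rightarrow> 'x) \<Rightarrow> real \<Rightarrow> real \<Rightarrow> (real \<Rightarrow> 'x)
     \<Rightarrow> ereal \<Rightarrow> (real \<Rightarrow> 'x) \<Rightarrow> bool" where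
  "mild_solution_on S B r a \<phi> b u = (\<forall>T. a \<le> T \<and> ereal T < b \<longrightarrow> mild_solution S B r a \<phi> T u)"

end

theory Submission
  imports Defs
begin

text \<open>The Stieltjes integral \<open>F(t,\<psi>)\<close> splits into the integral against the continuous part of \<open>g\<close>
  and the series \<open>\<Sum>k. h\<^sub>k p(t, \<psi>(-\<eta>\<^sub>k))\<close>. By (A1), (A3) and (A4) it is continuous in \<open>(t,\<psi>)\<close>,
  but because of the state-dependent delays \<open>\<eta>\<^sub>k\<close> it is in general not Lipschitz in \<open>\<psi>\<close>. By (A5) the
  delays and the jumps agree on two functions with the same past, so \<open>F\<close>, and hence \<open>B\<close>, is locally
  Lipschitz along such pairs. On a time step shorter than \<open>\<eta>_ign\<close> all candidate solutions have the
  same past, which gives existence by contraction and uniqueness. Solutions with different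
  initial functions are compared through an auxiliary function with the past of one and the
  (shifted) future of the other: the error so introduced is controlled by continuity of \<open>B\<close> alone.\<close>

section \<open>Riemann--Stieltjes integrals\<close>

text \<open>The delays \<open>\<eta> k\<close> may coincide and \<open>g\<close> may take any value
  at a jump point, so the jump part is treated as an unordered sum of one-sided jumps over all
  points of the interval; only its integral is regrouped by \<open>k\<close>. The integral against
  the continuous part is then obtained by subtraction, in the form to which (A4) applies. The
  Lipschitz constant of \<open>B\<close> depends on a bound for the states, so the argument runs in
  balls, and on a time window of length one: there \<open>exp \<bar>\<omega>\<bar>\<close> bounds
  the semigroup and \<open>\<eta>_ign\<close> has a positive minimum. The end point \<open>b\<close>
  is that of a single time step, not the maximal existence time. The step depends only on an integer
  bound for the norm of the initial function, so solutions with nearby data live on a common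
  interval. In the comparison of such solutions, mere continuity of \<open>B\<close> is made uniform
  in time by the compactness of the limiting trajectory.\<close>

lemma double_difference_bound:
  fixes g V :: "real \<Rightarrow> real"
  assumes dom: "\<And>s t. l \<le> s \<Longrightarrow> s \<le> t \<Longrightarrow> t \<le> h \<Longrightarrow> \<bar>g t - g s\<bar> \<le> V t - V s"
    and x: "l \<le> x" "x < x'" "x' \<le> h" and y: "l \<le> y" "y < y'" "y' \<le> h"
  shows "\<bar>g (min x' y') - g (min x y') - g (min x' y) + g (min x y)\<bar>
      \<le> V (min x' y') - V (min x y') - V (min x' y) + V (min x y)"
proof (cases "x < y' \<and> y < x'")
  case True
  \<comment> \<open>Overlapping cells meet in the interval from \<open>max x y\<close> to
    \<open>min x' y'\<close>. The collapse holds for every \<open>G\<close>, so it serves both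
    \<open>g\<close> and \<open>V\<close>; for cells that do not overlap both double differences
    vanish.\<close>
  have "G (min x' y') - G (min x y') - G (min x' y) + G (min x y) = G (min x' y') - G (max x y)"
    for G :: "real \<Rightarrow> real"
    using True by (auto simp: min_def max_def)
  moreover have "\<bar>g (min x' y') - g (max x y)\<bar> \<le> V (min x' y') - V (max x y)"
    using x y True by (intro dom) auto
  ultimately show ?thesis by metis
next
  case False
  then show ?thesis using x y by (auto simp: min_def)
qed

lemma tagged_partition_in_interval:
  assumes tp: "tagged_partition l h \<delta> x \<xi> n" and "i \<le> n"
  shows "l \<le> x i" "x i \<le> h"
proof -
  have inc: "x i \<le> x j" if "i \<le> j" "j \<le> n" for i j
    using that
  proof (induction j rule: dec_induct)
    case (step k)
    then have "x k < x (Suc k)" using tp by (auto simp: tagged_partition_def)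
    then show ?case using step by auto
  qed auto
  show "l \<le> x i" "x i \<le> h"
    using inc[of 0 i] inc[of i n] assms by (auto simp: tagged_partition_def)
qed

lemma tagged_partition_tag_in_interval:
  assumes tp: "tagged_partition l h \<delta> x \<xi> n" and "i < n"
  shows "l \<le> \<xi> i" "\<xi> i \<le> h"
proof -
  have "x i \<le> \<xi> i" "\<xi> i \<le> x (Suc i)" using assms by (auto simp: tagged_partition_def)
  then show "l \<le> \<xi> i" "\<xi> i \<le> h"
    using tagged_partition_in_interval[OF tp, of i] tagged_partition_in_interval[OF tp, of "Suc i"] assms
    by auto
qed

lemma tagged_partition_mono:
  "tagged_partition l h \<delta> x \<xi> n \<Longrightarrow> \<delta> \<le> \<delta>' \<Longrightarrow> tagged_partition l h \<delta>' x \<xi> n"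
  unfolding tagged_partition_def by force

lemma tagged_partition_exists:
  assumes "l < h" "0 < \<delta>"
  shows "\<exists>x \<xi> n. tagged_partition l h \<delta> x \<xi> n"
proof -
  obtain n :: nat where n: "(h - l) / \<delta> < real n" using reals_Archimedean2 by blast
  have "0 < (h - l) / \<delta>" using assms by simp
  then have n0: "0 < real n" using n by linarith
  have step: "(h - l) / real n < \<delta>" using n n0 assms by (simp add: field_simps)
  define x where "x = (\<lambda>i::nat. l + real i * ((h - l) / real n))"
  have d: "x (Suc i) - x i = (h - l) / real n" for i by (simp add: x_def algebra_simps add_divide_distrib diff_divide_distrib)
  have p: "0 < (h - l) / real n" using assms n0 by simp
  have "tagged_partition l h \<delta> x x n"
    unfolding tagged_partition_def
  proof (intro conjI allI impI)
    show "x 0 = l" "x n = h" using n0 by (auto simp: x_def)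
    fix i show "x i < x (Suc i)" "x (Suc i) - x i < \<delta>" "x i \<le> x i" "x i \<le> x (Suc i)"
      using d[of i] p step by linarith+
  qed
  then show ?thesis by blast
qed

text \<open>Over a pair of cells, the double difference of \<open>(u, v) \<mapsto> g (min u v)\<close> is the increment of
  \<open>g\<close> over their intersection; it telescopes in each index, which replaces the passage to a
  common refinement.\<close>

lemma Riemann_Stieltjes_sums_close:
  fixes f :: "real \<Rightarrow> 'x::real_normed_vector"
  assumes dom: "\<And>s t. l \<le> s \<Longrightarrow> s \<le> t \<Longrightarrow> t \<le> h \<Longrightarrow> \<bar>g t - g s\<bar> \<le> V t - V s"
    and p: "tagged_partition l h \<delta> x \<xi> n" and q: "tagged_partition l h \<delta>' y \<zeta> m"
    and osc: "\<And>s t. s \<in> {l..h} \<Longrightarrow> t \<in> {l..h} \<Longrightarrow> \<bar>s - t\<bar> < \<delta> + \<delta>' \<Longrightarrow> norm (f s - f t) \<le> e"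
  shows "norm ((\<Sum>i<n. (g (x (Suc i)) - g (x i)) *\<^sub>R f (\<xi> i)) -
               (\<Sum>j<m. (g (y (Suc j)) - g (y j)) *\<^sub>R f (\<zeta> j))) \<le> e * (V h - V l)"
proof -
  define D where "D = (\<lambda>(g::real \<Rightarrow> real) i j. g (min (x (Suc i)) (y (Suc j))) - g (min (x i) (y (Suc j)))
     - g (min (x (Suc i)) (y j)) + g (min (x i) (y j)))"
  have ends: "x 0 = l" "x n = h" "y 0 = l" "y m = h" using p q by (auto simp: tagged_partition_def)
  have xb: "l \<le> x i" "x i \<le> h" if "i \<le> n" for i
    using tagged_partition_in_interval[OF p that] .
  have yb: "l \<le> y i" "y i \<le> h" if "i \<le> m" for i
    using tagged_partition_in_interval[OF q that] .
  have D1: "(\<Sum>j<m. D G i j) = G (x (Suc i)) - G (x i)" if "i < n" for G i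
  proof -
    have "(\<Sum>j<m. D G i j) = (\<Sum>j<m. (G (min (x (Suc i)) (y (Suc j))) - G (min (x i) (y (Suc j))))
       - (G (min (x (Suc i)) (y j)) - G (min (x i) (y j))))"
      by (simp add: D_def algebra_simps)
    also have "\<dots> = (G (min (x (Suc i)) h) - G (min (x i) h)) - (G (min (x (Suc i)) l) - G (min (x i) l))"
      by (simp add: sum_lessThan_telescope[of "\<lambda>j. G (min (x (Suc i)) (y j)) - G (min (x i) (y j))"] ends)
    also have "\<dots> = G (x (Suc i)) - G (x i)"
      using xb[of i] xb[of "Suc i"] that by (auto simp: min_def)
    finally show ?thesis .
  qed
  have D2: "(\<Sum>i<n. D G i j) = G (y (Suc j)) - G (y j)" if "j < m" for G j
  proof -
    have "(\<Sum>i<n. D G i j) = (\<Sum>i<n. (G (min (x (Suc i)) (y (Suc j))) - G (min (x (Suc i)) (y j)))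
       - (G (min (x i) (y (Suc j))) - G (min (x i) (y j))))"
      by (simp add: D_def algebra_simps)
    also have "\<dots> = (G (min h (y (Suc j))) - G (min h (y j))) - (G (min l (y (Suc j))) - G (min l (y j)))"
      by (simp add: sum_lessThan_telescope[of "\<lambda>i. G (min (x i) (y (Suc j))) - G (min (x i) (y j))"] ends)
    also have "\<dots> = G (y (Suc j)) - G (y j)"
      using yb[of j] yb[of "Suc j"] that by (auto simp: min_def)
    finally show ?thesis .
  qed
  have "(\<Sum>i<n. (g (x (Suc i)) - g (x i)) *\<^sub>R f (\<xi> i)) = (\<Sum>i<n. \<Sum>j<m. D g i j *\<^sub>R f (\<xi> i))"
    by (intro sum.cong refl) (simp add: D1 flip: scaleR_left.sum)
  moreover have "(\<Sum>j<m. (g (y (Suc j)) - g (y j)) *\<^sub>R f (\<zeta> j)) = (\<Sum>j<m. \<Sum>i<n. D g i j *\<^sub>R f (\<zeta> j))"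
    by (intro sum.cong refl) (simp add: D2 flip: scaleR_left.sum)
  moreover have "(\<Sum>j<m. \<Sum>i<n. D g i j *\<^sub>R f (\<zeta> j)) = (\<Sum>i<n. \<Sum>j<m. D g i j *\<^sub>R f (\<zeta> j))"
    by (rule sum.swap)
  ultimately have "norm ((\<Sum>i<n. (g (x (Suc i)) - g (x i)) *\<^sub>R f (\<xi> i)) -
               (\<Sum>j<m. (g (y (Suc j)) - g (y j)) *\<^sub>R f (\<zeta> j)))
     = norm (\<Sum>i<n. \<Sum>j<m. D g i j *\<^sub>R (f (\<xi> i) - f (\<zeta> j)))"
    by (simp add: sum_subtractf scaleR_diff_right)
  also have "\<dots> \<le> (\<Sum>i<n. norm (\<Sum>j<m. D g i j *\<^sub>R (f (\<xi> i) - f (\<zeta> j))))"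
    by (rule norm_sum)
  also have "\<dots> \<le> (\<Sum>i<n. \<Sum>j<m. e * D V i j)"
  proof (intro sum_mono order.trans[OF norm_sum])
    fix i j assume ij: "i \<in> {..<n}" "j \<in> {..<m}"
    have xs: "x i < x (Suc i)" "x (Suc i) - x i < \<delta>" "x i \<le> \<xi> i" "\<xi> i \<le> x (Suc i)"
      using p ij by (auto simp: tagged_partition_def)
    have ys: "y j < y (Suc j)" "y (Suc j) - y j < \<delta>'" "y j \<le> \<zeta> j" "\<zeta> j \<le> y (Suc j)"
      using q ij by (auto simp: tagged_partition_def)
    have bb: "l \<le> x i" "x (Suc i) \<le> h" "l \<le> y j" "y (Suc j) \<le> h"
      using ij xb[of i] xb[of "Suc i"] yb[of j] yb[of "Suc j"] by auto
    have DD: "\<bar>D g i j\<bar> \<le> D V i j"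
      unfolding D_def by (rule double_difference_bound[of l h]) (use dom xs ys bb in auto)
    show "norm (D g i j *\<^sub>R (f (\<xi> i) - f (\<zeta> j))) \<le> e * D V i j"
    \<comment> \<open>Only overlapping cells carry weight, and their tags are closer than the sum of
      the two meshes, so the oscillation bound applies.\<close>
    proof (cases "x i < y (Suc j) \<and> y j < x (Suc i)")
      case True
      have "\<bar>\<xi> i - \<zeta> j\<bar> < \<delta> + \<delta>'" using True xs ys by linarith
      then have "norm (f (\<xi> i) - f (\<zeta> j)) \<le> e" using osc xs ys bb by auto
      then have "\<bar>D g i j\<bar> * norm (f (\<xi> i) - f (\<zeta> j)) \<le> D V i j * e"
        using DD by (intro mult_mono) auto
      then show ?thesis by (simp add: mult.commute)
    next
      case False
      have "D g i j = 0"
        unfolding D_def using False xs ys by (auto simp: min_def)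
      moreover have "D V i j = 0" unfolding D_def using False xs ys by (auto simp: min_def)
      ultimately show ?thesis by simp
    qed
  qed
  also have "\<dots> = e * (\<Sum>i<n. V (x (Suc i)) - V (x i))"
    by (simp add: D1 flip: sum_distrib_left)
  also have "\<dots> = e * (V h - V l)" by (simp add: sum_lessThan_telescope[of "\<lambda>i. V (x i)"] ends)
  finally show ?thesis .
qed

lemma has_RS_integral_unique:
  fixes I J :: "'x::real_normed_vector"
  assumes "l < h" and I: "has_RS_integral f g l h I" and J: "has_RS_integral f g l h J"
  shows "I = J"
proof (rule ccontr)
  assume "I \<noteq> J"
  then have e: "0 < norm (I - J) / 2" by simp
  obtain d1 where d1: "d1 > 0" "\<And>x \<xi> n. tagged_partition l h d1 x \<xi> n \<Longrightarrow>
      norm ((\<Sum>i<n. (g (x (Suc i)) - g (x i)) *\<^sub>R f (\<xi> i)) - I) < norm (I - J) / 2"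
    using I e unfolding has_RS_integral_def by meson
  obtain d2 where d2: "d2 > 0" "\<And>x \<xi> n. tagged_partition l h d2 x \<xi> n \<Longrightarrow>
      norm ((\<Sum>i<n. (g (x (Suc i)) - g (x i)) *\<^sub>R f (\<xi> i)) - J) < norm (I - J) / 2"
    using J e unfolding has_RS_integral_def by meson
  obtain x \<xi> n where t: "tagged_partition l h (min d1 d2) x \<xi> n"
    using tagged_partition_exists[OF \<open>l < h\<close>, of "min d1 d2"] d1 d2 by auto
  let ?s = "\<Sum>i<n. (g (x (Suc i)) - g (x i)) *\<^sub>R f (\<xi> i)"
  have "norm (?s - I) < norm (I - J) / 2" "norm (?s - J) < norm (I - J) / 2"
    using d1(2)[OF tagged_partition_mono[OF t]] d2(2)[OF tagged_partition_mono[OF t]] by auto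
  then have "norm ((?s - J) - (?s - I)) < norm (I - J)"
    using norm_triangle_ineq4[of "?s - J" "?s - I"] by linarith
  then show False by simp
qed

lemma RS_integral_eqI:
  assumes "l < h" "has_RS_integral f g l h I"
  shows "RS_integral f g l h = I"
  unfolding RS_integral_def using assms has_RS_integral_unique by blast

text \<open>The sums are bilinear in integrator and integrand. The identity \<open>eq\<close>
  between summands lets one proof cover differences of integrands as well as differences of
  integrators.\<close>

lemma has_RS_integral_diff:
  assumes I: "has_RS_integral f g l h I" and J: "has_RS_integral f' g' l h J"
    and eq: "\<And>s t x. (g' t - g' s) *\<^sub>R f' x = (g t - g s) *\<^sub>R f x - (k t - k s) *\<^sub>R q x"
  shows "has_RS_integral q k l h (I - J)"
  unfolding has_RS_integral_def
proof (intro allI impI)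
  fix e :: real assume "e > 0"
  then have e: "e / 2 > 0" by simp
  obtain d1 where d1: "d1 > 0" "\<And>x \<xi> n. tagged_partition l h d1 x \<xi> n \<Longrightarrow>
      norm ((\<Sum>i<n. (g (x (Suc i)) - g (x i)) *\<^sub>R f (\<xi> i)) - I) < e / 2"
    using I e unfolding has_RS_integral_def by meson
  obtain d2 where d2: "d2 > 0" "\<And>x \<xi> n. tagged_partition l h d2 x \<xi> n \<Longrightarrow>
      norm ((\<Sum>i<n. (g' (x (Suc i)) - g' (x i)) *\<^sub>R f' (\<xi> i)) - J) < e / 2"
    using J e unfolding has_RS_integral_def by meson
  show "\<exists>\<delta>>0. \<forall>x \<xi> n. tagged_partition l h \<delta> x \<xi> n \<longrightarrow>
      norm ((\<Sum>i<n. (k (x (Suc i)) - k (x i)) *\<^sub>R q (\<xi> i)) - (I - J)) < e"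
  proof (intro exI[of _ "min d1 d2"] conjI allI impI)
    show "0 < min d1 d2" using d1 d2 by simp
    fix x \<xi> n assume t: "tagged_partition l h (min d1 d2) x \<xi> n"
    let ?s = "\<Sum>i<n. (g (x (Suc i)) - g (x i)) *\<^sub>R f (\<xi> i)"
    let ?s' = "\<Sum>i<n. (g' (x (Suc i)) - g' (x i)) *\<^sub>R f' (\<xi> i)"
    have a: "norm (?s - I) < e / 2" "norm (?s' - J) < e / 2"
      using d1(2)[OF tagged_partition_mono[OF t]] d2(2)[OF tagged_partition_mono[OF t]] by auto
    have "(\<Sum>i<n. (k (x (Suc i)) - k (x i)) *\<^sub>R q (\<xi> i)) = ?s - ?s'"
      unfolding eq sum_subtractf by simp
    then have "(\<Sum>i<n. (k (x (Suc i)) - k (x i)) *\<^sub>R q (\<xi> i)) - (I - J) = (?s - I) - (?s' - J)"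
      by simp
    then have "norm ((\<Sum>i<n. (k (x (Suc i)) - k (x i)) *\<^sub>R q (\<xi> i)) - (I - J)) = norm ((?s - I) - (?s' - J))"
      by (rule arg_cong)
    also have "\<dots> < e" using norm_triangle_ineq4[of "?s - I" "?s' - J"] a by linarith
    finally show "norm ((\<Sum>i<n. (k (x (Suc i)) - k (x i)) *\<^sub>R q (\<xi> i)) - (I - J)) < e" .
  qed
qed

lemma has_RS_integral_diff_integrand:
  "has_RS_integral f g l h I \<Longrightarrow> has_RS_integral f' g l h J \<Longrightarrow>
    has_RS_integral (\<lambda>x. f x - f' x) g l h (I - J)"
  by (rule has_RS_integral_diff) (auto simp: algebra_simps)

lemma has_RS_integral_diff_integrator:
  "has_RS_integral f g l h I \<Longrightarrow> has_RS_integral f g' l h J \<Longrightarrow>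
    has_RS_integral f (\<lambda>x. g x - g' x) l h (I - J)"
  by (rule has_RS_integral_diff) (auto simp: algebra_simps)

lemma variation_le_tagged_partition:
  assumes "variation_le g l h M" "tagged_partition l h \<delta> x \<xi> n"
  shows "(\<Sum>i<n. \<bar>g (x (Suc i)) - g (x i)\<bar>) \<le> M"
  using assms(1)[unfolded variation_le_def, rule_format, of x n] assms(2)
  unfolding tagged_partition_def by (auto simp: less_imp_le)

lemma has_RS_integral_norm_le:
  assumes "l < h" and I: "has_RS_integral f g l h I" and M: "variation_le g l h M"
    and K: "\<And>x. x \<in> {l..h} \<Longrightarrow> norm (f x) \<le> K"
  shows "norm I \<le> M * K"
proof (rule field_le_epsilon)
  fix e :: real assume "e > 0"
  then obtain d where d: "d > 0" "\<And>x \<xi> n. tagged_partition l h d x \<xi> n \<Longrightarrow>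
      norm ((\<Sum>i<n. (g (x (Suc i)) - g (x i)) *\<^sub>R f (\<xi> i)) - I) < e"
    using I unfolding has_RS_integral_def by meson
  obtain x \<xi> n where t: "tagged_partition l h d x \<xi> n"
    using tagged_partition_exists[OF \<open>l < h\<close> d(1)] by auto
  let ?s = "\<Sum>i<n. (g (x (Suc i)) - g (x i)) *\<^sub>R f (\<xi> i)"
  have K0: "0 \<le> K" using order.trans[OF norm_ge_zero K[of l]] \<open>l < h\<close> by simp
  have "norm ?s \<le> (\<Sum>i<n. \<bar>g (x (Suc i)) - g (x i)\<bar> * K)"
  proof (intro order.trans[OF norm_sum] sum_mono)
    fix i assume "i \<in> {..<n}"
    then have "norm (f (\<xi> i)) \<le> K" using K tagged_partition_tag_in_interval[OF t] by auto
    then show "norm ((g (x (Suc i)) - g (x i)) *\<^sub>R f (\<xi> i)) \<le> \<bar>g (x (Suc i)) - g (x i)\<bar> * K"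
      by (simp add: mult_left_mono)
  qed
  also have "\<dots> \<le> M * K"
    unfolding sum_distrib_right[symmetric]
    using variation_le_tagged_partition[OF M t] K0 by (rule mult_right_mono)
  finally have "norm ?s \<le> M * K" .
  then show "norm I \<le> M * K + e"
    using d(2)[OF t] norm_triangle_ineq4[of ?s "?s - I"] by simp
qed

lemma variation_le_nonneg:
  assumes "variation_le g l h M" "l \<le> h"
  shows "0 \<le> M"
proof -
  have "\<bar>g h - g l\<bar> \<le> M"
    using assms(1)[unfolded variation_le_def, rule_format, of "\<lambda>i. if i = 0 then l else h" 1] assms(2) by simp
  then show ?thesis by (meson abs_ge_zero order.trans)
qed

text \<open>\<open>V t\<close> is the variation of \<open>g\<close> over \<open>{l..t}\<close>, a
  supremum over partitions. Appending \<open>t\<close> to a partition of \<open>{l..s}\<close>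
  raises its sum by the increment of \<open>g\<close>, which gives the inequality; appending
  \<open>h\<close> shows that all suprema are bounded by \<open>M\<close>.\<close>

lemma variation_le_dominating_mono:
  assumes M: "variation_le g l h M"
  obtains V :: "real \<Rightarrow> real" where "\<And>s t. l \<le> s \<Longrightarrow> s \<le> t \<Longrightarrow> t \<le> h \<Longrightarrow> \<bar>g t - g s\<bar> \<le> V t - V s"
proof -
  define A where "A = (\<lambda>t. {v. \<exists>(x::nat \<Rightarrow> real) n. x 0 = l \<and> x n = t \<and> (\<forall>i<n. x i \<le> x (Suc i)) \<and>
     v = (\<Sum>i<n. \<bar>g (x (Suc i)) - g (x i)\<bar>)})"
  have ext: "v + \<bar>g t - g s\<bar> \<in> A t" if "v \<in> A s" "s \<le> t" for v s t
  proof -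
    obtain x n where x: "x 0 = l" "x n = s" "\<forall>i<n. x i \<le> x (Suc i)"
      "v = (\<Sum>i<n. \<bar>g (x (Suc i)) - g (x i)\<bar>)"
      using \<open>v \<in> A s\<close> unfolding A_def by auto
    have eq: "(\<Sum>i<n. \<bar>g ((x(Suc n := t)) (Suc i)) - g ((x(Suc n := t)) i)\<bar>) = v"
      unfolding x(4) by (intro sum.cong) auto
    show ?thesis unfolding A_def mem_Collect_eq
      apply (intro exI[of _ "x(Suc n := t)"] exI[of _ "Suc n"] conjI)
      using x eq \<open>s \<le> t\<close> by (auto simp: less_Suc_eq)
  qed
  have ne: "A t \<noteq> {}" if "l \<le> t" for t
  proof -
    have "0 \<in> A l" unfolding A_def by (auto intro!: exI[of _ "\<lambda>_. l"] exI[of _ 0])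
    then show ?thesis using ext that by blast
  qed
  have bd: "bdd_above (A t)" if "t \<le> h" for t
  proof (rule bdd_aboveI)
    fix v assume "v \<in> A t"
    from ext[OF this that] obtain x :: "nat \<Rightarrow> real" and n where
      "x 0 = l" "x n = h" "\<forall>i<n. x i \<le> x (Suc i)"
      "v + \<bar>g h - g t\<bar> = (\<Sum>i<n. \<bar>g (x (Suc i)) - g (x i)\<bar>)"
      unfolding A_def mem_Collect_eq by metis
    with M[unfolded variation_le_def, rule_format, of x n] have "v + \<bar>g h - g t\<bar> \<le> M" by metis
    then show "v \<le> M" by simp
  qed
  have "\<bar>g t - g s\<bar> \<le> Sup (A t) - Sup (A s)" if "l \<le> s" "s \<le> t" "t \<le> h" for s t
  proof -
    have "Sup (A s) \<le> Sup (A t) - \<bar>g t - g s\<bar>"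
    proof (rule cSup_least)
      show "A s \<noteq> {}" using ne that by auto
      fix v assume "v \<in> A s"
      then have "v + \<bar>g t - g s\<bar> \<le> Sup (A t)" using ext bd that by (intro cSup_upper) auto
      then show "v \<le> Sup (A t) - \<bar>g t - g s\<bar>" by simp
    qed
    then show ?thesis by simp
  qed
  then show thesis by (rule that)
qed

text \<open>\<open>RS_integral\<close> is a definite description, so an integral has to be
  exhibited. Sums over partitions with mesh below \<open>1 / (k + 1)\<close> form a Cauchy sequence,
  by the comparison of fine sums; its limit is close to every fine sum.\<close>

lemma has_RS_integral_RS_integral:
  fixes f :: "real \<Rightarrow> 'x::banach"
  assumes "l < h" and f: "continuous_on {l..h} f" and M: "variation_le g l h M"
  shows "has_RS_integral f g l h (RS_integral f g l h)"
proof -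
  obtain V :: "real \<Rightarrow> real" where V: "\<And>s t. l \<le> s \<Longrightarrow> s \<le> t \<Longrightarrow> t \<le> h \<Longrightarrow> \<bar>g t - g s\<bar> \<le> V t - V s"
    using variation_le_dominating_mono[OF M] by blast
  \<comment> \<open>The summand 1 keeps the divisor in \<open>e / W\<close> positive when
    \<open>V\<close> does not increase.\<close>
  define W where "W = V h - V l + 1"
  have W: "0 < W" "V h - V l \<le> W" using V[of l h] \<open>l < h\<close> abs_ge_zero[of "g h - g l"] unfolding W_def by linarith+
  have unif: "\<exists>d>0. \<forall>s\<in>{l..h}. \<forall>t\<in>{l..h}. \<bar>s - t\<bar> < d \<longrightarrow> norm (f s - f t) \<le> e" if "e > 0" for e
  proof -
    have "uniformly_continuous_on {l..h} f" using f by (simp add: compact_uniformly_continuous)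
    then obtain d where "d > 0" "\<And>s t. s \<in> {l..h} \<Longrightarrow> t \<in> {l..h} \<Longrightarrow> dist t s < d \<Longrightarrow> dist (f t) (f s) < e"
      using \<open>e > 0\<close> unfolding uniformly_continuous_on_def by meson
    then show ?thesis by (metis dist_norm less_eq_real_def real_norm_def)
  qed
  have "\<exists>x \<xi> n. tagged_partition l h (1 / real (Suc k)) x \<xi> n" for k
    using tagged_partition_exists[OF \<open>l < h\<close>] by simp
  then obtain x \<xi> n where P: "\<And>k. tagged_partition l h (1 / real (Suc k)) (x k) (\<xi> k) (n k)"
    by metis
  define s where "s k = (\<Sum>i<n k. (g (x k (Suc i)) - g (x k i)) *\<^sub>R f (\<xi> k i))" for k
  have close: "\<exists>d>0. \<forall>k. 1 / real (Suc k) < d \<longrightarrow> (\<forall>y \<zeta> m. tagged_partition l h d y \<zeta> m \<longrightarrow>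
       norm ((\<Sum>i<m. (g (y (Suc i)) - g (y i)) *\<^sub>R f (\<zeta> i)) - s k) \<le> e)" if "e > 0" for e
  proof -
    obtain d where d: "d > 0" "\<And>s t. s\<in>{l..h} \<Longrightarrow> t\<in>{l..h} \<Longrightarrow> \<bar>s - t\<bar> < d \<Longrightarrow> norm (f s - f t) \<le> e / W"
      using unif[of "e / W"] W \<open>e > 0\<close> by auto
    show ?thesis
    \<comment> \<open>Comparing two partitions costs the sum of their meshes, hence half of
      \<open>d\<close> for each.\<close>
    proof (intro exI[of _ "d / 2"] conjI allI impI)
      show "0 < d / 2" using d by simp
      fix k y \<zeta> m assume k: "1 / real (Suc k) < d / 2" and t: "tagged_partition l h (d / 2) y \<zeta> m"
      have "norm ((\<Sum>i<m. (g (y (Suc i)) - g (y i)) *\<^sub>R f (\<zeta> i)) - s k) \<le> e / W * (V h - V l)"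
        unfolding s_def using V t P[of k]
      proof (rule Riemann_Stieltjes_sums_close)
        fix s t assume "s \<in> {l..h}" "t \<in> {l..h}" "\<bar>s - t\<bar> < d / 2 + 1 / real (Suc k)"
        then show "norm (f s - f t) \<le> e / W" using k d(2) by auto
      qed
      also have "\<dots> \<le> e / W * W" using W \<open>e > 0\<close> by (intro mult_left_mono) auto
      finally show "norm ((\<Sum>i<m. (g (y (Suc i)) - g (y i)) *\<^sub>R f (\<zeta> i)) - s k) \<le> e" using W by simp
    qed
  qed
  have small: "\<exists>N. \<forall>k\<ge>N. 1 / real (Suc k) < d" if "d > 0" for d
  proof -
    obtain N where N: "1 / real (Suc N) < d" by (rule nat_approx_posE[OF \<open>d > 0\<close>])
    have "1 / real (Suc k) < d" if "k \<ge> N" for k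
      using N that frac_le[of 1 1 "real (Suc N)" "real (Suc k)"] by simp
    then show ?thesis by blast
  qed
  have "Cauchy s"
    unfolding Cauchy_def
  proof (intro allI impI)
    fix e :: real assume "e > 0"
    then obtain d where d: "d > 0" "\<And>k y \<zeta> m. 1 / real (Suc k) < d \<Longrightarrow> tagged_partition l h d y \<zeta> m \<Longrightarrow>
       norm ((\<Sum>i<m. (g (y (Suc i)) - g (y i)) *\<^sub>R f (\<zeta> i)) - s k) \<le> e / 2"
      using close[of "e / 2"] by auto
    obtain N where N: "\<And>k. k \<ge> N \<Longrightarrow> 1 / real (Suc k) < d" using small[OF d(1)] by auto
    have "dist (s k) (s k') < e" if "k \<ge> N" "k' \<ge> N" for k k'
      using d(2)[OF N[OF that(2)] tagged_partition_mono[OF P[of k]], folded s_def] N[OF that(1)] \<open>e > 0\<close>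
      by (simp add: dist_norm)
    then show "\<exists>N. \<forall>m\<ge>N. \<forall>n\<ge>N. dist (s m) (s n) < e" by blast
  qed
  then obtain I where I: "s \<longlonglongrightarrow> I" using Cauchy_convergent convergent_def by blast
  have "has_RS_integral f g l h I"
    unfolding has_RS_integral_def
  proof (intro allI impI)
    fix e :: real assume "e > 0"
    then obtain d where d: "d > 0" "\<And>k y \<zeta> m. 1 / real (Suc k) < d \<Longrightarrow> tagged_partition l h d y \<zeta> m \<Longrightarrow>
       norm ((\<Sum>i<m. (g (y (Suc i)) - g (y i)) *\<^sub>R f (\<zeta> i)) - s k) \<le> e / 2"
      using close[of "e / 2"] by auto
    obtain N where N: "\<And>k. k \<ge> N \<Longrightarrow> 1 / real (Suc k) < d" using small[OF d(1)] by auto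
    have "norm ((\<Sum>i<m. (g (y (Suc i)) - g (y i)) *\<^sub>R f (\<zeta> i)) - I) < e"
      if t: "tagged_partition l h d y \<zeta> m" for y \<zeta> m
    proof -
      have "norm ((\<Sum>i<m. (g (y (Suc i)) - g (y i)) *\<^sub>R f (\<zeta> i)) - I) \<le> e / 2"
      proof (rule LIMSEQ_le_const2)
        show "(\<lambda>k. norm ((\<Sum>i<m. (g (y (Suc i)) - g (y i)) *\<^sub>R f (\<zeta> i)) - s k)) \<longlonglongrightarrow>
           norm ((\<Sum>i<m. (g (y (Suc i)) - g (y i)) *\<^sub>R f (\<zeta> i)) - I)"
          using I by (intro tendsto_intros)
        show "\<exists>N. \<forall>k\<ge>N. norm ((\<Sum>i<m. (g (y (Suc i)) - g (y i)) *\<^sub>R f (\<zeta> i)) - s k) \<le> e / 2"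
          using d(2)[OF N t] by blast
      qed
      then show ?thesis using \<open>e > 0\<close> by simp
    qed
    then show "\<exists>\<delta>>0. \<forall>x \<xi> n. tagged_partition l h \<delta> x \<xi> n \<longrightarrow>
      norm ((\<Sum>i<n. (g (x (Suc i)) - g (x i)) *\<^sub>R f (\<xi> i)) - I) < e" using d(1) by blast
  qed
  then show ?thesis using RS_integral_eqI[OF \<open>l < h\<close>] by metis
qed

section \<open>The jump part as integrator\<close>

lemma mono_right_limit_exists:
  fixes W :: "real \<Rightarrow> real"
  assumes "c < h" and mono: "\<And>s t. c < s \<Longrightarrow> s \<le> t \<Longrightarrow> t < h \<Longrightarrow> W s \<le> W t"
    and bd: "\<And>s. c < s \<Longrightarrow> s < h \<Longrightarrow> b \<le> W s"
  shows "\<exists>L. (W \<longlongrightarrow> L) (at_right c)"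
proof (intro exI tendstoI)
  let ?L = "Inf (W ` {c<..<h})"
  have bdd: "bdd_below (W ` {c<..<h})" using bd by (auto intro!: bdd_belowI[of _ b])
  have ne: "W ` {c<..<h} \<noteq> {}" using \<open>c < h\<close> by simp
  fix e :: real assume "e > 0"
  then obtain t where t: "c < t" "t < h" "W t < ?L + e"
    using cInf_lessD[OF ne, of "?L + e"] by auto
  have "dist (W y) ?L < e" if "c < y" "y < t" for y
  proof -
    have "?L \<le> W y" using that t bdd by (intro cInf_lower) auto
    moreover have "W y \<le> W t" using mono that t by auto
    ultimately show ?thesis using t by (simp add: dist_real_def)
  qed
  then show "\<forall>\<^sub>F y in at_right c. dist (W y) ?L < e"
    unfolding eventually_at_right[OF \<open>c < h\<close>] using t by blast
qed

text \<open>\<open>V\<close> and \<open>V - g\<close> are both increasing, so each has a right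
  limit, and \<open>g\<close> is their difference.\<close>

lemma dominated_right_limit:
  assumes dom: "\<And>s t. l \<le> s \<Longrightarrow> s \<le> t \<Longrightarrow> t \<le> h \<Longrightarrow> \<bar>g t - g s\<bar> \<le> V t - V s"
    and "l \<le> c" "c < h"
  shows "(g \<longlongrightarrow> rlim g c) (at_right c)"
proof -
  have "\<exists>L. (V \<longlongrightarrow> L) (at_right c)"
  proof (rule mono_right_limit_exists[where b = "V c"])
    show "V s \<le> V t" if "c < s" "s \<le> t" "t < h" for s t
      using order.trans[OF abs_ge_zero dom[of s t]] dom[of s t] that assms(2,3) by simp
    show "V c \<le> V s" if "c < s" "s < h" for s using order.trans[OF abs_ge_zero dom[of c s]] dom[of c s] that assms(2,3) by simp
  qed fact
  then obtain L where L: "(V \<longlongrightarrow> L) (at_right c)" by blast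
  have "\<exists>L. ((\<lambda>x. V x - g x) \<longlongrightarrow> L) (at_right c)"
  proof (rule mono_right_limit_exists[where b = "V c - g c"])
    show "V s - g s \<le> V t - g t" if "c < s" "s \<le> t" "t < h" for s t
      using order.trans[OF abs_ge_zero dom[of s t]] dom[of s t] that assms(2,3) by simp
    show "V c - g c \<le> V s - g s" if "c < s" "s < h" for s using order.trans[OF abs_ge_zero dom[of c s]] dom[of c s] that assms(2,3) by simp
  qed fact
  then obtain K where K: "((\<lambda>x. V x - g x) \<longlongrightarrow> K) (at_right c)" by blast
  have "(g \<longlongrightarrow> L - K) (at_right c)" using tendsto_diff[OF L K] by simp
  then show ?thesis
    unfolding rlim_def by (simp add: tendsto_Lim trivial_limit_at_right_real)
qed

lemma dominated_left_limit:
  assumes dom: "\<And>s t. l \<le> s \<Longrightarrow> s \<le> t \<Longrightarrow> t \<le> h \<Longrightarrow> \<bar>g t - g s\<bar> \<le> V t - V s"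
    and "l < c" "c \<le> h"
  shows "(g \<longlongrightarrow> llim g c) (at_left c)"
proof -
  \<comment> \<open>Reflection in the origin turns left limits into right limits;
    \<open>- V (- x)\<close> dominates the reflected function.\<close>
  have "((\<lambda>x. g (- x)) \<longlongrightarrow> rlim (\<lambda>x. g (- x)) (- c)) (at_right (- c))"
  proof (rule dominated_right_limit[where l = "- h" and h = "- l" and V = "\<lambda>x. - V (- x)"])
    show "\<bar>g (- t) - g (- s)\<bar> \<le> - V (- t) - - V (- s)" if "- h \<le> s" "s \<le> t" "t \<le> - l" for s t
      using dom[of "- t" "- s"] that by simp
  qed (use assms in auto)
  then have "(g \<longlongrightarrow> rlim (\<lambda>x. g (- x)) (- c)) (at_left c)"
    by (simp add: filterlim_at_left_to_right)
  then show ?thesis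
    unfolding llim_def by (simp add: tendsto_Lim trivial_limit_at_left_real)
qed

text \<open>The value of \<open>g\<close> at a jump point need not be one of its one-sided limits,
  so a jump has two halves. The half that would leave the interval is set to 0, in agreement with
  the end point conventions of \<open>jump_at\<close>.\<close>

definition left_jump :: "real \<Rightarrow> (real \<Rightarrow> real) \<Rightarrow> real \<Rightarrow> real" where
  "left_jump l g c = (if l < c then g c - llim g c else 0)"

definition right_jump :: "real \<Rightarrow> (real \<Rightarrow> real) \<Rightarrow> real \<Rightarrow> real" where
  "right_jump h g c = (if c < h then rlim g c - g c else 0)"

text \<open>Jumps at different points use up disjoint portions of the increase of \<open>V\<close>.
  The induction adds the points from left to right.\<close>

lemma sum_jumps_le:
  assumes dom: "\<And>s t. l \<le> s \<Longrightarrow> s \<le> t \<Longrightarrow> t \<le> h \<Longrightarrow> \<bar>g t - g s\<bar> \<le> V t - V s"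
    and F: "finite F" "F \<subseteq> {l..h}" and "l < h"
  shows "(\<Sum>c\<in>F. \<bar>left_jump l g c\<bar> + \<bar>right_jump h g c\<bar>) \<le> V h - V l"
proof -
  let ?w = "\<lambda>c. \<bar>left_jump l g c\<bar> + \<bar>right_jump h g c\<bar>"
  have nonneg: "V s \<le> V t" if "l \<le> s" "s \<le> t" "t \<le> h" for s t
    using dom[OF that] by (meson abs_ge_zero diff_ge_0_iff_ge order.trans)
  have left_lim: "((\<lambda>y. \<bar>g m - g y\<bar>) \<longlongrightarrow> \<bar>left_jump l g m\<bar>) (at_left m)" if "l < m" "m \<le> h" for m
    using dominated_left_limit[OF dom that] that unfolding left_jump_def
    by (auto intro!: tendsto_intros)
  have right: "\<bar>right_jump h g k\<bar> \<le> V y - V k" if "l \<le> k" "k < y" "y \<le> h" for k y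
  proof -
    have "k < h" using that by simp
    have "((\<lambda>s. \<bar>g s - g k\<bar>) \<longlongrightarrow> \<bar>right_jump h g k\<bar>) (at_right k)"
      using dominated_right_limit[OF dom \<open>l \<le> k\<close> \<open>k < h\<close>] \<open>k < h\<close> unfolding right_jump_def
      by (auto intro!: tendsto_intros)
    moreover have "\<forall>\<^sub>F s in at_right k. \<bar>g s - g k\<bar> \<le> V y - V k"
      unfolding eventually_at_right[OF that(2)]
    proof (intro exI[of _ y] conjI allI impI)
      fix s assume "k < s" "s < y"
      then show "\<bar>g s - g k\<bar> \<le> V y - V k" using dom[of k s] nonneg[of s y] that by auto
    qed fact
    ultimately show ?thesis by (rule tendsto_upperbound) simp
  qed
  \<comment> \<open>Whatever is already bounded by \<open>V y - V l\<close> for all \<open>y\<close>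
    just below \<open>m\<close> leaves the increase of \<open>V\<close> on \<open>{y..m}\<close> for
    the left jump at \<open>m\<close>, as \<open>y\<close> tends to \<open>m\<close>.\<close>
  have step: "T + \<bar>left_jump l g m\<bar> \<le> V m - V l"
    if T: "\<And>y. k < y \<Longrightarrow> y < m \<Longrightarrow> T \<le> V y - V l" and m: "l \<le> k" "k < m" "m \<le> h" for T k m
  proof -
    have "((\<lambda>y. T + \<bar>g m - g y\<bar>) \<longlongrightarrow> T + \<bar>left_jump l g m\<bar>) (at_left m)"
      using m by (intro tendsto_add tendsto_const left_lim) auto
    moreover have "\<forall>\<^sub>F y in at_left m. T + \<bar>g m - g y\<bar> \<le> V m - V l"
      unfolding eventually_at_left[OF m(2)]
    proof (intro exI[of _ k] conjI allI impI)
      fix y assume "k < y" "y < m"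
      then show "T + \<bar>g m - g y\<bar> \<le> V m - V l" using T[of y] dom[of y m] m by auto
    qed fact
    ultimately show ?thesis by (rule tendsto_upperbound) simp
  qed
  \<comment> \<open>The induction hypothesis carries the left jump at the free right end
    \<open>m\<close>. Applied at the largest point \<open>k\<close>, it yields both halves of the
    jump there, and a point \<open>y\<close> between \<open>k\<close> and \<open>m\<close> separates
    the right half from the next left half.\<close>
  have main: "(\<Sum>c\<in>F. ?w c) + \<bar>left_jump l g m\<bar> \<le> V m - V l"
    if "finite F" "F \<subseteq> {l..<m}" "l \<le> m" "m \<le> h" for F m
    using that
  proof (induction F arbitrary: m rule: finite_linorder_max_induct)
    case empty
    show ?case
    proof (cases "l = m")
      case False
      show ?thesis using step[of l m 0] nonneg False empty by simp
    qed (simp add: left_jump_def)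
  next
    case (insert k F)
    have k: "l \<le> k" "k < m" using insert by auto
    have IH: "(\<Sum>c\<in>F. ?w c) + \<bar>left_jump l g k\<bar> \<le> V k - V l"
      using insert k by (intro insert.IH) auto
    have "k \<notin> F" using insert by auto
    then have "(\<Sum>c\<in>insert k F. ?w c) = (\<Sum>c\<in>F. ?w c) + \<bar>left_jump l g k\<bar> + \<bar>right_jump h g k\<bar>"
      using insert by simp
    also have "\<dots> + \<bar>left_jump l g m\<bar> \<le> V m - V l"
    proof (rule step[OF _ k])
      fix y assume "k < y" "y < m"
      then show "(\<Sum>c\<in>F. ?w c) + \<bar>left_jump l g k\<bar> + \<bar>right_jump h g k\<bar> \<le> V y - V l"
        using right[of k y] k insert IH by auto
    qed (use insert in auto)
    finally show ?case .
  qed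
  \<comment> \<open>The end point \<open>h\<close> has no right jump, so its contribution is the
    extra left jump that \<open>main\<close> provides for \<open>m = h\<close>.\<close>
  have "(\<Sum>c\<in>F. ?w c) \<le> (\<Sum>c\<in>insert h (F - {h}). ?w c)"
    using F by (intro sum_mono2) auto
  also have "\<dots> = (\<Sum>c\<in>F - {h}. ?w c) + \<bar>left_jump l g h\<bar>"
    by (subst sum.insert) (use F in \<open>auto simp: right_jump_def\<close>)
  also have "\<dots> \<le> V h - V l" using F \<open>l < h\<close> by (intro main) auto
  finally show ?thesis .
qed

lemma jumps_summable:
  assumes "variation_le g l h M" "l < h"
  shows "(\<lambda>c. \<bar>left_jump l g c\<bar> + \<bar>right_jump h g c\<bar>) summable_on {l..h}"
proof -
  obtain V where V: "\<And>s t. l \<le> s \<Longrightarrow> s \<le> t \<Longrightarrow> t \<le> h \<Longrightarrow> \<bar>g t - g s\<bar> \<le> V t - V s"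
    using variation_le_dominating_mono[OF assms(1)] by blast
  show ?thesis
    using sum_jumps_le[OF V _ _ \<open>l < h\<close>]
    by (intro nonneg_bdd_above_summable_on bdd_aboveI[of _ "V h - V l"]) auto
qed

section \<open>The jump part as an unordered sum over jump points, and integration against
  it\<close>

lemma summable_on_bounded_by:
  fixes f :: "'a \<Rightarrow> 'b::banach"
  assumes "w summable_on A" "\<And>x. x \<in> A \<Longrightarrow> norm (f x) \<le> w x"
  shows "f summable_on A"
  using Infinite_Sum.abs_summable_on_comparison_test'[OF assms] abs_summable_summable by blast

text \<open>The share of the point \<open>c\<close> in the value of the jump part at
  \<open>x\<close>: the left half of a jump counts from \<open>c\<close> on, the right half only
  beyond \<open>c\<close>. The index set becomes all of \<open>{l..h}\<close> for every
  \<open>x\<close>, so values at different points can be subtracted termwise.\<close>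

definition saltus_term :: "real \<Rightarrow> real \<Rightarrow> (real \<Rightarrow> real) \<Rightarrow> real \<Rightarrow> real \<Rightarrow> real" where
  "saltus_term l h g x c = left_jump l g c * of_bool (c \<le> x) + right_jump h g c * of_bool (c < x)"

lemma has_sum_jump_part:
  assumes M: "variation_le g l h M" and "l < h" and x: "x \<in> {l..h}"
  shows "(saltus_term l h g x has_sum jump_part l g x) {l..h}"
proof (cases "x = l")
  case True
  then have "jump_part l g x = 0" by (simp add: jump_part_def)
  then show ?thesis using True by (auto intro!: has_sum_0 simp: saltus_term_def left_jump_def)
next
  case False
  then have lx: "l < x" "x \<le> h" using x by auto
  let ?j = "\<lambda>s. rlim g s - llim g s"
  have "(\<lambda>s. left_jump l g s + right_jump h g s) summable_on {l..h}"
    by (rule summable_on_bounded_by[OF jumps_summable[OF M \<open>l < h\<close>]]) auto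
  then have "(\<lambda>s. left_jump l g s + right_jump h g s) summable_on {l<..<x}"
    by (rule summable_on_subset_banach) (use lx in auto)
  then have "?j summable_on {l<..<x}"
    by (rule summable_on_cong[THEN iffD1, rotated]) (use lx in \<open>auto simp: left_jump_def right_jump_def\<close>)
  then have "(?j has_sum infsum ?j {l<..<x}) {l<..<x}" by simp
  then have 1: "(saltus_term l h g x has_sum infsum ?j {l<..<x}) {l<..<x}"
    by (rule has_sum_cong[THEN iffD1, rotated])
      (use lx in \<open>auto simp: saltus_term_def left_jump_def right_jump_def\<close>)
  \<comment> \<open>At the two ends only half a jump counts: the right half at \<open>l\<close> and
    the left half at \<open>x\<close>.\<close>
  have 2: "(saltus_term l h g x has_sum (rlim g l - g l) + (g x - llim g x)) {l, x}"
    using lx by (intro has_sum_finiteI) (auto simp: saltus_term_def left_jump_def right_jump_def)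
  have "(saltus_term l h g x has_sum infsum ?j {l<..<x} + ((rlim g l - g l) + (g x - llim g x)))
     ({l<..<x} \<union> {l, x})"
    by (rule has_sum_Un_disjoint[OF 1 2]) auto
  also have "infsum ?j {l<..<x} + ((rlim g l - g l) + (g x - llim g x)) = jump_part l g x"
    using lx by (simp add: jump_part_def)
  finally show ?thesis
    by (rule has_sum_cong_neutral[THEN iffD1, rotated -1])
      (use lx in \<open>auto simp: saltus_term_def\<close>)
qed

lemma has_sum_diff:
  fixes f :: "'a \<Rightarrow> 'b::topological_ab_group_add"
  assumes "(f has_sum s) A" "(g has_sum t) A"
  shows "((\<lambda>x. f x - g x) has_sum s - t) A"
  using has_sum_add[OF assms(1), of "\<lambda>x. - g x" "- t"] assms(2) by (simp add: has_sum_uminus)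

text \<open>A finite set carries all but \<open>e\<close> of the total mass. Near a given point,
  one-sided limits of the jump part only meet the remaining small jumps.\<close>

lemma summable_tail_small:
  fixes w :: "'a \<Rightarrow> real"
  assumes w: "w summable_on A" "\<And>x. x \<in> A \<Longrightarrow> 0 \<le> w x" and "e > 0"
  shows "\<exists>F. finite F \<and> (\<forall>B. B \<subseteq> A \<longrightarrow> B \<inter> F = {} \<longrightarrow> infsum w B \<le> e)"
proof -
  obtain F where F: "finite F" "F \<subseteq> A" "dist (sum w F) (infsum w A) \<le> e"
    using infsum_finite_approximation[OF w(1) \<open>e > 0\<close>] by blast
  have "infsum w B \<le> e" if B: "B \<subseteq> A" "B \<inter> F = {}" for B
  proof -
    have s: "w summable_on B" using summable_on_subset_banach[OF w(1) B(1)] .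
    have "infsum w B + sum w F = infsum w (B \<union> F)"
      using infsum_Un_disjoint[OF s _ B(2)] F by simp
    also have "\<dots> \<le> infsum w A"
      by (rule infsum_mono2) (use B F w summable_on_subset_banach[OF w(1)] in auto)
    finally show ?thesis using F(3) by (auto simp: dist_real_def)
  qed
  then show ?thesis using F(1) by blast
qed

lemma has_sum_indicator:
  assumes "c \<in> A" shows "((\<lambda>x. y * of_bool (x = c)) has_sum (y::real)) A"
proof -
  have "((\<lambda>x. y * of_bool (x = c)) has_sum y) {c}" by (rule has_sum_finiteI) auto
  then show ?thesis by (rule has_sum_cong_neutral[THEN iffD1, rotated -1]) (use assms in auto)
qed

text \<open>On \<open>{c<..y}\<close> with \<open>y\<close> close to \<open>c\<close>, every jump
  from a prescribed finite set is eventually missed, so the jumps met there have arbitrarily small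
  total size.\<close>

lemma jump_part_limits:
  assumes M: "variation_le g l h M" and "l < h" and c: "c \<in> {l..h}"
  shows "c < h \<Longrightarrow> (jump_part l g \<longlongrightarrow> jump_part l g c + right_jump h g c) (at_right c)"
    and "l < c \<Longrightarrow> (jump_part l g \<longlongrightarrow> jump_part l g c - left_jump l g c) (at_left c)"
proof -
  let ?w = "\<lambda>c. \<bar>left_jump l g c\<bar> + \<bar>right_jump h g c\<bar>"
  note sw = jumps_summable[OF M \<open>l < h\<close>]
  have w0: "0 \<le> ?w s" if "s \<in> {l..h}" for s by simp
  have ind: "((\<lambda>s. ?w s * of_bool (s \<in> B)) has_sum infsum ?w B) {l..h}" if "B \<subseteq> {l..h}" for B
  proof -
    have "(?w has_sum infsum ?w B) B"
      using summable_on_subset_banach[OF sw that] by simp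
    then show ?thesis by (rule has_sum_cong_neutral[THEN iffD1, rotated -1]) (use that in auto)
  qed
  show "(jump_part l g \<longlongrightarrow> jump_part l g c + right_jump h g c) (at_right c)" if "c < h"
  proof (rule tendstoI)
    fix e :: real assume "e > 0"
    then have "e / 2 > 0" by simp
    from summable_tail_small[OF sw w0 this] obtain F where F: "finite F"
      "\<forall>B. B \<subseteq> {l..h} \<longrightarrow> B \<inter> F = {} \<longrightarrow> infsum ?w B \<le> e / 2"
      by metis
    have "\<forall>x\<in>F. \<forall>\<^sub>F y in at_right c. x \<notin> {c<..y}"
    proof
      fix x show "\<forall>\<^sub>F y in at_right c. x \<notin> {c<..y}"
        unfolding eventually_at_right[OF \<open>c < h\<close>]
        by (rule exI[of _ "if x \<le> c then h else x"]) (use \<open>c < h\<close> in auto)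
    qed
    then have "\<forall>\<^sub>F y in at_right c. \<forall>x\<in>F. x \<notin> {c<..y}"
      using F(1) by (simp add: eventually_ball_finite)
    moreover have "\<forall>\<^sub>F y in at_right c. c < y \<and> y < h"
      unfolding eventually_at_right[OF \<open>c < h\<close>] using that by blast
    ultimately show "\<forall>\<^sub>F y in at_right c. dist (jump_part l g y) (jump_part l g c + right_jump h g c) < e"
    proof eventually_elim
      case (elim y)
      have y: "y \<in> {l..h}" using elim c by auto
      have sub: "{c<..y} \<subseteq> {l..h}" using elim c by auto
      \<comment> \<open>Once the right half of the jump at \<open>c\<close> itself is removed, the
        terms vanish outside \<open>{c<..y}\<close>.\<close>
      have "((\<lambda>s. saltus_term l h g y s - saltus_term l h g c s - right_jump h g c * of_bool (s = c))
         has_sum jump_part l g y - jump_part l g c - right_jump h g c) {l..h}"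
        by (intro has_sum_diff has_sum_jump_part[OF M \<open>l < h\<close>] has_sum_indicator y c)
      from this ind[OF sub]
      have "norm (jump_part l g y - jump_part l g c - right_jump h g c) \<le> infsum ?w {c<..y}"
        by (rule norm_infsum_le) (use elim in \<open>auto simp: saltus_term_def abs_triangle_ineq\<close>)
      also have "\<dots> \<le> e / 2" using F(2) sub elim by blast
      finally show ?case using \<open>e > 0\<close> by (simp add: dist_real_def algebra_simps)
    qed
  qed
  show "(jump_part l g \<longlongrightarrow> jump_part l g c - left_jump l g c) (at_left c)" if "l < c"
  proof (rule tendstoI)
    fix e :: real assume "e > 0"
    then have "e / 2 > 0" by simp
    from summable_tail_small[OF sw w0 this] obtain F where F: "finite F"
      "\<forall>B. B \<subseteq> {l..h} \<longrightarrow> B \<inter> F = {} \<longrightarrow> infsum ?w B \<le> e / 2"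
      by metis
    have "\<forall>x\<in>F. \<forall>\<^sub>F y in at_left c. x \<notin> {y..<c}"
    proof
      fix x show "\<forall>\<^sub>F y in at_left c. x \<notin> {y..<c}"
        unfolding eventually_at_left[OF \<open>l < c\<close>]
        by (rule exI[of _ "if c \<le> x then l else x"]) (use \<open>l < c\<close> in auto)
    qed
    then have "\<forall>\<^sub>F y in at_left c. \<forall>x\<in>F. x \<notin> {y..<c}"
      using F(1) by (simp add: eventually_ball_finite)
    moreover have "\<forall>\<^sub>F y in at_left c. l < y \<and> y < c"
      unfolding eventually_at_left[OF \<open>l < c\<close>] using that by blast
    ultimately show "\<forall>\<^sub>F y in at_left c. dist (jump_part l g y) (jump_part l g c - left_jump l g c) < e"
    proof eventually_elim
      case (elim y)
      have y: "y \<in> {l..h}" using elim c by auto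
      have sub: "{y..<c} \<subseteq> {l..h}" using elim c by auto
      have "((\<lambda>s. saltus_term l h g c s - saltus_term l h g y s - left_jump l g c * of_bool (s = c))
         has_sum jump_part l g c - jump_part l g y - left_jump l g c) {l..h}"
        by (intro has_sum_diff has_sum_jump_part[OF M \<open>l < h\<close>] has_sum_indicator y c)
      from this ind[OF sub]
      have "norm (jump_part l g c - jump_part l g y - left_jump l g c) \<le> infsum ?w {y..<c}"
        by (rule norm_infsum_le) (use elim in \<open>auto simp: saltus_term_def abs_triangle_ineq\<close>)
      also have "\<dots> \<le> e / 2" using F(2) sub elim by blast
      finally show ?case using \<open>e > 0\<close> unfolding dist_real_def real_norm_def by linarith
    qed
  qed
qed

text \<open>Translates the jumps of the jump part, to which \<open>A3_jumps\<close> refers, into the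
  one-sided jumps of \<open>g\<close>.\<close>

lemma jump_at_jump_part:
  assumes M: "variation_le g l h M" and "l < h" and c: "c \<in> {l..h}"
  shows "jump_at l h (jump_part l g) c = left_jump l g c + right_jump h g c"
proof -
  have "(if c < h then rlim (jump_part l g) c else jump_part l g h) = jump_part l g c + right_jump h g c"
    using jump_part_limits(1)[OF assms] c
    by (auto simp: rlim_def tendsto_Lim trivial_limit_at_right_real right_jump_def)
  moreover have "(if l < c then llim (jump_part l g) c else jump_part l g l) = jump_part l g c - left_jump l g c"
    using jump_part_limits(2)[OF assms] c
    by (auto simp: llim_def tendsto_Lim trivial_limit_at_left_real left_jump_def)
  ultimately show ?thesis unfolding jump_at_def by simp
qed

lemma has_sum_finite_sum:
  fixes f :: "'i \<Rightarrow> 'a \<Rightarrow> 'b::topological_comm_monoid_add"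
  assumes "finite I" "\<And>i. i \<in> I \<Longrightarrow> (f i has_sum s i) A"
  shows "((\<lambda>x. \<Sum>i\<in>I. f i x) has_sum (\<Sum>i\<in>I. s i)) A"
  using assms by (induction I rule: finite_induct) (auto intro: has_sum_add)

text \<open>The Stieltjes sum is exchanged with the sum over jump points. For fixed \<open>c\<close>
  the increments of the saltus terms telescope to the whole jump and sit in cells that contain
  \<open>c\<close>, where the tag is within the mesh of \<open>c\<close>; uniform continuity bounds
  the error by \<open>e'\<close> times the size of the jump.\<close>

lemma has_RS_integral_jump_part:
  fixes f :: "real \<Rightarrow> 'x::banach"
  assumes M: "variation_le g l h M" and "l < h" and f: "continuous_on {l..h} f"
    and I: "((\<lambda>c. (left_jump l g c + right_jump h g c) *\<^sub>R f c) has_sum I) {l..h}"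
  shows "has_RS_integral f (jump_part l g) l h I"
  unfolding has_RS_integral_def
proof (intro allI impI)
  fix e :: real assume "e > 0"
  let ?w = "\<lambda>c. \<bar>left_jump l g c\<bar> + \<bar>right_jump h g c\<bar>"
  let ?t = "saltus_term l h g"
  define W where "W = infsum ?w {l..h}"
  have W: "0 \<le> W" unfolding W_def by (rule infsum_nonneg) auto
  have hsw: "(?w has_sum W) {l..h}" using jumps_summable[OF M \<open>l < h\<close>] unfolding W_def by simp
  \<comment> \<open>Division by \<open>W + 1\<close> rather than \<open>W\<close> admits the case
    without jumps and makes the final inequality strict.\<close>
  define e' where "e' = e / (W + 1)"
  have e': "e' > 0" using \<open>e > 0\<close> W by (simp add: e'_def)
  have "uniformly_continuous_on {l..h} f" using f by (simp add: compact_uniformly_continuous)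
  then obtain d where d: "d > 0" "\<And>s t. s \<in> {l..h} \<Longrightarrow> t \<in> {l..h} \<Longrightarrow> dist t s < d \<Longrightarrow> dist (f t) (f s) < e'"
    using e' unfolding uniformly_continuous_on_def by meson
  show "\<exists>\<delta>>0. \<forall>x \<xi> n. tagged_partition l h \<delta> x \<xi> n \<longrightarrow>
      norm ((\<Sum>i<n. (jump_part l g (x (Suc i)) - jump_part l g (x i)) *\<^sub>R f (\<xi> i)) - I) < e"
  proof (intro exI[of _ d] conjI allI impI)
    fix x \<xi> n assume t: "tagged_partition l h d x \<xi> n"
    have xb: "x i \<in> {l..h}" if "i \<le> n" for i using tagged_partition_in_interval[OF t that] by simp
    have "((\<lambda>c. (?t (x (Suc i)) c - ?t (x i) c) *\<^sub>R f (\<xi> i)) has_sum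
       (jump_part l g (x (Suc i)) - jump_part l g (x i)) *\<^sub>R f (\<xi> i)) {l..h}" if "i < n" for i
      by (rule has_sum_bounded_linear[OF bounded_linear_scaleR_left, unfolded o_def])
        (use that xb in \<open>auto intro!: has_sum_diff has_sum_jump_part[OF M \<open>l < h\<close>]\<close>)
    then have "((\<lambda>c. (\<Sum>i<n. (?t (x (Suc i)) c - ?t (x i) c) *\<^sub>R f (\<xi> i)) -
           (left_jump l g c + right_jump h g c) *\<^sub>R f c) has_sum
        (\<Sum>i<n. (jump_part l g (x (Suc i)) - jump_part l g (x i)) *\<^sub>R f (\<xi> i)) - I) {l..h}"
      by (intro has_sum_diff[OF has_sum_finite_sum I]) auto
    from this has_sum_cmult_right[OF hsw, of e']
    have "norm ((\<Sum>i<n. (jump_part l g (x (Suc i)) - jump_part l g (x i)) *\<^sub>R f (\<xi> i)) - I) \<le> e' * W"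
    proof (rule norm_infsum_le)
      fix c assume c: "c \<in> {l..h}"
      have ends: "x 0 = l" "x n = h" using t by (auto simp: tagged_partition_def)
      have "(\<Sum>i<n. ?t (x (Suc i)) c - ?t (x i) c) = ?t h c - ?t l c"
        by (simp add: sum_lessThan_telescope[of "\<lambda>i. ?t (x i) c"] ends)
      also have "\<dots> = left_jump l g c + right_jump h g c"
        using c by (auto simp: saltus_term_def left_jump_def right_jump_def)
      finally have eq: "(\<Sum>i<n. (?t (x (Suc i)) c - ?t (x i) c) *\<^sub>R f (\<xi> i)) - (left_jump l g c + right_jump h g c) *\<^sub>R f c
         = (\<Sum>i<n. (?t (x (Suc i)) c - ?t (x i) c) *\<^sub>R (f (\<xi> i) - f c))"
        by (simp add: scaleR_diff_right sum_subtractf flip: scaleR_left.sum)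
      have le: "norm (\<Sum>i<n. (?t (x (Suc i)) c - ?t (x i) c) *\<^sub>R (f (\<xi> i) - f c))
        \<le> (\<Sum>i<n. e' * ((\<bar>left_jump l g c\<bar> * of_bool (c \<le> x (Suc i)) + \<bar>right_jump h g c\<bar> * of_bool (c < x (Suc i)))
         - (\<bar>left_jump l g c\<bar> * of_bool (c \<le> x i) + \<bar>right_jump h g c\<bar> * of_bool (c < x i))))"
      proof (intro order.trans[OF norm_sum] sum_mono)
        fix i assume i: "i \<in> {..<n}"
        have xs: "x i < x (Suc i)" "x (Suc i) - x i < d" "x i \<le> \<xi> i" "\<xi> i \<le> x (Suc i)"
          using t i by (auto simp: tagged_partition_def)
        have xi: "\<xi> i \<in> {l..h}" using tagged_partition_tag_in_interval[OF t] i by auto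
        let ?L = "left_jump l g c" let ?R = "right_jump h g c"
        let ?D = "\<lambda>L R. (L * of_bool (c \<le> x (Suc i)) + R * of_bool (c < x (Suc i)))
         - (L * of_bool (c \<le> x i) + R * of_bool (c < x i))"
        \<comment> \<open>A partition point \<open>c\<close> sends its left half to the cell ending
          at \<open>c\<close> and its right half to the cell starting there. As both indicators
          increase along the partition, absolute values may be taken half by half.\<close>
        have le: "\<bar>?D ?L ?R\<bar> \<le> ?D \<bar>?L\<bar> \<bar>?R\<bar>" using xs by (auto simp: abs_triangle_ineq)
        show "norm ((?t (x (Suc i)) c - ?t (x i) c) *\<^sub>R (f (\<xi> i) - f c)) \<le> e' * ?D \<bar>?L\<bar> \<bar>?R\<bar>"
        proof (cases "x i \<le> c \<and> c \<le> x (Suc i)")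
          case True
          then have "dist (\<xi> i) c < d" using xs by (auto simp: dist_real_def)
          then have "norm (f (\<xi> i) - f c) \<le> e'" using d(2)[OF c xi] by (simp add: dist_norm)
          then have "\<bar>?D ?L ?R\<bar> * norm (f (\<xi> i) - f c) \<le> ?D \<bar>?L\<bar> \<bar>?R\<bar> * e'"
            using le by (intro mult_mono) auto
          then show ?thesis by (simp add: saltus_term_def mult.commute)
        next
          case False
          then show ?thesis using xs by (auto simp: saltus_term_def)
        qed
      qed
      have tel: "(\<Sum>i<n. e' * ((\<bar>left_jump l g c\<bar> * of_bool (c \<le> x (Suc i)) + \<bar>right_jump h g c\<bar> * of_bool (c < x (Suc i)))
         - (\<bar>left_jump l g c\<bar> * of_bool (c \<le> x i) + \<bar>right_jump h g c\<bar> * of_bool (c < x i))))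
         = e' * (\<bar>left_jump l g c\<bar> * of_bool (c \<le> h) + \<bar>right_jump h g c\<bar> * of_bool (c < h))
         - e' * (\<bar>left_jump l g c\<bar> * of_bool (c \<le> l) + \<bar>right_jump h g c\<bar> * of_bool (c < l))"
        using sum_lessThan_telescope[of "\<lambda>i. e' * (\<bar>left_jump l g c\<bar> * of_bool (c \<le> x i) + \<bar>right_jump h g c\<bar> * of_bool (c < x i))" n]
        unfolding ends right_diff_distrib .
      show "norm ((\<Sum>i<n. (?t (x (Suc i)) c - ?t (x i) c) *\<^sub>R f (\<xi> i)) -
           (left_jump l g c + right_jump h g c) *\<^sub>R f c) \<le> e' * ?w c"
        unfolding eq by (rule order.trans[OF le]) (use e' c in \<open>auto simp: tel\<close>)
    qed
    also have "\<dots> < e' * (W + 1)" using e' by simp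
    also have "\<dots> = e" using W by (simp add: e'_def)
    finally show "norm ((\<Sum>i<n. (jump_part l g (x (Suc i)) - jump_part l g (x i)) *\<^sub>R f (\<xi> i)) - I) < e" .
  qed fact
qed

text \<open>Several \<open>z k\<close> may coincide. Absolute convergence permits regrouping the
  series by the fibres of \<open>z\<close>; by \<open>jumps\<close>, the fibre over \<open>c\<close>
  adds up to the jump at \<open>c\<close>, and an empty fibre means no jump.\<close>

lemma has_RS_integral_jump_part_series:
  fixes f :: "real \<Rightarrow> 'x::banach"
  assumes M: "variation_le g l h M" and "l < h" and f: "continuous_on {l..h} f"
    and q: "summable (\<lambda>k. \<bar>q k\<bar>)" and z: "\<And>k::nat. z k \<in> {l..h}"
    and jumps: "\<And>c. c \<in> {l..h} \<Longrightarrow> jump_at l h (jump_part l g) c = (\<Sum>k. if z k = c then q k else 0)"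
  shows "has_RS_integral f (jump_part l g) l h (\<Sum>k. q k *\<^sub>R f (z k))"
proof (rule has_RS_integral_jump_part[OF M \<open>l < h\<close> f])
  have "compact (f ` {l..h})" using f by (simp add: compact_continuous_image)
  then obtain K where K: "\<And>x. x \<in> {l..h} \<Longrightarrow> norm (f x) \<le> K"
    using compact_imp_bounded bounded_iff by (metis imageI)
  have "summable (\<lambda>k. norm (q k *\<^sub>R f (z k)))"
  proof (rule summable_comparison_test'[where N = 0])
    show "summable (\<lambda>k. \<bar>q k\<bar> * K)" using q by (rule summable_mult2)
    show "norm (norm (q k *\<^sub>R f (z k))) \<le> \<bar>q k\<bar> * K" for k
      using K[OF z] by (simp add: mult_left_mono)
  qed
  then have hs: "((\<lambda>k. q k *\<^sub>R f (z k)) has_sum (\<Sum>k. q k *\<^sub>R f (z k))) UNIV"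
    by (intro norm_summable_imp_has_sum summable_sums) (auto intro: summable_norm_cancel)
  let ?\<Sigma> = "Sigma {l..h} (\<lambda>c. {k. z k = c})"
  have img: "(\<lambda>k. (z k, k)) ` UNIV = ?\<Sigma>" using z by auto
  have "((\<lambda>(c, k). q k *\<^sub>R f c) has_sum (\<Sum>k. q k *\<^sub>R f (z k))) ?\<Sigma>"
    unfolding img[symmetric] by (subst has_sum_reindex) (use hs in \<open>auto simp: inj_on_def o_def\<close>)
  then show "((\<lambda>c. (left_jump l g c + right_jump h g c) *\<^sub>R f c) has_sum (\<Sum>k. q k *\<^sub>R f (z k))) {l..h}"
  proof (rule has_sum_SigmaD)
    fix c assume c: "c \<in> {l..h}"
    let ?q = "\<lambda>k. if z k = c then q k else 0"
    have "summable (\<lambda>k. norm (?q k))"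
      by (rule summable_comparison_test'[OF q, where N = 0]) auto
    then have "(?q has_sum (\<Sum>k. ?q k)) UNIV"
      by (intro norm_summable_imp_has_sum summable_sums) (auto intro: summable_norm_cancel)
    then have "(q has_sum (\<Sum>k. ?q k)) {k. z k = c}"
      by (rule has_sum_cong_neutral[THEN iffD1, rotated -1]) auto
    then have "((\<lambda>k. q k *\<^sub>R f c) has_sum (\<Sum>k. ?q k) *\<^sub>R f c) {k. z k = c}"
      using has_sum_bounded_linear[OF bounded_linear_scaleR_left, unfolded o_def] by blast
    moreover have "(\<Sum>k. ?q k) = left_jump l g c + right_jump h g c"
      using jumps[OF c] jump_at_jump_part[OF M \<open>l < h\<close> c] by simp
    ultimately show "((\<lambda>k. case (c, k) of (c, k) \<Rightarrow> q k *\<^sub>R f c) has_sum (left_jump l g c + right_jump h g c) *\<^sub>R f c)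
        {k. z k = c}" by simp
  qed
qed

section \<open>Continuity and Lipschitz properties of the nonlinearity\<close>

lemma Cspace_continuous: "\<psi> \<in> Cspace r \<Longrightarrow> continuous_on {-r..0} \<psi>"
  by (simp add: Cspace_def)

lemma Cspace_diff: "\<phi> \<in> Cspace r \<Longrightarrow> \<psi> \<in> Cspace r \<Longrightarrow> \<phi> - \<psi> \<in> Cspace r"
  by (auto simp: Cspace_def fun_diff_def intro!: continuous_intros)

lemma norm_le_normC:
  assumes "\<psi> \<in> Cspace r" "\<theta> \<in> {-r..0}"
  shows "norm (\<psi> \<theta>) \<le> normC r \<psi>"
proof -
  have "continuous_on {-r..0} (\<lambda>\<theta>. norm (\<psi> \<theta>))"
    using assms(1) by (intro continuous_intros Cspace_continuous)
  then have "compact ((\<lambda>\<theta>. norm (\<psi> \<theta>)) ` {-r..0})" by (simp add: compact_continuous_image)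
  then show ?thesis
    unfolding normC_def using assms(2)
    by (intro cSup_upper) (auto intro: bounded_imp_bdd_above compact_imp_bounded)
qed

lemma normC_le:
  assumes "0 \<le> r" "\<And>\<theta>. \<theta> \<in> {-r..0} \<Longrightarrow> norm (\<psi> \<theta>) \<le> K"
  shows "normC r \<psi> \<le> K"
  unfolding normC_def by (rule cSup_least) (use assms in auto)

lemma normC_nonneg: "0 \<le> r \<Longrightarrow> \<psi> \<in> Cspace r \<Longrightarrow> 0 \<le> normC r \<psi>"
  using order.trans[OF norm_ge_zero norm_le_normC[of \<psi> r 0]] by simp

lemma normC_triangle:
  assumes "0 \<le> r" "\<phi> \<in> Cspace r" "\<psi> \<in> Cspace r"
  shows "normC r \<psi> \<le> normC r \<phi> + normC r (\<psi> - \<phi>)"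
proof (rule normC_le[OF \<open>0 \<le> r\<close>])
  fix \<theta> assume \<theta>: "\<theta> \<in> {-r..0}"
  have "norm (\<psi> \<theta>) \<le> norm (\<phi> \<theta>) + norm ((\<psi> - \<phi>) \<theta>)"
    using norm_triangle_ineq[of "\<phi> \<theta>" "(\<psi> - \<phi>) \<theta>"] by simp
  also have "\<dots> \<le> normC r \<phi> + normC r (\<psi> - \<phi>)"
    using assms \<theta> by (intro add_mono norm_le_normC Cspace_diff)
  finally show "norm (\<psi> \<theta>) \<le> normC r \<phi> + normC r (\<psi> - \<phi>)" .
qed

lemma contRC_tendsto:
  assumes f: "contRC r f" and \<phi>: "\<phi> \<in> Cspace r" "\<And>n. \<psi> n \<in> Cspace r"
    and s: "s \<longlonglongrightarrow> t" and \<psi>: "(\<lambda>n. normC r (\<psi> n - \<phi>)) \<longlonglongrightarrow> 0"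
  shows "(\<lambda>n. f (s n) (\<psi> n)) \<longlonglongrightarrow> f t \<phi>"
proof (rule tendstoI)
  fix e :: real assume "e > 0"
  then obtain d where d: "d > 0" "\<And>s \<psi>. \<psi> \<in> Cspace r \<Longrightarrow> \<bar>s - t\<bar> < d \<Longrightarrow> normC r (\<psi> - \<phi>) < d
      \<Longrightarrow> dist (f s \<psi>) (f t \<phi>) < e"
    using f \<phi>(1) unfolding contRC_def by meson
  have "\<forall>\<^sub>F n in sequentially. dist (s n) t < d" using s d(1) by (rule tendstoD)
  moreover have "\<forall>\<^sub>F n in sequentially. normC r (\<psi> n - \<phi>) < d"
    using order_tendstoD(2)[OF \<psi> d(1)] .
  ultimately show "\<forall>\<^sub>F n in sequentially. dist (f (s n) (\<psi> n)) (f t \<phi>) < e"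
    by eventually_elim (use d(2) \<phi>(2) in \<open>auto simp: dist_real_def\<close>)
qed

text \<open>Isolates the study of \<open>B\<close> from the evolution problem: its outcome is
  sequential continuity, a Lipschitz bound for states with the same past, and boundedness on bounded
  sets.\<close>

locale delay_nonlinearity =
  fixes r a M_Vg L_Vgc L_p C\<^sub>1 C\<^sub>2 :: real
    and g :: "real \<Rightarrow> real \<Rightarrow> (real \<Rightarrow> 'x::banach) \<Rightarrow> real"
    and \<eta> h :: "nat \<Rightarrow> real \<Rightarrow> (real \<Rightarrow> 'x) \<Rightarrow> real"
    and \<eta>_ign :: "real \<Rightarrow> real"
    and p :: "real \<Rightarrow> 'x \<Rightarrow> 'x"
    and G :: "real \<Rightarrow> 'x \<Rightarrow> 'x \<Rightarrow> 'x"
    and B :: "real \<Rightarrow> (real \<Rightarrow> 'x) \<Rightarrow> 'x"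
  assumes r_pos: "r > 0"
    and A1: "\<And>t \<phi>. \<phi> \<in> Cspace r \<Longrightarrow> variation_le (\<lambda>\<theta>. g \<theta> t \<phi>) (-r) 0 M_Vg"
    and A3_cont: "\<And>k. contRC r (\<eta> k) \<and> contRC r (h k)"
    and A3_range: "\<And>k t \<phi>. \<phi> \<in> Cspace r \<Longrightarrow> \<eta> k t \<phi> \<in> {0..r}"
    and A3_jumps: "\<And>t \<phi> \<theta>. \<phi> \<in> Cspace r \<Longrightarrow> \<theta> \<in> {-r..0} \<Longrightarrow>
        jump_at (-r) 0 (jump_part (-r) (\<lambda>\<sigma>. g \<sigma> t \<phi>)) \<theta>
          = (\<Sum>k. if - \<eta> k t \<phi> = \<theta> then h k t \<phi> else 0)"
    and A3_summable: "\<And>t \<phi>. \<phi> \<in> Cspace r \<Longrightarrow> summable (\<lambda>k. \<bar>h k t \<phi>\<bar>)"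
    and A3_uniform: "\<And>R \<epsilon>. \<epsilon> > 0 \<Longrightarrow> \<exists>N. \<forall>n\<ge>N. \<forall>t \<phi>. \<phi> \<in> Cspace r \<and> \<bar>t\<bar> \<le> R \<and> normC r \<phi> \<le> R
        \<longrightarrow> (\<Sum>k. \<bar>h (k + n) t \<phi>\<bar>) < \<epsilon>"
    and A4_nonneg: "L_Vgc \<ge> 0"
    and A4: "\<And>t\<^sub>1 t\<^sub>2 \<phi> \<psi>. t\<^sub>1 \<ge> a \<Longrightarrow> t\<^sub>2 \<ge> a \<Longrightarrow> \<phi> \<in> Cspace r \<Longrightarrow> \<psi> \<in> Cspace r \<Longrightarrow>
        variation_le (\<lambda>\<theta>. cont_part (-r) (\<lambda>\<sigma>. g \<sigma> t\<^sub>1 \<phi>) \<theta> - cont_part (-r) (\<lambda>\<sigma>. g \<sigma> t\<^sub>2 \<psi>) \<theta>)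
          (-r) 0 (L_Vgc * (\<bar>t\<^sub>1 - t\<^sub>2\<bar> + normC r (\<phi> - \<psi>)))"
    and A5: "\<And>t \<phi>\<^sub>1 \<phi>\<^sub>2 k. t \<ge> a \<Longrightarrow> \<phi>\<^sub>1 \<in> Cspace r \<Longrightarrow> \<phi>\<^sub>2 \<in> Cspace r \<Longrightarrow>
        (\<forall>\<theta>\<in>{-r..-\<eta>_ign t}. \<phi>\<^sub>1 \<theta> = \<phi>\<^sub>2 \<theta>) \<Longrightarrow>
        \<eta> k t \<phi>\<^sub>1 = \<eta> k t \<phi>\<^sub>2 \<and> h k t \<phi>\<^sub>1 = h k t \<phi>\<^sub>2"
    and Lp_nonneg: "L_p \<ge> 0"
    and p_lip: "\<And>t s u v. norm (p t u - p s v) \<le> L_p * (\<bar>s - t\<bar> + norm (u - v))"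
    and C_nonneg: "C\<^sub>1 \<ge> 0" "C\<^sub>2 \<ge> 0"
    and p_growth: "\<And>s u. norm (p s u) \<le> C\<^sub>1 * norm u + C\<^sub>2"
    and G_cont: "continuous_on UNIV (\<lambda>(t, u, v). G t u v)"
    and G_loclip: "\<And>R. R > 0 \<Longrightarrow> \<exists>L>0. \<forall>t u\<^sub>1 u\<^sub>2 v\<^sub>1 v\<^sub>2. t > a \<and> norm u\<^sub>1 \<le> R \<and> norm u\<^sub>2 \<le> R
        \<and> norm v\<^sub>1 \<le> R \<and> norm v\<^sub>2 \<le> R \<longrightarrow>
        norm (G t u\<^sub>1 v\<^sub>1 - G t u\<^sub>2 v\<^sub>2) \<le> L * (norm (u\<^sub>1 - u\<^sub>2) + norm (v\<^sub>1 - v\<^sub>2))"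
    and B_def: "\<And>t \<psi>. B t \<psi> = G t (\<psi> 0) (RS_integral (\<lambda>\<theta>. p t (\<psi> \<theta>)) (\<lambda>\<theta>. g \<theta> t \<psi>) (-r) 0)"
begin

section \<open>Splitting and continuity of the Stieltjes functional\<close>

definition F :: "real \<Rightarrow> (real \<Rightarrow> 'x) \<Rightarrow> 'x" where
  "F t \<psi> = RS_integral (\<lambda>\<theta>. p t (\<psi> \<theta>)) (\<lambda>\<theta>. g \<theta> t \<psi>) (-r) 0"

text \<open>The state that determines delays and jumps is kept apart from the integrand, since
  estimates below sum one frozen integrand against the jump data of two states.\<close>

definition jump_series :: "real \<Rightarrow> (real \<Rightarrow> 'x) \<Rightarrow> (real \<Rightarrow> 'x) \<Rightarrow> 'x" where
  "jump_series t \<psi> f = (\<Sum>k. h k t \<psi> *\<^sub>R f (- \<eta> k t \<psi>))"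

lemma M_nonneg: "0 \<le> M_Vg"
proof -
  have "(\<lambda>_. 0) \<in> Cspace r" by (auto simp: Cspace_def)
  then show ?thesis using variation_le_nonneg[OF A1] r_pos by (metis less_imp_le neg_le_0_iff_le)
qed

lemma integrand_continuous:
  assumes "\<psi> \<in> Cspace r"
  shows "continuous_on {-r..0} (\<lambda>\<theta>. p t (\<psi> \<theta>))"
proof -
  have "L_p-lipschitz_on UNIV (p t)"
    using p_lip[of t _ t] Lp_nonneg by (intro lipschitz_onI) (auto simp: dist_norm)
  then have "continuous_on UNIV (p t)" by (rule lipschitz_on_continuous_on)
  then show ?thesis by (rule continuous_on_compose2[OF _ Cspace_continuous[OF assms]]) auto
qed

lemma integrand_bound:
  assumes "\<psi> \<in> Cspace r" "\<theta> \<in> {-r..0}"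
  shows "norm (p t (\<psi> \<theta>)) \<le> C\<^sub>1 * normC r \<psi> + C\<^sub>2"
  using p_growth[of t "\<psi> \<theta>"] mult_left_mono[OF norm_le_normC[OF assms] C_nonneg(1)] by linarith

lemma has_RS_integral_g:
  fixes f :: "real \<Rightarrow> 'x"
  assumes "\<psi> \<in> Cspace r" "continuous_on {-r..0} f"
  shows "has_RS_integral f (\<lambda>\<theta>. g \<theta> t \<psi>) (-r) 0 (RS_integral f (\<lambda>\<theta>. g \<theta> t \<psi>) (-r) 0)"
  by (rule has_RS_integral_RS_integral[OF _ assms(2) A1[OF assms(1)]]) (use r_pos in simp)

text \<open>By subtraction: the integral against \<open>g\<close> exists by (A1), the one against
  the jump part is the series by (A3).\<close>

lemma has_RS_integral_cont_part:
  fixes f :: "real \<Rightarrow> 'x"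
  assumes \<psi>: "\<psi> \<in> Cspace r" and f: "continuous_on {-r..0} f"
  shows "has_RS_integral f (cont_part (-r) (\<lambda>\<sigma>. g \<sigma> t \<psi>)) (-r) 0
     (RS_integral f (\<lambda>\<theta>. g \<theta> t \<psi>) (-r) 0 - jump_series t \<psi> f)"
proof -
  have "has_RS_integral f (jump_part (-r) (\<lambda>\<sigma>. g \<sigma> t \<psi>)) (-r) 0 (jump_series t \<psi> f)"
    unfolding jump_series_def
    by (rule has_RS_integral_jump_part_series[OF A1[OF \<psi>] _ f A3_summable[OF \<psi>]])
      (use A3_jumps[OF \<psi>] A3_range[OF \<psi>] r_pos in auto)
  from has_RS_integral_diff_integrator[OF has_RS_integral_g[OF \<psi> f] this]
  show ?thesis by (simp add: cont_part_def[abs_def])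
qed

lemma F_bound:
  assumes "\<psi> \<in> Cspace r"
  shows "norm (F t \<psi>) \<le> M_Vg * (C\<^sub>1 * normC r \<psi> + C\<^sub>2)"
  unfolding F_def
  by (rule has_RS_integral_norm_le[OF _ has_RS_integral_g[OF assms integrand_continuous[OF assms]] A1[OF assms]])
    (use integrand_bound[OF assms] r_pos in auto)

text \<open>First the integrand is exchanged under the integrator of the first state, at the cost of
  the Lipschitz constant of \<open>p\<close> times the variation bound. Then the integrator is
  exchanged with the integrand frozen at the second state: (A4) controls the continuous part, and
  the growth of \<open>p\<close> supplies the factor with \<open>normC r \<psi>\<close>. The jump
  term is left as it stands, for want of a Lipschitz bound.\<close>

lemma F_diff_bound:
  assumes t: "t\<^sub>1 \<ge> a" "t\<^sub>2 \<ge> a" and \<phi>: "\<phi> \<in> Cspace r" and \<psi>: "\<psi> \<in> Cspace r"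
  shows "norm (F t\<^sub>1 \<phi> - F t\<^sub>2 \<psi>) \<le>
     (M_Vg * L_p + L_Vgc * (C\<^sub>1 * normC r \<psi> + C\<^sub>2)) * (\<bar>t\<^sub>1 - t\<^sub>2\<bar> + normC r (\<phi> - \<psi>)) +
     norm (jump_series t\<^sub>1 \<phi> (\<lambda>\<theta>. p t\<^sub>2 (\<psi> \<theta>)) - jump_series t\<^sub>2 \<psi> (\<lambda>\<theta>. p t\<^sub>2 (\<psi> \<theta>)))"
proof -
  let ?f1 = "\<lambda>\<theta>. p t\<^sub>1 (\<phi> \<theta>)" and ?f2 = "\<lambda>\<theta>. p t\<^sub>2 (\<psi> \<theta>)"
  let ?d = "\<bar>t\<^sub>1 - t\<^sub>2\<bar> + normC r (\<phi> - \<psi>)"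
  have r: "- r < 0" using r_pos by simp
  note f1 = integrand_continuous[OF \<phi>, of t\<^sub>1] and f2 = integrand_continuous[OF \<psi>, of t\<^sub>2]
  let ?I = "RS_integral ?f2 (\<lambda>\<theta>. g \<theta> t\<^sub>1 \<phi>) (-r) 0"
  have "norm (F t\<^sub>1 \<phi> - ?I) \<le> M_Vg * (L_p * ?d)"
    unfolding F_def
  proof (rule has_RS_integral_norm_le[OF r _ A1[OF \<phi>]])
    show "has_RS_integral (\<lambda>\<theta>. ?f1 \<theta> - ?f2 \<theta>) (\<lambda>\<theta>. g \<theta> t\<^sub>1 \<phi>) (-r) 0
       (RS_integral ?f1 (\<lambda>\<theta>. g \<theta> t\<^sub>1 \<phi>) (-r) 0 - ?I)"
      by (intro has_RS_integral_diff_integrand has_RS_integral_g \<phi> f1 f2)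
    fix \<theta> assume \<theta>: "\<theta> \<in> {-r..0}"
    have "norm (\<phi> \<theta> - \<psi> \<theta>) \<le> normC r (\<phi> - \<psi>)"
      using norm_le_normC[OF Cspace_diff[OF \<phi> \<psi>] \<theta>] by simp
    then have "L_p * (\<bar>t\<^sub>2 - t\<^sub>1\<bar> + norm (\<phi> \<theta> - \<psi> \<theta>)) \<le> L_p * ?d"
      using Lp_nonneg by (intro mult_left_mono) auto
    then show "norm (?f1 \<theta> - ?f2 \<theta>) \<le> L_p * ?d" using p_lip[of t\<^sub>1 "\<phi> \<theta>" t\<^sub>2 "\<psi> \<theta>"] by linarith
  qed
  moreover have "norm ((?I - jump_series t\<^sub>1 \<phi> ?f2) - (F t\<^sub>2 \<psi> - jump_series t\<^sub>2 \<psi> ?f2))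
      \<le> (L_Vgc * ?d) * (C\<^sub>1 * normC r \<psi> + C\<^sub>2)"
    unfolding F_def
    by (rule has_RS_integral_norm_le[OF r has_RS_integral_diff_integrator[OF
          has_RS_integral_cont_part[OF \<phi> f2] has_RS_integral_cont_part[OF \<psi> f2]] A4[OF t \<phi> \<psi>]
          integrand_bound[OF \<psi>]])
  moreover have "F t\<^sub>1 \<phi> - F t\<^sub>2 \<psi> = (F t\<^sub>1 \<phi> - ?I) + ((?I - jump_series t\<^sub>1 \<phi> ?f2) - (F t\<^sub>2 \<psi> - jump_series t\<^sub>2 \<psi> ?f2))
     + (jump_series t\<^sub>1 \<phi> ?f2 - jump_series t\<^sub>2 \<psi> ?f2)" by simp
  ultimately have "norm (F t\<^sub>1 \<phi> - F t\<^sub>2 \<psi>) \<le> M_Vg * (L_p * ?d) + (L_Vgc * ?d) * (C\<^sub>1 * normC r \<psi> + C\<^sub>2)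
     + norm (jump_series t\<^sub>1 \<phi> ?f2 - jump_series t\<^sub>2 \<psi> ?f2)"
    using norm_triangle_ineq[of "F t\<^sub>1 \<phi> - ?I" "(?I - jump_series t\<^sub>1 \<phi> ?f2) - (F t\<^sub>2 \<psi> - jump_series t\<^sub>2 \<psi> ?f2)"]
      norm_triangle_ineq[of "(F t\<^sub>1 \<phi> - ?I) + ((?I - jump_series t\<^sub>1 \<phi> ?f2) - (F t\<^sub>2 \<psi> - jump_series t\<^sub>2 \<psi> ?f2))"
        "jump_series t\<^sub>1 \<phi> ?f2 - jump_series t\<^sub>2 \<psi> ?f2"]
    by (smt (verit))
  then show ?thesis by (simp add: algebra_simps)
qed

lemma F_lipschitz_same_past:
  assumes t: "t \<ge> a" and \<phi>: "\<phi> \<in> Cspace r" and \<psi>: "\<psi> \<in> Cspace r"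
    and past: "\<forall>\<theta>\<in>{-r..-\<eta>_ign t}. \<phi> \<theta> = \<psi> \<theta>"
  shows "norm (F t \<phi> - F t \<psi>) \<le> (M_Vg * L_p + L_Vgc * (C\<^sub>1 * normC r \<psi> + C\<^sub>2)) * normC r (\<phi> - \<psi>)"
proof -
  have "jump_series t \<phi> f = jump_series t \<psi> f" for f
    unfolding jump_series_def using A5[OF t \<phi> \<psi> past] by simp
  then show ?thesis using F_diff_bound[OF t t \<phi> \<psi>] by simp
qed

text \<open>Uniform smallness of the tails on bounded sets reduces the limit to finitely many terms,
  in which jumps and delays converge and \<open>f\<close> is continuous at the moving
  points.\<close>

lemma jump_series_tendsto:
  assumes \<phi>: "\<phi> \<in> Cspace r" "\<And>n. \<psi> n \<in> Cspace r"
    and s: "s \<longlonglongrightarrow> t" and \<psi>: "(\<lambda>n. normC r (\<psi> n - \<phi>)) \<longlonglongrightarrow> 0"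
    and f: "continuous_on {-r..0} f"
  shows "(\<lambda>n. jump_series (s n) (\<psi> n) f) \<longlonglongrightarrow> jump_series t \<phi> f"
proof (rule tendstoI)
  fix e :: real assume "e > 0"
  have "compact (f ` {-r..0})" using f by (simp add: compact_continuous_image)
  then obtain K where K: "K > 0" "\<And>x. x \<in> {-r..0} \<Longrightarrow> norm (f x) \<le> K"
    using compact_imp_bounded bounded_pos by (metis imageI)
  obtain R1 where R1: "\<And>n. \<bar>s n\<bar> \<le> R1"
    using convergent_imp_Bseq[of s] s unfolding convergent_def Bseq_def by (auto simp: real_norm_def)
  obtain R2 where R2: "\<And>n. \<bar>normC r (\<psi> n - \<phi>)\<bar> \<le> R2"
    using convergent_imp_Bseq[of "\<lambda>n. normC r (\<psi> n - \<phi>)"] \<psi> unfolding convergent_def Bseq_def by (auto simp: real_norm_def)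
  \<comment> \<open>One bounded set contains the limit and the whole sequence, so a single
    \<open>N\<close> cuts all tails.\<close>
  define R where "R = \<bar>t\<bar> + \<bar>R1\<bar> + normC r \<phi> + \<bar>R2\<bar>"
  have pos: "0 \<le> normC r \<phi>" using normC_nonneg[OF _ \<phi>(1)] r_pos by simp
  have bs: "\<bar>s n\<bar> \<le> R" "normC r (\<psi> n) \<le> R" for n
    using R1[of n] R2[of n] pos normC_triangle[OF _ \<phi>(1) \<phi>(2)[of n]] r_pos unfolding R_def by auto
  have bt: "\<bar>t\<bar> \<le> R" "normC r \<phi> \<le> R" using pos unfolding R_def by auto
  \<comment> \<open>The integrand multiplies tails of the jumps by at most \<open>K\<close>; two
    tails and the finite part then share \<open>e\<close> in thirds.\<close>
  have eK: "e / (3 * K) > 0" using \<open>e > 0\<close> K by simp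
  obtain N where N: "\<And>t \<phi>. \<phi> \<in> Cspace r \<Longrightarrow> \<bar>t\<bar> \<le> R \<Longrightarrow> normC r \<phi> \<le> R \<Longrightarrow> (\<Sum>k. \<bar>h (k + N) t \<phi>\<bar>) < e / (3 * K)"
    using A3_uniform[OF eK, of R] by blast
  have tail: "norm (jump_series t \<phi> f - (\<Sum>k<N. h k t \<phi> *\<^sub>R f (- \<eta> k t \<phi>))) < e / 3"
    if \<phi>: "\<phi> \<in> Cspace r" and "\<bar>t\<bar> \<le> R" "normC r \<phi> \<le> R" for t \<phi>
  proof -
    have le: "norm (h k t \<phi> *\<^sub>R f (- \<eta> k t \<phi>)) \<le> K * \<bar>h k t \<phi>\<bar>" for k
    proof -
      have "- \<eta> k t \<phi> \<in> {-r..0}" using A3_range[OF \<phi>] by auto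
      then have "\<bar>h k t \<phi>\<bar> * norm (f (- \<eta> k t \<phi>)) \<le> \<bar>h k t \<phi>\<bar> * K"
        using K(2) by (intro mult_left_mono) auto
      then show ?thesis by (simp add: mult.commute)
    qed
    have sh: "summable (\<lambda>k. K * \<bar>h k t \<phi>\<bar>)" using A3_summable[OF \<phi>] by (rule summable_mult)
    have sm: "summable (\<lambda>k. norm (h k t \<phi> *\<^sub>R f (- \<eta> k t \<phi>)))"
      by (rule summable_comparison_test'[OF sh, where N = 0]) (use le in auto)
    have "jump_series t \<phi> f - (\<Sum>k<N. h k t \<phi> *\<^sub>R f (- \<eta> k t \<phi>)) = (\<Sum>k. h (k + N) t \<phi> *\<^sub>R f (- \<eta> (k + N) t \<phi>))"
      unfolding jump_series_def
      using suminf_minus_initial_segment[OF summable_norm_cancel[OF sm], of N] by simp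
    also have "norm \<dots> \<le> (\<Sum>k. norm (h (k + N) t \<phi> *\<^sub>R f (- \<eta> (k + N) t \<phi>)))"
      using summable_ignore_initial_segment[OF sm, of N] by (rule summable_norm)
    also have "\<dots> \<le> (\<Sum>k. K * \<bar>h (k + N) t \<phi>\<bar>)"
      by (rule suminf_le[OF le summable_ignore_initial_segment[OF sm, of N] summable_ignore_initial_segment[OF sh, of N]])
    also have "\<dots> = K * (\<Sum>k. \<bar>h (k + N) t \<phi>\<bar>)"
      using summable_ignore_initial_segment[OF A3_summable[OF \<phi>], of N] by (rule suminf_mult)
    also have "\<dots> < K * (e / (3 * K))" using N[OF that] K(1) by (rule mult_strict_left_mono)
    also have "\<dots> = e / 3" using K(1) by simp
    finally show ?thesis .
  qed
  have "(\<lambda>n. \<Sum>k<N. h k (s n) (\<psi> n) *\<^sub>R f (- \<eta> k (s n) (\<psi> n))) \<longlonglongrightarrow> (\<Sum>k<N. h k t \<phi> *\<^sub>R f (- \<eta> k t \<phi>))"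
  proof (intro tendsto_sum tendsto_scaleR)
    fix k
    show "(\<lambda>n. h k (s n) (\<psi> n)) \<longlonglongrightarrow> h k t \<phi>"
      using contRC_tendsto[OF _ \<phi> s \<psi>] A3_cont by blast
    have "(\<lambda>n. - \<eta> k (s n) (\<psi> n)) \<longlonglongrightarrow> - \<eta> k t \<phi>"
      using contRC_tendsto[OF _ \<phi> s \<psi>] A3_cont by (intro tendsto_minus) blast
    then show "(\<lambda>n. f (- \<eta> k (s n) (\<psi> n))) \<longlonglongrightarrow> f (- \<eta> k t \<phi>)"
      by (rule continuous_on_tendsto_compose[OF f])
        (use A3_range[OF \<phi>(1)] A3_range[OF \<phi>(2)] in auto)
  qed
  then have "\<forall>\<^sub>F n in sequentially. dist (\<Sum>k<N. h k (s n) (\<psi> n) *\<^sub>R f (- \<eta> k (s n) (\<psi> n))) (\<Sum>k<N. h k t \<phi> *\<^sub>R f (- \<eta> k t \<phi>)) < e / 3"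
    by (rule tendstoD) (use \<open>e > 0\<close> in simp)
  then show "\<forall>\<^sub>F n in sequentially. dist (jump_series (s n) (\<psi> n) f) (jump_series t \<phi> f) < e"
  proof eventually_elim
    case (elim n)
    let ?S = "\<lambda>t \<phi>. \<Sum>k<N. h k t \<phi> *\<^sub>R f (- \<eta> k t \<phi>)"
    have "dist (jump_series (s n) (\<psi> n) f) (?S (s n) (\<psi> n)) < e / 3" "dist (jump_series t \<phi> f) (?S t \<phi>) < e / 3"
      using tail[OF \<phi>(2) bs] tail[OF \<phi>(1) bt] by (auto simp: dist_norm)
    with elim show ?case by metric
  qed
qed

lemma F_tendsto:
  assumes \<phi>: "\<phi> \<in> Cspace r" "\<And>n. \<psi> n \<in> Cspace r" and a: "t \<ge> a" "\<And>n. s n \<ge> a"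
    and s: "s \<longlonglongrightarrow> t" and \<psi>: "(\<lambda>n. normC r (\<psi> n - \<phi>)) \<longlonglongrightarrow> 0"
  shows "(\<lambda>n. F (s n) (\<psi> n)) \<longlonglongrightarrow> F t \<phi>"
proof (rule LIM_zero_cancel, rule Lim_null_comparison[OF always_eventually], rule allI)
  let ?K = "M_Vg * L_p + L_Vgc * (C\<^sub>1 * normC r \<phi> + C\<^sub>2)"
  let ?f = "\<lambda>\<theta>. p t (\<phi> \<theta>)"
  show "norm (F (s n) (\<psi> n) - F t \<phi>) \<le> ?K * (\<bar>s n - t\<bar> + normC r (\<psi> n - \<phi>)) +
     norm (jump_series (s n) (\<psi> n) ?f - jump_series t \<phi> ?f)" for n
    by (rule F_diff_bound) (use \<phi> a in auto)
  have "(\<lambda>n. \<bar>s n - t\<bar>) \<longlonglongrightarrow> \<bar>t - t\<bar>" using s by (intro tendsto_intros)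
  moreover have "(\<lambda>n. norm (jump_series (s n) (\<psi> n) ?f - jump_series t \<phi> ?f)) \<longlonglongrightarrow> norm (jump_series t \<phi> ?f - jump_series t \<phi> ?f)"
    by (intro tendsto_intros jump_series_tendsto \<phi> s \<psi> integrand_continuous)
  ultimately have "(\<lambda>n. ?K * (\<bar>s n - t\<bar> + normC r (\<psi> n - \<phi>)) + norm (jump_series (s n) (\<psi> n) ?f - jump_series t \<phi> ?f))
     \<longlonglongrightarrow> ?K * (\<bar>t - t\<bar> + 0) + norm (jump_series t \<phi> ?f - jump_series t \<phi> ?f)"
    using \<psi> by (intro tendsto_add tendsto_mult tendsto_const)
  then show "(\<lambda>n. ?K * (\<bar>s n - t\<bar> + normC r (\<psi> n - \<phi>)) + norm (jump_series (s n) (\<psi> n) ?f - jump_series t \<phi> ?f)) \<longlonglongrightarrow> 0"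
    by simp
qed

section \<open>Continuity, Lipschitz bound and boundedness of the composed nonlinearity\<close>

lemma G_tendsto:
  assumes "s \<longlonglongrightarrow> t" "u \<longlonglongrightarrow> x" "v \<longlonglongrightarrow> y"
  shows "(\<lambda>n. G (s n) (u n) (v n)) \<longlonglongrightarrow> G t x y"
  using continuous_on_tendsto_compose[OF G_cont tendsto_Pair[OF assms(1) tendsto_Pair[OF assms(2,3)]]]
  by simp

lemma B_tendsto:
  assumes \<phi>: "\<phi> \<in> Cspace r" "\<And>n. \<psi> n \<in> Cspace r" and a: "t \<ge> a" "\<And>n. s n \<ge> a"
    and s: "s \<longlonglongrightarrow> t" and \<psi>: "(\<lambda>n. normC r (\<psi> n - \<phi>)) \<longlonglongrightarrow> 0"
  shows "(\<lambda>n. B (s n) (\<psi> n)) \<longlonglongrightarrow> B t \<phi>"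
proof -
  have "(\<lambda>n. \<psi> n 0) \<longlonglongrightarrow> \<phi> 0"
  proof (rule LIM_zero_cancel, rule Lim_null_comparison[OF always_eventually \<psi>], rule allI)
    show "norm (\<psi> n 0 - \<phi> 0) \<le> normC r (\<psi> n - \<phi>)" for n
      using norm_le_normC[OF Cspace_diff[OF \<phi>(2) \<phi>(1)], of 0 n] r_pos by simp
  qed
  then show ?thesis
    unfolding B_def F_def[symmetric] by (intro G_tendsto s F_tendsto assms)
qed

text \<open>The Lipschitz hypothesis covers \<open>t > a\<close> only; continuity of
  \<open>G\<close> carries it to the initial time as a limit from the right, with the same
  constant.\<close>

lemma G_loclip_closed:
  assumes "R > 0"
  shows "\<exists>L>0. \<forall>t u\<^sub>1 u\<^sub>2 v\<^sub>1 v\<^sub>2. t \<ge> a \<and> norm u\<^sub>1 \<le> R \<and> norm u\<^sub>2 \<le> R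
        \<and> norm v\<^sub>1 \<le> R \<and> norm v\<^sub>2 \<le> R \<longrightarrow>
        norm (G t u\<^sub>1 v\<^sub>1 - G t u\<^sub>2 v\<^sub>2) \<le> L * (norm (u\<^sub>1 - u\<^sub>2) + norm (v\<^sub>1 - v\<^sub>2))"
proof -
  obtain L where L: "L > 0" "\<And>t u\<^sub>1 u\<^sub>2 v\<^sub>1 v\<^sub>2. t > a \<Longrightarrow> norm u\<^sub>1 \<le> R \<Longrightarrow> norm u\<^sub>2 \<le> R \<Longrightarrow>
      norm v\<^sub>1 \<le> R \<Longrightarrow> norm v\<^sub>2 \<le> R \<Longrightarrow>
      norm (G t u\<^sub>1 v\<^sub>1 - G t u\<^sub>2 v\<^sub>2) \<le> L * (norm (u\<^sub>1 - u\<^sub>2) + norm (v\<^sub>1 - v\<^sub>2))"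
    using G_loclip[OF assms] by blast
  have "norm (G t u\<^sub>1 v\<^sub>1 - G t u\<^sub>2 v\<^sub>2) \<le> L * (norm (u\<^sub>1 - u\<^sub>2) + norm (v\<^sub>1 - v\<^sub>2))"
    if "t \<ge> a" "norm u\<^sub>1 \<le> R" "norm u\<^sub>2 \<le> R" "norm v\<^sub>1 \<le> R" "norm v\<^sub>2 \<le> R" for t u\<^sub>1 u\<^sub>2 v\<^sub>1 v\<^sub>2
  proof (rule LIMSEQ_le_const2)
    have "(\<lambda>n. t + inverse (real (Suc n))) \<longlonglongrightarrow> t + 0"
      by (intro tendsto_add tendsto_const LIMSEQ_inverse_real_of_nat)
    then have s: "(\<lambda>n. t + inverse (real (Suc n))) \<longlonglongrightarrow> t" by simp
    show "(\<lambda>n. norm (G (t + inverse (real (Suc n))) u\<^sub>1 v\<^sub>1 - G (t + inverse (real (Suc n))) u\<^sub>2 v\<^sub>2))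
       \<longlonglongrightarrow> norm (G t u\<^sub>1 v\<^sub>1 - G t u\<^sub>2 v\<^sub>2)"
      by (intro tendsto_norm tendsto_diff G_tendsto s tendsto_const)
    show "\<exists>N. \<forall>n\<ge>N. norm (G (t + inverse (real (Suc n))) u\<^sub>1 v\<^sub>1 - G (t + inverse (real (Suc n))) u\<^sub>2 v\<^sub>2)
        \<le> L * (norm (u\<^sub>1 - u\<^sub>2) + norm (v\<^sub>1 - v\<^sub>2))"
    proof (intro exI allI impI L(2))
      show "a < t + inverse (real (Suc n))" for n
        using \<open>t \<ge> a\<close> by (smt (verit) inverse_positive_iff_positive of_nat_0_less_iff zero_less_Suc)
    qed (use that in auto)
  qed
  then show ?thesis using L(1) by blast
qed

lemma B_lipschitz_same_past:
  "\<exists>L\<ge>0. \<forall>t\<ge>a. \<forall>\<phi>\<in>Cspace r. \<forall>\<psi>\<in>Cspace r. normC r \<phi> \<le> R \<longrightarrow> normC r \<psi> \<le> R \<longrightarrow>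
     (\<forall>\<theta>\<in>{-r..-\<eta>_ign t}. \<phi> \<theta> = \<psi> \<theta>) \<longrightarrow> norm (B t \<phi> - B t \<psi>) \<le> L * normC r (\<phi> - \<psi>)"
  and B_bounded: "\<exists>K. \<forall>t\<in>{a..T}. \<forall>\<psi>\<in>Cspace r. normC r \<psi> \<le> R \<longrightarrow> norm (B t \<psi>) \<le> K"
proof -
  \<comment> \<open>Bounds both arguments that \<open>B\<close> passes to \<open>G\<close>: the
    value at 0, and \<open>F\<close> by the variation and growth bounds. The absolute value and the
    summand 1 keep it positive for every \<open>R\<close>.\<close>
  define R' where "R' = \<bar>R\<bar> + M_Vg * (C\<^sub>1 * \<bar>R\<bar> + C\<^sub>2) + 1"
  have pos: "0 \<le> M_Vg * (C\<^sub>1 * \<bar>R\<bar> + C\<^sub>2)" using M_nonneg C_nonneg by simp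
  then have R': "R' > 0" unfolding R'_def by simp
  obtain L where L: "L > 0" "\<And>t u\<^sub>1 u\<^sub>2 v\<^sub>1 v\<^sub>2. t \<ge> a \<Longrightarrow> norm u\<^sub>1 \<le> R' \<Longrightarrow> norm u\<^sub>2 \<le> R' \<Longrightarrow>
      norm v\<^sub>1 \<le> R' \<Longrightarrow> norm v\<^sub>2 \<le> R' \<Longrightarrow>
      norm (G t u\<^sub>1 v\<^sub>1 - G t u\<^sub>2 v\<^sub>2) \<le> L * (norm (u\<^sub>1 - u\<^sub>2) + norm (v\<^sub>1 - v\<^sub>2))"
    using G_loclip_closed[OF R'] by blast
  have bd: "norm (\<psi> 0) \<le> R'" "norm (F t \<psi>) \<le> R'" if "\<psi> \<in> Cspace r" "normC r \<psi> \<le> R" for t \<psi>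
  proof -
    show "norm (\<psi> 0) \<le> R'"
      using norm_le_normC[OF that(1), of 0] that(2) r_pos pos unfolding R'_def by simp
    have "C\<^sub>1 * normC r \<psi> \<le> C\<^sub>1 * \<bar>R\<bar>" using that C_nonneg by (intro mult_left_mono) auto
    then have "M_Vg * (C\<^sub>1 * normC r \<psi> + C\<^sub>2) \<le> M_Vg * (C\<^sub>1 * \<bar>R\<bar> + C\<^sub>2)"
      using M_nonneg by (intro mult_left_mono) auto
    then show "norm (F t \<psi>) \<le> R'" using F_bound[OF that(1), of t] unfolding R'_def by linarith
  qed
  define K where "K = M_Vg * L_p + L_Vgc * (C\<^sub>1 * \<bar>R\<bar> + C\<^sub>2)"
  have K: "0 \<le> K" unfolding K_def using M_nonneg Lp_nonneg A4_nonneg C_nonneg by simp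
  show "\<exists>L\<ge>0. \<forall>t\<ge>a. \<forall>\<phi>\<in>Cspace r. \<forall>\<psi>\<in>Cspace r. normC r \<phi> \<le> R \<longrightarrow> normC r \<psi> \<le> R \<longrightarrow>
     (\<forall>\<theta>\<in>{-r..-\<eta>_ign t}. \<phi> \<theta> = \<psi> \<theta>) \<longrightarrow> norm (B t \<phi> - B t \<psi>) \<le> L * normC r (\<phi> - \<psi>)"
  proof (intro exI[of _ "L * (1 + K)"] conjI ballI allI impI)
    show "0 \<le> L * (1 + K)" using L K by simp
    fix t :: real and \<phi> \<psi> :: "real \<Rightarrow> 'x"
    assume t: "a \<le> t" and \<phi>: "\<phi> \<in> Cspace r" "normC r \<phi> \<le> R" and \<psi>: "\<psi> \<in> Cspace r" "normC r \<psi> \<le> R"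
      and past: "\<forall>\<theta>\<in>{-r..-\<eta>_ign t}. \<phi> \<theta> = \<psi> \<theta>"
    have d0: "0 \<le> normC r (\<phi> - \<psi>)" using normC_nonneg[OF _ Cspace_diff[OF \<phi>(1) \<psi>(1)]] r_pos by simp
    have "C\<^sub>1 * normC r \<psi> \<le> C\<^sub>1 * \<bar>R\<bar>" using \<psi> C_nonneg by (intro mult_left_mono) auto
    then have "M_Vg * L_p + L_Vgc * (C\<^sub>1 * normC r \<psi> + C\<^sub>2) \<le> K"
      unfolding K_def using A4_nonneg by (intro add_left_mono mult_left_mono) auto
    then have FF: "norm (F t \<phi> - F t \<psi>) \<le> K * normC r (\<phi> - \<psi>)"
      using F_lipschitz_same_past[OF t \<phi>(1) \<psi>(1) past] mult_right_mono[OF _ d0] by (meson order.trans)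
    have uu: "norm (\<phi> 0 - \<psi> 0) \<le> normC r (\<phi> - \<psi>)"
      using norm_le_normC[OF Cspace_diff[OF \<phi>(1) \<psi>(1)], of 0] r_pos by simp
    have "norm (B t \<phi> - B t \<psi>) \<le> L * (norm (\<phi> 0 - \<psi> 0) + norm (F t \<phi> - F t \<psi>))"
      unfolding B_def F_def[symmetric] by (rule L(2)) (use t bd \<phi> \<psi> in auto)
    also have "\<dots> \<le> L * (normC r (\<phi> - \<psi>) + K * normC r (\<phi> - \<psi>))"
      using FF uu L(1) by (intro mult_left_mono add_mono) auto
    finally show "norm (B t \<phi> - B t \<psi>) \<le> L * (1 + K) * normC r (\<phi> - \<psi>)" by (simp add: algebra_simps)
  qed
  show "\<exists>K. \<forall>t\<in>{a..T}. \<forall>\<psi>\<in>Cspace r. normC r \<psi> \<le> R \<longrightarrow> norm (B t \<psi>) \<le> K"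
  proof -
    \<comment> \<open>Boundedness follows by comparison with \<open>G t 0 0\<close>, which is
      bounded on a compact time interval; the Lipschitz constant of \<open>G\<close> controls the
      distance.\<close>
    have "continuous_on {a..T} (\<lambda>t. (\<lambda>(t, u, v). G t u v) (t, 0, 0))"
      by (rule continuous_on_compose2[OF G_cont]) (auto intro!: continuous_intros)
    then have "compact ((\<lambda>t. G t 0 0) ` {a..T})" by (intro compact_continuous_image) auto
    then obtain K0 where K0: "\<And>t. t \<in> {a..T} \<Longrightarrow> norm (G t 0 0) \<le> K0"
      using compact_imp_bounded bounded_iff by (metis imageI)
    have "norm (B t \<psi>) \<le> K0 + L * (R' + R')" if t: "t \<in> {a..T}" and \<psi>: "\<psi> \<in> Cspace r" "normC r \<psi> \<le> R" for t \<psi>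
    proof -
      have "norm (B t \<psi> - G t 0 0) \<le> L * (norm (\<psi> 0 - 0) + norm (F t \<psi> - 0))"
        unfolding B_def F_def[symmetric] by (rule L(2)) (use t bd \<psi> R' in auto)
      also have "\<dots> \<le> L * (R' + R')" using bd[OF \<psi>] L(1) by (intro mult_left_mono add_mono) auto
      finally show ?thesis using K0[OF t] norm_triangle_sub[of "B t \<psi>" "G t 0 0"] by linarith
    qed
    then show ?thesis by blast
  qed
qed

end

section \<open>Mild solutions\<close>

lemma seg_in_Cspace:
  assumes "continuous_on {s - r..s} u"
  shows "seg r u s \<in> Cspace r"
proof -
  have "continuous_on {-r..0} (\<lambda>\<theta>. u (s + \<theta>))"
    by (rule continuous_on_compose2[OF assms]) (auto intro!: continuous_intros)
  then have "continuous_on {-r..0} (seg r u s)"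
    by (rule continuous_on_cong[THEN iffD1, rotated 2]) (auto simp: seg_def)
  then show ?thesis by (auto simp: Cspace_def seg_def)
qed

lemma normC_seg_le:
  assumes "0 \<le> r" "\<And>x. x \<in> {s - r..s} \<Longrightarrow> norm (u x) \<le> K"
  shows "normC r (seg r u s) \<le> K"
  by (rule normC_le[OF assms(1)]) (use assms(2) in \<open>auto simp: seg_def\<close>)

lemma normC_seg_diff_le:
  assumes "0 \<le> r" "\<And>x. x \<in> {s - r..s} \<Longrightarrow> norm (u x - v x) \<le> K"
  shows "normC r (seg r u s - seg r v s) \<le> K"
  by (rule normC_le[OF assms(1)]) (use assms(2) in \<open>auto simp: seg_def\<close>)

lemma seg_tendsto:
  assumes "0 \<le> r" and u: "continuous_on {a - r..T} u" and s: "\<And>n. s n \<in> {a..T}" "t \<in> {a..T}" "s \<longlonglongrightarrow> t"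
  shows "(\<lambda>n. normC r (seg r u (s n) - seg r u t)) \<longlonglongrightarrow> 0"
proof (rule tendstoI)
  fix e :: real assume "e > 0"
  have "uniformly_continuous_on {a - r..T} u" using u by (simp add: compact_uniformly_continuous)
  moreover have "e / 2 > 0" using \<open>e > 0\<close> by simp
  ultimately obtain d where d: "d > 0" "\<And>x y. x \<in> {a - r..T} \<Longrightarrow> y \<in> {a - r..T} \<Longrightarrow> dist y x < d \<Longrightarrow> dist (u y) (u x) < e / 2"
    unfolding uniformly_continuous_on_def by meson
  have "\<forall>\<^sub>F n in sequentially. dist (s n) t < d" using s(3) d(1) by (rule tendstoD)
  then show "\<forall>\<^sub>F n in sequentially. dist (normC r (seg r u (s n) - seg r u t)) 0 < e"
  proof eventually_elim
    case (elim n)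
    have sub: "{s n - r..s n} \<subseteq> {a - r..T}" "{t - r..t} \<subseteq> {a - r..T}" using s(1)[of n] s(2) by auto
    have "normC r (seg r u (s n) - seg r u t) \<le> e / 2"
    proof (rule normC_le[OF \<open>0 \<le> r\<close>])
      fix \<theta> assume \<theta>: "\<theta> \<in> {-r..0}"
      have "dist (u (s n + \<theta>)) (u (t + \<theta>)) < e / 2"
        using \<theta> elim s(1)[of n] s(2) by (intro d(2)) (auto simp: dist_real_def)
      then show "norm ((seg r u (s n) - seg r u t) \<theta>) \<le> e / 2" using \<theta> by (simp add: seg_def dist_norm)
    qed
    moreover have "0 \<le> normC r (seg r u (s n) - seg r u t)"
      using sub by (intro normC_nonneg[OF \<open>0 \<le> r\<close>] Cspace_diff seg_in_Cspace continuous_on_subset[OF u])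
    ultimately show ?case using \<open>e > 0\<close> by (simp add: dist_real_def)
  qed
qed

text \<open>What the evolution problem requires of \<open>B\<close>, on a unit time window. The
  number \<open>\<rho>\<close> is a uniform depth below which agreement of two states counts as
  having the same past.\<close>

locale mild_problem =
  fixes S :: "real \<Rightarrow> 'x::banach \<Rightarrow> 'x" and \<omega> r a \<rho> :: real
    and B :: "real \<Rightarrow> (real \<Rightarrow> 'x) \<Rightarrow> 'x"
  assumes r_pos: "r > 0" and rho_pos: "\<rho> > 0"
    and semigroup: "compact_C0_semigroup S \<omega>"
    and B_tendsto: "\<And>\<phi> \<psi> t s. \<phi> \<in> Cspace r \<Longrightarrow> (\<And>n. \<psi> n \<in> Cspace r) \<Longrightarrow> t \<ge> a \<Longrightarrow> (\<And>n. s n \<ge> a) \<Longrightarrow>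
      s \<longlonglongrightarrow> t \<Longrightarrow> (\<lambda>n. normC r (\<psi> n - \<phi>)) \<longlonglongrightarrow> 0 \<Longrightarrow> (\<lambda>n. B (s n) (\<psi> n)) \<longlonglongrightarrow> B t \<phi>"
    and B_lipschitz: "\<And>R. \<exists>L\<ge>0. \<forall>t\<in>{a..a + 1}. \<forall>\<phi>\<in>Cspace r. \<forall>\<psi>\<in>Cspace r. normC r \<phi> \<le> R \<longrightarrow> normC r \<psi> \<le> R \<longrightarrow>
      (\<forall>\<theta>\<in>{-r..-\<rho>}. \<phi> \<theta> = \<psi> \<theta>) \<longrightarrow> norm (B t \<phi> - B t \<psi>) \<le> L * normC r (\<phi> - \<psi>)"
    and B_bounded: "\<And>R. \<exists>K. \<forall>t\<in>{a..a + 1}. \<forall>\<psi>\<in>Cspace r. normC r \<psi> \<le> R \<longrightarrow> norm (B t \<psi>) \<le> K"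
begin

section \<open>The semigroup and the convolution term on a unit time window\<close>

definition E :: real where "E = exp \<bar>\<omega>\<bar>"

lemma E_ge_1: "1 \<le> E"
  unfolding E_def by simp

lemma S_0: "S 0 x = x"
  using semigroup by (simp add: compact_C0_semigroup_def)

lemma S_diff: "0 \<le> t \<Longrightarrow> S t (x - y) = S t x - S t y"
  using semigroup by (simp add: compact_C0_semigroup_def bounded_linear.linear linear_diff)

lemma S_bound:
  assumes "0 \<le> t" "t \<le> 1"
  shows "norm (S t x) \<le> E * norm x"
proof -
  have "\<omega> * t \<le> \<bar>\<omega>\<bar> * 1" using assms by (intro mult_mono) auto
  then have "exp (\<omega> * t) \<le> E" unfolding E_def by simp
  then have "exp (\<omega> * t) * norm x \<le> E * norm x" by (rule mult_right_mono) simp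
  moreover have "norm (S t x) \<le> exp (\<omega> * t) * norm x"
    using semigroup assms by (simp add: compact_C0_semigroup_def)
  ultimately show ?thesis by linarith
qed

text \<open>Strong continuity at a fixed vector, combined with the uniform bound \<open>E\<close>,
  which absorbs the change of the vector.\<close>

lemma S_jointly_continuous: "continuous_on ({0..1} \<times> UNIV) (\<lambda>(t, x). S t x)"
  unfolding continuous_on_sequentially
proof (intro allI ballI impI, elim conjE)
  fix z :: "nat \<Rightarrow> real \<times> 'x" and c assume c: "c \<in> {0..1} \<times> UNIV" and z: "\<forall>n. z n \<in> {0..1} \<times> UNIV" "z \<longlonglongrightarrow> c"
  have f: "(\<lambda>n. fst (z n)) \<longlonglongrightarrow> fst c" and s: "(\<lambda>n. snd (z n)) \<longlonglongrightarrow> snd c"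
    using z(2) by (auto intro: tendsto_fst tendsto_snd)
  have c1: "fst c \<in> {0..1}" using c by auto
  have z1: "fst (z n) \<in> {0..1}" for n using z(1)[rule_format, of n] by auto
  have "continuous_on {0..} (\<lambda>t. S t (snd c))" using semigroup by (simp add: compact_C0_semigroup_def)
  then have 1: "(\<lambda>n. S (fst (z n)) (snd c)) \<longlonglongrightarrow> S (fst c) (snd c)"
    by (rule continuous_on_tendsto_compose[OF _ f]) (use c1 z1 in auto)
  have 2: "(\<lambda>n. S (fst (z n)) (snd (z n)) - S (fst (z n)) (snd c)) \<longlonglongrightarrow> 0"
  proof (rule Lim_null_comparison[OF always_eventually], rule allI)
    show "norm (S (fst (z n)) (snd (z n)) - S (fst (z n)) (snd c)) \<le> E * norm (snd (z n) - snd c)" for n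
      using S_bound[of "fst (z n)" "snd (z n) - snd c"] S_diff[of "fst (z n)" "snd (z n)" "snd c"] z1[of n] by simp
    have "(\<lambda>n. E * norm (snd (z n) - snd c)) \<longlonglongrightarrow> E * norm (snd c - snd c)"
      by (intro tendsto_mult tendsto_const tendsto_norm tendsto_diff s)
    then show "(\<lambda>n. E * norm (snd (z n) - snd c)) \<longlonglongrightarrow> 0" by simp
  qed
  show "((\<lambda>(t, x). S t x) \<circ> z) \<longlonglongrightarrow> (case c of (t, x) \<Rightarrow> S t x)"
    using tendsto_add[OF 2 1] by (simp add: o_def case_prod_beta)
qed

lemma convolution_integrand_continuous:
  assumes f: "continuous_on {a..T} f" and T: "T \<le> a + 1" and t: "t \<in> {a..T}"
  shows "continuous_on {a..t} (\<lambda>s. S (t - s) (f s))"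
proof -
  have "continuous_on {a..t} f" using f t by (auto intro: continuous_on_subset)
  then have "continuous_on {a..t} (\<lambda>s. (\<lambda>(t, x). S t x) (t - s, f s))"
    by (intro continuous_on_compose2[OF S_jointly_continuous] continuous_intros) (use t T in auto)
  then show ?thesis by simp
qed

text \<open>Freezing the integrand at its value \<open>f t\<close> for \<open>s \<ge> t\<close> makes the domain of integration
  independent of \<open>t\<close>.\<close>

lemma convolution_continuous:
  assumes f: "continuous_on {a..T} f" and T: "T \<le> a + 1"
  shows "continuous_on {a..T} (\<lambda>t. integral {a..t} (\<lambda>s. S (t - s) (f s)))"
proof -
  define k where "k = (\<lambda>t s. S (max 0 (t - s)) (f (min s t)))"
  have "continuous_on ({a..T} \<times> {a..T}) (\<lambda>z. (\<lambda>(t, x). S t x) (max 0 (fst z - snd z), f (min (snd z) (fst z))))"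
    by (intro continuous_on_compose2[OF S_jointly_continuous] continuous_on_compose2[OF f] continuous_intros)
      (use T in auto)
  then have k: "continuous_on ({a..T} \<times> {a..T}) (\<lambda>(t, s). k t s)"
    by (simp add: k_def case_prod_beta)
  then have 1: "continuous_on {a..T} (\<lambda>t. integral {a..T} (k t))"
    using integral_continuous_on_param[of "{a..T}" a T k] by simp
  have "integral {a..t} (\<lambda>s. S (t - s) (f s)) = integral {a..T} (k t) - (T - t) *\<^sub>R f t" if t: "t \<in> {a..T}" for t
  proof -
    have "continuous_on {a..T} (\<lambda>s. (\<lambda>(t, s). k t s) (t, s))"
      by (rule continuous_on_compose2[OF k]) (use t in \<open>auto intro!: continuous_intros\<close>)
    then have "k t integrable_on {a..T}" by (intro integrable_continuous_real) simp
    then have "integral {a..T} (k t) = integral {a..t} (k t) + integral {t..T} (k t)"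
      using t by (intro Henstock_Kurzweil_Integration.integral_combine[symmetric]) auto
    moreover have "integral {a..t} (k t) = integral {a..t} (\<lambda>s. S (t - s) (f s))"
      by (rule integral_cong) (simp add: k_def)
    moreover have "integral {t..T} (k t) = integral {t..T} (\<lambda>s. f t)"
      by (rule integral_cong) (simp add: k_def S_0)
    ultimately show ?thesis using t by simp
  qed
  moreover have "continuous_on {a..T} (\<lambda>t. integral {a..T} (k t) - (T - t) *\<^sub>R f t)"
    by (intro continuous_intros 1 f)
  ultimately show ?thesis by (subst continuous_on_cong[OF refl]) auto
qed

lemma seg_in_Cspace_of_solution:
  assumes "continuous_on {a - r..T} u" "s \<in> {a..T}"
  shows "seg r u s \<in> Cspace r"
  using assms by (intro seg_in_Cspace continuous_on_subset[OF assms(1)]) auto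

lemma B_seg_continuous:
  assumes u: "continuous_on {a - r..T} u"
  shows "continuous_on {a..T} (\<lambda>s. B s (seg r u s))"
  unfolding continuous_on_sequentially o_def
proof (intro allI ballI impI, elim conjE)
  fix s t assume s: "t \<in> {a..T}" "\<forall>n. s n \<in> {a..T}" "s \<longlonglongrightarrow> t"
  show "(\<lambda>n. B (s n) (seg r u (s n))) \<longlonglongrightarrow> B t (seg r u t)"
    using s r_pos by (intro B_tendsto seg_in_Cspace_of_solution[OF u] seg_tendsto[OF _ u]) auto
qed

text \<open>The Duhamel term of the variation-of-constants formula.\<close>

definition Q :: "(real \<Rightarrow> 'x) \<Rightarrow> real \<Rightarrow> 'x" where
  "Q u t = integral {a..t} (\<lambda>s. S (t - s) (B s (seg r u s)))"

lemma Q_has_integral: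
  assumes "continuous_on {a - r..T} u" "T \<le> a + 1" "t \<in> {a..T}"
  shows "((\<lambda>s. S (t - s) (B s (seg r u s))) has_integral Q u t) {a..t}"
  unfolding Q_def
  using convolution_integrand_continuous[OF B_seg_continuous[OF assms(1)] assms(2,3)]
  by (intro integrable_integral integrable_continuous_real)

lemma Q_bound:
  assumes "continuous_on {a - r..T} u" "T \<le> a + 1" "t \<in> {a..T}" "0 \<le> K"
    and K: "\<And>s. s \<in> {a..t} \<Longrightarrow> norm (B s (seg r u s)) \<le> K"
  shows "norm (Q u t) \<le> E * K * (t - a)"
proof -
  have "norm (Q u t) \<le> E * K * measure lborel (cbox a t)"
  proof (rule has_integral_bound)
    show "0 \<le> E * K" using E_ge_1 assms by simp
    show "((\<lambda>s. S (t - s) (B s (seg r u s))) has_integral Q u t) (cbox a t)"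
      using Q_has_integral[OF assms(1-3)] by simp
    fix s assume s: "s \<in> cbox a t"
    have "norm (S (t - s) (B s (seg r u s))) \<le> E * norm (B s (seg r u s))"
      using s assms by (intro S_bound) auto
    also have "\<dots> \<le> E * K" using K s E_ge_1 by (intro mult_left_mono) auto
    finally show "norm (S (t - s) (B s (seg r u s))) \<le> E * K" .
  qed
  then show ?thesis using assms by simp
qed

text \<open>The bound on the difference of the nonlinearities may vary with time, as the
  exponentially weighted estimate for uniqueness demands; a constant bound is the special case used
  elsewhere.\<close>

lemma Q_diff_bound_integral:
  assumes u: "continuous_on {a - r..T} u" and v: "continuous_on {a - r..T} v" and T: "T \<le> a + 1" "t \<in> {a..T}"
    and k: "(k has_integral I) {a..t}"
    and le: "\<And>s. s \<in> {a..t} \<Longrightarrow> norm (B s (seg r u s) - B s (seg r v s)) \<le> k s"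
  shows "norm (Q u t - Q v t) \<le> E * I"
proof -
  let ?f = "\<lambda>s. S (t - s) (B s (seg r u s)) - S (t - s) (B s (seg r v s))"
  have f: "(?f has_integral (Q u t - Q v t)) {a..t}"
    by (intro has_integral_diff Q_has_integral[OF u T] Q_has_integral[OF v T])
  have k': "((\<lambda>s. E * k s) has_integral E * I) {a..t}" by (rule has_integral_mult_right[OF k])
  have "norm (integral {a..t} ?f) \<le> integral {a..t} (\<lambda>s. E * k s)"
  proof (rule integral_norm_bound_integral)
    fix s assume s: "s \<in> {a..t}"
    have "norm (?f s) \<le> E * norm (B s (seg r u s) - B s (seg r v s))"
      using S_bound[of "t - s" "B s (seg r u s) - B s (seg r v s)"]
        S_diff[of "t - s" "B s (seg r u s)" "B s (seg r v s)"] s T by simp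
    also have "\<dots> \<le> E * k s" using le[OF s] E_ge_1 by (intro mult_left_mono) auto
    finally show "norm (?f s) \<le> E * k s" .
  qed (use f k' in \<open>auto simp: has_integral_integrable_integral\<close>)
  then show ?thesis by (simp only: integral_unique[OF f] integral_unique[OF k'])
qed

lemma Q_diff_bound:
  assumes "continuous_on {a - r..T} u" "continuous_on {a - r..T} v" "T \<le> a + 1" "t \<in> {a..T}"
    and "\<And>s. s \<in> {a..t} \<Longrightarrow> norm (B s (seg r u s) - B s (seg r v s)) \<le> k"
  shows "norm (Q u t - Q v t) \<le> E * k * (t - a)"
  using Q_diff_bound_integral[OF assms(1-4) has_integral_const_real assms(5)] assms(4)
  by (simp add: mult.commute mult.left_commute)

lemma mild_solution_values:
  assumes "mild_solution S B r a \<phi> T u" "T \<le> a + 1"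
  shows "a \<le> T" "continuous_on {a - r..T} u" "\<And>t. t \<in> {a - r..a} \<Longrightarrow> u t = \<phi> (t - a)"
    "\<And>t. t \<in> {a..T} \<Longrightarrow> u t = S (t - a) (\<phi> 0) + Q u t"
proof -
  show 1: "a \<le> T" and 2: "continuous_on {a - r..T} u" using assms by (auto simp: mild_solution_def)
  have init: "\<forall>\<theta>\<in>{-r..0}. u (a + \<theta>) = \<phi> \<theta>" using assms by (auto simp: mild_solution_def)
  show "u t = \<phi> (t - a)" if "t \<in> {a - r..a}" for t
    using bspec[OF init, of "t - a"] that by simp
  show "u t = S (t - a) (\<phi> 0) + Q u t" if "t \<in> {a..T}" for t
  proof -
    have "((\<lambda>s. S (t - s) (B s (seg r u s))) has_integral (u t - S (t - a) (\<phi> 0))) {a..t}"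
      using assms that by (auto simp: mild_solution_def)
    from has_integral_unique[OF this Q_has_integral[OF 2 assms(2) that]]
    show ?thesis by (simp add: algebra_simps)
  qed
qed

lemma mild_solution_restrict:
  "mild_solution S B r a \<phi> T u \<Longrightarrow> a \<le> T' \<Longrightarrow> T' \<le> T \<Longrightarrow> mild_solution S B r a \<phi> T' u"
  unfolding mild_solution_def by (auto intro: continuous_on_subset)

section \<open>Local existence, uniqueness and stability on a short time step\<close>

lemma seg_same_past:
  assumes "\<And>t. t \<in> {a - r..a} \<Longrightarrow> u t = v t" "s \<in> {a..a + \<rho>}"
  shows "\<forall>\<theta>\<in>{-r..-\<rho>}. seg r u s \<theta> = seg r v s \<theta>"
  \<comment> \<open>For \<open>\<theta> \<le> - \<rho>\<close> the time \<open>s + \<theta>\<close>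
    is at most \<open>a\<close>, where both functions show the common history.\<close>
  using assms rho_pos by (auto simp: seg_def)

text \<open>One formula for history and future, so that continuity across \<open>a\<close> needs no
  gluing: up to \<open>a\<close> the last two summands vanish, beyond \<open>a\<close> the two
  occurrences of \<open>\<phi> 0\<close> cancel.\<close>

definition picard :: "(real \<Rightarrow> 'x) \<Rightarrow> (real \<Rightarrow> 'x) \<Rightarrow> real \<Rightarrow> 'x" where
  "picard \<phi> u t = \<phi> (min 0 (t - a)) + (S (max 0 (t - a)) (\<phi> 0) - \<phi> 0) + Q u (max a t)"

lemma picard_initial: "t \<le> a \<Longrightarrow> picard \<phi> u t = \<phi> (t - a)"
  by (simp add: picard_def S_0 Q_def)

lemma picard_later: "a \<le> t \<Longrightarrow> picard \<phi> u t = S (t - a) (\<phi> 0) + Q u t"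
  by (simp add: picard_def)

lemma picard_continuous:
  assumes \<phi>: "\<phi> \<in> Cspace r" and u: "continuous_on {a - r..T} u" and T: "a \<le> T" "T \<le> a + 1"
  shows "continuous_on {a - r..T} (picard \<phi> u)"
proof -
  have S: "continuous_on {0..} (\<lambda>t. S t (\<phi> 0))" using semigroup by (simp add: compact_C0_semigroup_def)
  have Q: "continuous_on {a..T} (Q u)"
    unfolding Q_def using convolution_continuous[OF B_seg_continuous[OF u] T(2)] .
  show ?thesis
    unfolding picard_def[abs_def]
    by (intro continuous_intros continuous_on_compose2[OF Cspace_continuous[OF \<phi>]]
        continuous_on_compose2[OF S] continuous_on_compose2[OF Q]) (use r_pos T in auto)
qed

text \<open>A time step \<open>\<tau>\<close> on which the fixed point map preserves the ball of radius \<open>E R + 1\<close> and halves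
  distances, for all initial functions of norm at most \<open>R\<close>. The radius \<open>E R + 3\<close> leaves room for
  the perturbed solutions of the stability estimate.\<close>

definition admissible :: "real \<Rightarrow> real \<Rightarrow> bool" where
  "admissible R \<tau> \<longleftrightarrow> 0 < \<tau> \<and> \<tau> \<le> 1 \<and> \<tau> \<le> \<rho> \<and> (\<exists>K L. 0 \<le> K \<and> 0 \<le> L \<and>
     (\<forall>t\<in>{a..a + 1}. \<forall>\<psi>\<in>Cspace r. normC r \<psi> \<le> E * R + 3 \<longrightarrow> norm (B t \<psi>) \<le> K) \<and>
     (\<forall>t\<in>{a..a + 1}. \<forall>\<phi>\<in>Cspace r. \<forall>\<psi>\<in>Cspace r. normC r \<phi> \<le> E * R + 3 \<longrightarrow> normC r \<psi> \<le> E * R + 3 \<longrightarrow>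
      (\<forall>\<theta>\<in>{-r..-\<rho>}. \<phi> \<theta> = \<psi> \<theta>) \<longrightarrow> norm (B t \<phi> - B t \<psi>) \<le> L * normC r (\<phi> - \<psi>)) \<and>
     E * K * \<tau> \<le> 1 \<and> E * L * \<tau> \<le> 1 / 2)"

lemma admissible_exists: "\<exists>\<tau>. admissible R \<tau>"
proof -
  obtain L where L: "0 \<le> L" "\<forall>t\<in>{a..a + 1}. \<forall>\<phi>\<in>Cspace r. \<forall>\<psi>\<in>Cspace r. normC r \<phi> \<le> E * R + 3 \<longrightarrow> normC r \<psi> \<le> E * R + 3 \<longrightarrow>
      (\<forall>\<theta>\<in>{-r..-\<rho>}. \<phi> \<theta> = \<psi> \<theta>) \<longrightarrow> norm (B t \<phi> - B t \<psi>) \<le> L * normC r (\<phi> - \<psi>)"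
    using B_lipschitz[of "E * R + 3"] by blast
  obtain K where K: "\<forall>t\<in>{a..a + 1}. \<forall>\<psi>\<in>Cspace r. normC r \<psi> \<le> E * R + 3 \<longrightarrow> norm (B t \<psi>) \<le> K"
    using B_bounded[of "E * R + 3"] by blast
  \<comment> \<open>The reciprocals of \<open>c1\<close> and \<open>c2\<close> enforce the two
    smallness conditions; the summands 1 keep both positive when \<open>K\<close> or
    \<open>L\<close> is 0.\<close>
  define c1 where "c1 = E * \<bar>K\<bar> + 1"
  define c2 where "c2 = 2 * (E * L + 1)"
  have c: "0 < c1" "0 < c2" unfolding c1_def c2_def using E_ge_1 L by (auto intro!: add_nonneg_pos)
  define \<tau> where "\<tau> = min 1 (min \<rho> (min (1 / c1) (1 / c2)))"
  have \<tau>: "0 < \<tau>" "\<tau> \<le> 1" "\<tau> \<le> \<rho>" "\<tau> \<le> 1 / c1" "\<tau> \<le> 1 / c2" unfolding \<tau>_def using rho_pos c by auto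
  have "E * \<bar>K\<bar> * \<tau> \<le> c1 * (1 / c1)" unfolding c1_def[symmetric] using \<tau> E_ge_1 c
    by (intro mult_mono) (auto simp: c1_def)
  then have 1: "E * \<bar>K\<bar> * \<tau> \<le> 1" using c by simp
  have "E * L * \<tau> \<le> (c2 / 2) * (1 / c2)" using \<tau> E_ge_1 c L
    by (intro mult_mono) (auto simp: c2_def)
  then have 2: "E * L * \<tau> \<le> 1 / 2" using c by simp
  have "\<forall>t\<in>{a..a + 1}. \<forall>\<psi>\<in>Cspace r. normC r \<psi> \<le> E * R + 3 \<longrightarrow> norm (B t \<psi>) \<le> \<bar>K\<bar>"
    using K by (meson abs_ge_self order.trans)
  then show ?thesis unfolding admissible_def using \<tau> 1 2 L abs_ge_zero by blast
qed

text \<open>The constants \<open>K\<close> and \<open>L\<close> do not depend on the step, so it may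
  be shrunk. This is what later permits a choice of steps that is antitone in the radius.\<close>

lemma admissible_antimono:
  assumes adm: "admissible R \<tau>" and \<tau>': "0 < \<tau>'" "\<tau>' \<le> \<tau>"
  shows "admissible R \<tau>'"
proof -
  have le: "E * k * \<tau>' \<le> c" if "0 \<le> k" "E * k * \<tau> \<le> c" for k c
    by (rule order.trans[OF mult_left_mono[OF \<tau>'(2)] that(2)]) (use E_ge_1 that(1) in simp)
  have "\<tau> \<le> 1" "\<tau> \<le> \<rho>" using adm by (auto simp: admissible_def)
  then have "\<tau>' \<le> 1" "\<tau>' \<le> \<rho>" using \<tau>' by auto
  then show ?thesis using adm le \<tau>'(1) unfolding admissible_def by blast
qed

text \<open>Banach's fixed point theorem in the bounded continuous functions on the whole line.
  Since \<open>\<tau> \<le> \<rho>\<close>, all candidates have the same past throughout the step,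
  so the Lipschitz bound for \<open>B\<close> applies to any two of them and the map contracts by
  1/2.\<close>

lemma local_existence:
  assumes adm: "admissible R \<tau>" and \<phi>: "\<phi> \<in> Cspace r" "normC r \<phi> \<le> R"
  shows "\<exists>u. mild_solution S B r a \<phi> (a + \<tau>) u \<and> (\<forall>t\<in>{a - r..a + \<tau>}. norm (u t) \<le> E * R + 1)"
proof -
  obtain K L where \<tau>: "0 < \<tau>" "\<tau> \<le> 1" "\<tau> \<le> \<rho>" and KL: "0 \<le> K" "0 \<le> L"
    and K: "\<And>t \<psi>. t \<in> {a..a + 1} \<Longrightarrow> \<psi> \<in> Cspace r \<Longrightarrow> normC r \<psi> \<le> E * R + 3 \<Longrightarrow> norm (B t \<psi>) \<le> K"
    and L: "\<And>t \<phi> \<psi>. t \<in> {a..a + 1} \<Longrightarrow> \<phi> \<in> Cspace r \<Longrightarrow> \<psi> \<in> Cspace r \<Longrightarrow> normC r \<phi> \<le> E * R + 3 \<Longrightarrow>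
      normC r \<psi> \<le> E * R + 3 \<Longrightarrow> \<forall>\<theta>\<in>{-r..-\<rho>}. \<phi> \<theta> = \<psi> \<theta> \<Longrightarrow> norm (B t \<phi> - B t \<psi>) \<le> L * normC r (\<phi> - \<psi>)"
    and small: "E * K * \<tau> \<le> 1" "E * L * \<tau> \<le> 1 / 2"
    using adm unfolding admissible_def by blast
  have r0: "0 \<le> r" using r_pos by simp
  have R0: "0 \<le> R" using normC_nonneg[OF r0 \<phi>(1)] \<phi>(2) by linarith
  have ER: "R \<le> E * R" using E_ge_1 R0 by (simp add: mult_le_cancel_right1)
  let ?T = "a + \<tau>" and ?I = "{a - r..a + \<tau>}"
  \<comment> \<open>Bounded continuous functions are total on the line; clamping the argument
    extends images of the fixed point map constantly beyond the interval.\<close>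
  let ?cl = "clamp (a - r) (a + \<tau>) :: real \<Rightarrow> real"
  have cl: "?cl t \<in> ?I" for t using clamp_in_interval[of "a - r" "a + \<tau>" t] \<tau> r_pos by (simp add: cbox_interval)
  have \<phi>b: "norm (\<phi> \<theta>) \<le> R" if "\<theta> \<in> {-r..0}" for \<theta> using norm_le_normC[OF \<phi>(1) that] \<phi>(2) by linarith
  \<comment> \<open>The prescribed history and the ball are pointwise closed constraints, so the
    functions that obey them form a closed, hence complete, set.\<close>
  define Z where "Z = (\<lambda>t. (if t \<in> {a - r..a} then {\<phi> (t - a)} else UNIV) \<inter> cball 0 (E * R + 1))"
  define X where "X = PiC UNIV Z"
  have X: "u \<in> X \<longleftrightarrow> (\<forall>t\<in>{a - r..a}. apply_bcontfun u t = \<phi> (t - a)) \<and> (\<forall>t. norm (apply_bcontfun u t) \<le> E * R + 1)" for u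
    unfolding X_def mem_PiC_iff Z_def Pi_def by auto
  have "closed X" unfolding X_def by (rule closed_PiC) (auto simp: Z_def)
  then have complete: "complete X" by (simp add: complete_eq_closed)
  have cont: "continuous_on ?I (apply_bcontfun u)" for u by simp
  have Bseg: "norm (B s (seg r (apply_bcontfun u) s)) \<le> K" if "u \<in> X" "s \<in> {a..?T}" for u s
  proof (rule K)
    show "seg r (apply_bcontfun u) s \<in> Cspace r" by (rule seg_in_Cspace) simp
    show "normC r (seg r (apply_bcontfun u) s) \<le> E * R + 3"
      by (rule normC_seg_le[OF r0]) (use that X in \<open>auto intro: order.trans\<close>)
  qed (use that \<tau> in auto)
  have pic_bound: "norm (picard \<phi> (apply_bcontfun u) t) \<le> E * R + 1" if u: "u \<in> X" and t: "t \<in> ?I" for u t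
  proof (cases "t \<le> a")
    case True
    then show ?thesis using \<phi>b[of "t - a"] t ER by (simp add: picard_initial)
  next
    case False
    have "norm (S (t - a) (\<phi> 0)) \<le> E * norm (\<phi> 0)" using False t \<tau> by (intro S_bound) auto
    also have "\<dots> \<le> E * R" using \<phi>b[of 0] E_ge_1 r_pos by (intro mult_left_mono) auto
    finally have 1: "norm (S (t - a) (\<phi> 0)) \<le> E * R" .
    have "norm (Q (apply_bcontfun u) t) \<le> E * K * (t - a)"
      by (rule Q_bound[OF cont]) (use False t \<tau> KL Bseg[OF u] in auto)
    also have "\<dots> \<le> E * K * \<tau>" using t E_ge_1 KL by (intro mult_left_mono) auto
    finally have "norm (Q (apply_bcontfun u) t) \<le> 1" using small by linarith
    then show ?thesis using 1 False norm_triangle_ineq[of "S (t - a) (\<phi> 0)" "Q (apply_bcontfun u) t"]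
      by (simp add: picard_later)
  qed
  have "\<exists>w. \<forall>t. apply_bcontfun w t = picard \<phi> (apply_bcontfun u) (?cl t)" for u
  proof -
    have "continuous_on (cbox (a - r) ?T) (picard \<phi> (apply_bcontfun u))"
      using picard_continuous[OF \<phi>(1) cont, of u] \<tau> by simp
    then show ?thesis by (rule continuous_on_cbox_bcontfunE) blast
  qed
  then obtain \<Phi> where \<Phi>: "\<And>u t. apply_bcontfun (\<Phi> u) t = picard \<phi> (apply_bcontfun u) (?cl t)"
    by metis
  have cl_id: "?cl t = t" if "t \<in> ?I" for t using clamp_cancel_cbox[of t "a - r" ?T] that by simp
  have self: "\<Phi> u \<in> X" if "u \<in> X" for u
    unfolding X using pic_bound[OF that cl] \<tau> by (auto simp: \<Phi> cl_id picard_initial)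
  \<comment> \<open>A first candidate: the history, continued constantly by
    \<open>\<phi> 0\<close>.\<close>
  have "continuous_on (cbox (a - r) ?T) (\<lambda>t. \<phi> (min 0 (t - a)))"
    by (intro continuous_intros continuous_on_compose2[OF Cspace_continuous[OF \<phi>(1)]]) (use r_pos in auto)
  then obtain w where w: "\<And>t. apply_bcontfun w t = \<phi> (min 0 (?cl t - a))"
    by (rule continuous_on_cbox_bcontfunE) blast
  have "norm (\<phi> (min 0 (?cl t - a))) \<le> E * R + 1" for t
    using \<phi>b[of "min 0 (?cl t - a)"] cl[of t] ER r_pos by auto
  then have "w \<in> X" unfolding X using \<tau> by (auto simp: w cl_id)
  then have ne: "X \<noteq> {}" by blast
  have contr: "dist (\<Phi> u) (\<Phi> v) \<le> 1 / 2 * dist u v" if u: "u \<in> X" and v: "v \<in> X" for u v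
  proof (rule dist_bound)
    fix t
    show "dist (apply_bcontfun (\<Phi> u) t) (apply_bcontfun (\<Phi> v) t) \<le> 1 / 2 * dist u v"
    proof (cases "?cl t \<le> a")
      case True
      then show ?thesis by (simp add: \<Phi> picard_initial)
    next
      case False
      define c where "c = ?cl t"
      have c: "c \<in> {a..?T}" using False cl[of t] unfolding c_def by auto
      have "norm (B s (seg r (apply_bcontfun u) s) - B s (seg r (apply_bcontfun v) s)) \<le> L * dist u v"
        if s: "s \<in> {a..c}" for s
      proof -
        have seg: "seg r (apply_bcontfun w) s \<in> Cspace r" for w by (rule seg_in_Cspace) simp
        have nb: "normC r (seg r (apply_bcontfun w) s) \<le> E * R + 3" if "w \<in> X" for w
          by (rule normC_seg_le[OF r0]) (use that X in \<open>auto intro: order.trans\<close>)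
        have "norm (B s (seg r (apply_bcontfun u) s) - B s (seg r (apply_bcontfun v) s))
          \<le> L * normC r (seg r (apply_bcontfun u) s - seg r (apply_bcontfun v) s)"
        proof (rule L[OF _ seg seg nb[OF u] nb[OF v]])
          show "s \<in> {a..a + 1}" using s c \<tau> by auto
          show "\<forall>\<theta>\<in>{-r..-\<rho>}. seg r (apply_bcontfun u) s \<theta> = seg r (apply_bcontfun v) s \<theta>"
            by (rule seg_same_past) (use u v X s c \<tau> in auto)
        qed
        also have "\<dots> \<le> L * dist u v"
          using KL dist_bounded[of u _ v] by (intro mult_left_mono normC_seg_diff_le[OF r0]) (auto simp: dist_norm)
        finally show ?thesis .
      qed
      then have "norm (Q (apply_bcontfun u) c - Q (apply_bcontfun v) c) \<le> E * (L * dist u v) * (c - a)"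
        by (intro Q_diff_bound[OF cont cont _ c]) (use \<tau> in auto)
      also have "\<dots> \<le> E * (L * dist u v) * \<tau>" using c KL E_ge_1 by (intro mult_left_mono) auto
      also have "\<dots> = (E * L * \<tau>) * dist u v" by simp
      also have "\<dots> \<le> 1 / 2 * dist u v" using small by (intro mult_right_mono) auto
      finally show ?thesis using c by (simp add: \<Phi> picard_later dist_norm flip: c_def)
    qed
  qed
  obtain u where u: "u \<in> X" "\<Phi> u = u"
    using Banach_fix[OF complete ne, of "1 / 2" \<Phi>] self contr by auto
  have val: "apply_bcontfun u t = picard \<phi> (apply_bcontfun u) t" if "t \<in> ?I" for t
    using \<Phi>[of u t] u(2) cl_id[OF that] by simp
  have "mild_solution S B r a \<phi> ?T (apply_bcontfun u)"
    unfolding mild_solution_def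
  proof (intro conjI ballI)
    show "apply_bcontfun u (a + \<theta>) = \<phi> \<theta>" if "\<theta> \<in> {-r..0}" for \<theta> using u X that by auto
    fix t assume t: "t \<in> {a..?T}"
    have "Q (apply_bcontfun u) t = apply_bcontfun u t - S (t - a) (\<phi> 0)"
      using val[of t] t r_pos by (simp add: picard_later)
    then show "((\<lambda>s. S (t - s) (B s (seg r (apply_bcontfun u) s))) has_integral (apply_bcontfun u t - S (t - a) (\<phi> 0))) {a..t}"
      using Q_has_integral[OF cont _ t, of u] \<tau> by simp
  qed (use \<tau> in auto)
  then show ?thesis using u(1) X by blast
qed

text \<open>Maximising the difference of two solutions against the weight \<open>exp (- c (t - a))\<close> with large
  \<open>c\<close> takes the place of Gronwall's inequality.\<close>

lemma uniqueness:
  assumes u: "mild_solution S B r a \<phi> T u" and v: "mild_solution S B r a \<phi> T v"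
    and T: "T \<le> a + 1" "T \<le> a + \<rho>" and s: "s \<in> {a - r..T}"
  shows "u s = v s"
proof -
  note U = mild_solution_values[OF u T(1)] and V = mild_solution_values[OF v T(1)]
  have r0: "0 \<le> r" using r_pos by simp
  have "compact (u ` {a - r..T} \<union> v ` {a - r..T})"
    using U V by (intro compact_Un compact_continuous_image) auto
  \<comment> \<open>The competing solutions come with no norm bound; compactness of their ranges
    supplies the radius in which \<open>B\<close> is Lipschitz.\<close>
  then obtain R where "\<And>x. x \<in> u ` {a - r..T} \<union> v ` {a - r..T} \<Longrightarrow> norm x \<le> R"
    using compact_imp_bounded bounded_iff by metis
  then have R: "norm (u x) \<le> R" "norm (v x) \<le> R" if "x \<in> {a - r..T}" for x using that by auto
  obtain L where L: "0 \<le> L" "\<And>t \<phi> \<psi>. t \<in> {a..a + 1} \<Longrightarrow> \<phi> \<in> Cspace r \<Longrightarrow> \<psi> \<in> Cspace r \<Longrightarrow> normC r \<phi> \<le> R \<Longrightarrow>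
      normC r \<psi> \<le> R \<Longrightarrow> \<forall>\<theta>\<in>{-r..-\<rho>}. \<phi> \<theta> = \<psi> \<theta> \<Longrightarrow> norm (B t \<phi> - B t \<psi>) \<le> L * normC r (\<phi> - \<psi>)"
    using B_lipschitz[of R] by blast
  \<comment> \<open>Integrating the weight divides by \<open>c\<close>, so this choice makes the
    factor \<open>E * L / c\<close> at most 1/2; the summand 1 covers \<open>L = 0\<close>.\<close>
  define c where "c = 2 * E * L + 1"
  have c: "0 < c" "2 * E * L \<le> c" unfolding c_def using L E_ge_1 by (auto intro!: add_nonneg_pos)
  define W where "W = (\<lambda>t. exp (- (c * (t - a))) * norm (u t - v t))"
  have "continuous_on {a..T} u" "continuous_on {a..T} v"
    using U(2) V(2) r_pos by (auto intro: continuous_on_subset)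
  then have "continuous_on {a..T} W" unfolding W_def by (intro continuous_intros)
  then obtain t0 where t0: "t0 \<in> {a..T}" "\<And>t. t \<in> {a..T} \<Longrightarrow> W t \<le> W t0"
    using continuous_attains_sup[of "{a..T}" W] U(1) by auto
  define D where "D = W t0"
  have D0: "0 \<le> D" unfolding D_def W_def by simp
  have diff: "norm (u t - v t) \<le> D * exp (c * (t - a))" if "t \<in> {a..T}" for t
  proof -
    have "norm (u t - v t) = W t * exp (c * (t - a))"
      unfolding W_def by (simp add: exp_minus)
    also have "\<dots> \<le> D * exp (c * (t - a))"
      using t0(2)[OF that] unfolding D_def by (intro mult_right_mono) auto
    finally show ?thesis .
  qed
  have past: "u t = v t" if "t \<in> {a - r..a}" for t using U(3) V(3) that by simp
  have Bd: "norm (B s (seg r u s) - B s (seg r v s)) \<le> L * D * exp (c * (s - a))" if s: "s \<in> {a..T}" for s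
  proof -
    have "norm (B s (seg r u s) - B s (seg r v s)) \<le> L * normC r (seg r u s - seg r v s)"
    proof (rule L(2))
      show "seg r u s \<in> Cspace r" "seg r v s \<in> Cspace r"
        using s U(2) V(2) by (auto intro: seg_in_Cspace_of_solution)
      show "normC r (seg r u s) \<le> R" "normC r (seg r v s) \<le> R"
        using s by (auto intro!: normC_seg_le[OF r0] R)
      show "\<forall>\<theta>\<in>{-r..-\<rho>}. seg r u s \<theta> = seg r v s \<theta>"
        by (rule seg_same_past[OF past]) (use s T in auto)
    qed (use s T in auto)
    also have "\<dots> \<le> L * (D * exp (c * (s - a)))"
    proof (intro mult_left_mono normC_seg_diff_le[OF r0])
      fix x assume x: "x \<in> {s - r..s}"
      show "norm (u x - v x) \<le> D * exp (c * (s - a))"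
      proof (cases "x \<le> a")
        case True
        then show ?thesis using past[of x] x s D0 by simp
      next
        case False
        have "norm (u x - v x) \<le> D * exp (c * (x - a))" using diff False x s by auto
        also have "\<dots> \<le> D * exp (c * (s - a))" using x c D0 by (intro mult_left_mono) auto
        finally show ?thesis .
      qed
    qed fact
    finally show ?thesis by (simp add: mult.assoc)
  qed
  have at0: "a \<le> t0" using t0 by simp
  have "((\<lambda>s. exp (c * (s - a))) has_integral exp (c * (t0 - a)) / c - exp (c * (a - a)) / c) {a..t0}"
    by (rule fundamental_theorem_of_calculus[OF at0])
      (use c in \<open>auto intro!: derivative_eq_intros simp flip: has_real_derivative_iff_has_vector_derivative\<close>)
  from has_integral_mult_right[OF this, of "L * D"]
  have "norm (Q u t0 - Q v t0) \<le> E * (L * D * (exp (c * (t0 - a)) / c - exp (c * (a - a)) / c))"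
    by (rule Q_diff_bound_integral[OF U(2) V(2) T(1) t0(1)]) (use Bd t0 in auto)
  also have "\<dots> \<le> E * (L * D * (exp (c * (t0 - a)) / c))"
    using c E_ge_1 L D0 by (intro mult_left_mono) auto
  also have "\<dots> = (E * L / c) * (D * exp (c * (t0 - a)))" by simp
  also have "\<dots> \<le> 1 / 2 * (D * exp (c * (t0 - a)))"
    using c D0 by (intro mult_right_mono) (auto simp: field_simps)
  finally have "norm (u t0 - v t0) \<le> 1 / 2 * (D * exp (c * (t0 - a)))"
    using U(4)[OF t0(1)] V(4)[OF t0(1)] by simp
  then have "exp (- (c * (t0 - a))) * norm (u t0 - v t0) \<le> exp (- (c * (t0 - a))) * (1 / 2 * (D * exp (c * (t0 - a))))"
    by (rule mult_left_mono) simp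
  also have "\<dots> = D / 2" by (simp add: exp_minus)
  \<comment> \<open>The maximum of the weighted difference is at most half of itself, hence
    0.\<close>
  finally have "D \<le> D / 2" unfolding D_def W_def .
  then have "D = 0" using D0 by simp
  then show ?thesis using diff[of s] past[of s] s by (cases "s \<le> a") auto
qed

text \<open>Continuity of \<open>B\<close> is uniform near the trajectory of \<open>u\<close>: a
  sequence of counterexamples has times converging along a subsequence, and both the segments of
  \<open>u\<close> and the offending states then tend to the same segment, against the gap
  \<open>e\<close>.\<close>

lemma B_uniform_along:
  assumes u: "continuous_on {a - r..T} u" and "e > 0"
  shows "\<exists>d>0. \<forall>s\<in>{a..T}. \<forall>\<psi>\<in>Cspace r. normC r (\<psi> - seg r u s) < d \<longrightarrow> norm (B s \<psi> - B s (seg r u s)) < e"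
proof (rule ccontr)
  assume "\<not> ?thesis"
  then have "\<exists>s \<psi>. s \<in> {a..T} \<and> \<psi> \<in> Cspace r \<and> normC r (\<psi> - seg r u s) < inverse (real (Suc n)) \<and>
     \<not> norm (B s \<psi> - B s (seg r u s)) < e" for n
    by (metis inverse_positive_iff_positive of_nat_0_less_iff zero_less_Suc)
  then obtain s \<psi> where s: "\<And>n. s n \<in> {a..T}" and \<psi>: "\<And>n. \<psi> n \<in> Cspace r"
    and close: "\<And>n. normC r (\<psi> n - seg r u (s n)) < inverse (real (Suc n))"
    and far: "\<And>n. \<not> norm (B (s n) (\<psi> n) - B (s n) (seg r u (s n))) < e" by metis
  have r0: "0 \<le> r" using r_pos by simp
  obtain t \<sigma> where t: "t \<in> {a..T}" and \<sigma>: "strict_mono \<sigma>" and lim: "(s \<circ> \<sigma>) \<longlonglongrightarrow> t"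
    using compact_Icc[of a T, unfolded compact_def] s by meson
  have segt: "seg r u t \<in> Cspace r" and segs: "seg r u (s (\<sigma> n)) \<in> Cspace r" for n
    using s t by (auto intro!: seg_in_Cspace_of_solution[OF u])
  have l1: "(\<lambda>n. normC r (seg r u ((s \<circ> \<sigma>) n) - seg r u t)) \<longlonglongrightarrow> 0"
    using lim by (rule seg_tendsto[OF r0 u, rotated 2]) (use s t in auto)
  have "(\<lambda>n. inverse (real (Suc (\<sigma> n)))) \<longlonglongrightarrow> 0"
    using LIMSEQ_subseq_LIMSEQ[OF LIMSEQ_inverse_real_of_nat \<sigma>] by (simp add: o_def)
  from tendsto_add[OF this l1]
  have l2: "(\<lambda>n. inverse (real (Suc (\<sigma> n))) + normC r (seg r u ((s \<circ> \<sigma>) n) - seg r u t)) \<longlonglongrightarrow> 0" by simp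
  have "(\<lambda>n. normC r (\<psi> (\<sigma> n) - seg r u t)) \<longlonglongrightarrow> 0"
  proof (rule tendsto_sandwich[OF always_eventually always_eventually tendsto_const l2]; rule allI)
    fix n
    show "0 \<le> normC r (\<psi> (\<sigma> n) - seg r u t)" by (intro normC_nonneg r0 Cspace_diff \<psi> segt)
    have "normC r (\<psi> (\<sigma> n) - seg r u t) \<le> normC r (seg r u (s (\<sigma> n)) - seg r u t) + normC r ((\<psi> (\<sigma> n) - seg r u t) - (seg r u (s (\<sigma> n)) - seg r u t))"
      by (intro normC_triangle r0 Cspace_diff \<psi> segt segs)
    moreover have "(\<psi> (\<sigma> n) - seg r u t) - (seg r u (s (\<sigma> n)) - seg r u t) = \<psi> (\<sigma> n) - seg r u (s (\<sigma> n))"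
      by (rule ext) simp
    ultimately show "normC r (\<psi> (\<sigma> n) - seg r u t) \<le> inverse (real (Suc (\<sigma> n))) + normC r (seg r u ((s \<circ> \<sigma>) n) - seg r u t)"
      using close[of "\<sigma> n"] by simp
  qed
  then have "(\<lambda>n. B ((s \<circ> \<sigma>) n) (\<psi> (\<sigma> n))) \<longlonglongrightarrow> B t (seg r u t)"
    by (intro B_tendsto[OF segt _ _ _ lim]) (use \<psi> s t in auto)
  moreover have "(\<lambda>n. B ((s \<circ> \<sigma>) n) (seg r u ((s \<circ> \<sigma>) n))) \<longlonglongrightarrow> B t (seg r u t)"
    by (intro B_tendsto[OF segt _ _ _ lim l1]) (use segs s t in auto)
  ultimately have "(\<lambda>n. B ((s \<circ> \<sigma>) n) (\<psi> (\<sigma> n)) - B ((s \<circ> \<sigma>) n) (seg r u ((s \<circ> \<sigma>) n))) \<longlonglongrightarrow> B t (seg r u t) - B t (seg r u t)"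
    by (rule tendsto_diff)
  from tendstoD[OF this \<open>e > 0\<close>] show False using far by (auto simp: eventually_sequentially)
qed

text \<open>\<open>B\<close> is Lipschitz only between segments with the same past, so the two solutions are compared
  through \<open>v\<close>, which has the past of \<open>u'\<close> and the future of \<open>u\<close>, shifted to be continuous.\<close>

lemma stability_estimate:
  assumes adm: "admissible R \<tau>" and \<phi>: "\<phi> \<in> Cspace r" "\<phi>' \<in> Cspace r"
    and u: "mild_solution S B r a \<phi> (a + \<tau>) u" "\<And>t. t \<in> {a - r..a + \<tau>} \<Longrightarrow> norm (u t) \<le> E * R + 1"
    and u': "mild_solution S B r a \<phi>' (a + \<tau>) u'" "\<And>t. t \<in> {a - r..a + \<tau>} \<Longrightarrow> norm (u' t) \<le> E * R + 1"
    and d: "normC r (\<phi>' - \<phi>) = d" "d \<le> 1" and "0 \<le> e"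
    and near: "\<And>s \<psi>. s \<in> {a..a + \<tau>} \<Longrightarrow> \<psi> \<in> Cspace r \<Longrightarrow> normC r (\<psi> - seg r u s) \<le> d \<Longrightarrow> norm (B s \<psi> - B s (seg r u s)) \<le> e"
    and t: "t \<in> {a - r..a + \<tau>}"
  shows "norm (u' t - u t) \<le> (2 * E + 3) * d + 2 * E * e"
proof -
  obtain L where \<tau>: "0 < \<tau>" "\<tau> \<le> 1" "\<tau> \<le> \<rho>" and L0: "0 \<le> L"
    and L: "\<And>t \<phi> \<psi>. t \<in> {a..a + 1} \<Longrightarrow> \<phi> \<in> Cspace r \<Longrightarrow> \<psi> \<in> Cspace r \<Longrightarrow> normC r \<phi> \<le> E * R + 3 \<Longrightarrow>
      normC r \<psi> \<le> E * R + 3 \<Longrightarrow> \<forall>\<theta>\<in>{-r..-\<rho>}. \<phi> \<theta> = \<psi> \<theta> \<Longrightarrow> norm (B t \<phi> - B t \<psi>) \<le> L * normC r (\<phi> - \<psi>)"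
    and small: "E * L * \<tau> \<le> 1 / 2"
    using adm unfolding admissible_def by blast
  let ?T = "a + \<tau>" and ?I = "{a - r..a + \<tau>}"
  have T1: "?T \<le> a + 1" using \<tau> by simp
  note U = mild_solution_values[OF u(1) T1] and U' = mild_solution_values[OF u'(1) T1]
  have r0: "0 \<le> r" using r_pos by simp
  have dd: "norm (\<phi>' \<theta> - \<phi> \<theta>) \<le> d" if "\<theta> \<in> {-r..0}" for \<theta>
    using norm_le_normC[OF Cspace_diff[OF \<phi>(2,1)] that] d by simp
  define v where "v = (\<lambda>t. u t + (\<phi>' (min 0 (t - a)) - \<phi> (min 0 (t - a))))"
  have vc: "continuous_on ?I v" unfolding v_def
    by (intro continuous_intros U(2) continuous_on_compose2[OF Cspace_continuous[OF \<phi>(1)]]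
        continuous_on_compose2[OF Cspace_continuous[OF \<phi>(2)]]) (use r_pos in auto)
  have vu: "norm (v x - u x) \<le> d" if "x \<in> ?I" for x
    using dd[of "min 0 (x - a)"] that r_pos unfolding v_def by auto
  \<comment> \<open>The shift costs at most \<open>d \<le> 1\<close> beyond the bound for
    \<open>u\<close>, which stays within the radius of the Lipschitz bound in
    \<open>admissible\<close>.\<close>
  have vb: "norm (v x) \<le> E * R + 2" if "x \<in> ?I" for x
    using vu[OF that] u(2)[OF that] d(2) norm_triangle_sub[of "v x" "u x"] by linarith
  have past: "u' x = v x" if "x \<in> {a - r..a}" for x
    using U(3)[OF that] U'(3)[OF that] that unfolding v_def by simp
  have "continuous_on {a..?T} u'" "continuous_on {a..?T} v"
    using U'(2) vc r_pos by (auto intro: continuous_on_subset)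
  then have "continuous_on {a..?T} (\<lambda>t. norm (u' t - v t))" by (intro continuous_intros)
  then obtain t0 where t0: "t0 \<in> {a..?T}" "\<And>t. t \<in> {a..?T} \<Longrightarrow> norm (u' t - v t) \<le> norm (u' t0 - v t0)"
    using continuous_attains_sup[of "{a..?T}" "\<lambda>t. norm (u' t - v t)"] \<tau> by auto
  \<comment> \<open>The maximum over \<open>{a..a + \<tau>}\<close> bounds the difference on the
    history as well, where \<open>u'\<close> and \<open>v\<close> coincide.\<close>
  define m where "m = norm (u' t0 - v t0)"
  have m: "norm (u' x - v x) \<le> m" if "x \<in> ?I" for x
    using t0(2)[of x] past[of x] that unfolding m_def by (cases "x \<le> a") auto
  have m0: "0 \<le> m" unfolding m_def by simp
  have "norm (B s (seg r u' s) - B s (seg r u s)) \<le> L * m + e" if s: "s \<in> {a..t0}" for s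
  proof -
    have s': "s \<in> {a..?T}" using s t0 by auto
    have sub: "x \<in> ?I" if "x \<in> {s - r..s}" for x using that s' by auto
    have seg: "seg r u' s \<in> Cspace r" "seg r v s \<in> Cspace r"
      by (rule seg_in_Cspace_of_solution[OF _ s']; fact)+
    have "norm (B s (seg r u' s) - B s (seg r v s)) \<le> L * normC r (seg r u' s - seg r v s)"
    proof (rule L[OF _ seg])
      show "normC r (seg r u' s) \<le> E * R + 3" "normC r (seg r v s) \<le> E * R + 3"
        using order.trans[OF u'(2)] order.trans[OF vb] sub by (auto intro!: normC_seg_le[OF r0])
      show "\<forall>\<theta>\<in>{-r..-\<rho>}. seg r u' s \<theta> = seg r v s \<theta>"
        by (rule seg_same_past[OF past]) (use s' \<tau> in auto)
    qed (use s' \<tau> in auto)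
    also have "\<dots> \<le> L * m" using L0 m sub by (intro mult_left_mono normC_seg_diff_le[OF r0]) auto
    finally have 1: "norm (B s (seg r u' s) - B s (seg r v s)) \<le> L * m" .
    have "norm (B s (seg r v s) - B s (seg r u s)) \<le> e"
      by (rule near[OF s' seg(2)]) (use vu sub in \<open>auto intro!: normC_seg_diff_le[OF r0]\<close>)
    then show ?thesis using 1 norm_triangle_ineq[of "B s (seg r u' s) - B s (seg r v s)" "B s (seg r v s) - B s (seg r u s)"] by simp
  qed
  then have "norm (Q u' t0 - Q u t0) \<le> E * (L * m + e) * (t0 - a)"
    by (rule Q_diff_bound[OF U'(2) U(2) T1 t0(1)])
  also have "\<dots> \<le> E * (L * m + e) * \<tau>" using t0 E_ge_1 L0 m0 \<open>0 \<le> e\<close> by (intro mult_left_mono) auto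
  also have "\<dots> = (E * L * \<tau>) * m + (E * e) * \<tau>" by (simp add: algebra_simps)
  also have "\<dots> \<le> 1 / 2 * m + (E * e) * 1"
    using small m0 \<tau> E_ge_1 \<open>0 \<le> e\<close> by (intro add_mono mult_right_mono mult_left_mono) auto
  finally have q: "norm (Q u' t0 - Q u t0) \<le> 1 / 2 * m + E * e" by simp
  have z: "norm (\<phi>' 0 - \<phi> 0) \<le> d" using dd[of 0] r_pos by simp
  have "norm (S (t0 - a) (\<phi>' 0 - \<phi> 0)) \<le> E * norm (\<phi>' 0 - \<phi> 0)" using t0 \<tau> by (intro S_bound) auto
  also have "\<dots> \<le> E * d" using z E_ge_1 by (intro mult_left_mono) auto
  finally have s0: "norm (S (t0 - a) (\<phi>' 0 - \<phi> 0)) \<le> E * d" .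
  have "u' t0 - v t0 = S (t0 - a) (\<phi>' 0 - \<phi> 0) + (Q u' t0 - Q u t0) - (\<phi>' 0 - \<phi> 0)"
    using U(4)[OF t0(1)] U'(4)[OF t0(1)] t0(1) S_diff[of "t0 - a"] unfolding v_def by simp
  then have "m = norm (S (t0 - a) (\<phi>' 0 - \<phi> 0) + (Q u' t0 - Q u t0) - (\<phi>' 0 - \<phi> 0))" unfolding m_def by simp
  \<comment> \<open>The semigroup acting on the initial difference, the Duhamel terms and the shift
    in \<open>v\<close>, in this order. Absorbing half of \<open>m\<close> doubles the rest; the
    return from \<open>v\<close> to \<open>u\<close> adds one more \<open>d\<close>, whence the
    constant \<open>2 * E + 3\<close>.\<close>
  then have "m \<le> E * d + (1 / 2 * m + E * e) + d"
    using q s0 z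
      norm_triangle_ineq[of "S (t0 - a) (\<phi>' 0 - \<phi> 0)" "Q u' t0 - Q u t0"]
      norm_triangle_ineq4[of "S (t0 - a) (\<phi>' 0 - \<phi> 0) + (Q u' t0 - Q u t0)" "\<phi>' 0 - \<phi> 0"] by linarith
  then have "m \<le> 2 * E * d + 2 * d + 2 * E * e" by (simp add: algebra_simps)
  moreover have "norm (u' t - u t) \<le> m + d"
    using m[OF t] vu[OF t] norm_triangle_ineq[of "u' t - v t" "v t - u t"] by simp
  ultimately show ?thesis by (simp add: algebra_simps)
qed

lemma continuous_dependence:
  assumes adm: "admissible R \<tau>" and \<phi>: "\<phi> \<in> Cspace r" "\<And>n. \<phi>s n \<in> Cspace r"
    and u: "mild_solution S B r a \<phi> (a + \<tau>) u" "\<And>t. t \<in> {a - r..a + \<tau>} \<Longrightarrow> norm (u t) \<le> E * R + 1"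
    and us: "\<forall>\<^sub>F n in sequentially. mild_solution S B r a (\<phi>s n) (a + \<tau>) (us n) \<and>
      (\<forall>t\<in>{a - r..a + \<tau>}. norm (us n t) \<le> E * R + 1)"
    and lim: "(\<lambda>n. normC r (\<phi>s n - \<phi>)) \<longlonglongrightarrow> 0" and t: "t \<in> {a..a + \<tau>}"
  shows "(\<lambda>n. normC r (seg r (us n) t - seg r u t)) \<longlonglongrightarrow> 0"
proof (rule tendstoI)
  fix e :: real assume "e > 0"
  have E0: "0 < E" using E_ge_1 by simp
  have r0: "0 \<le> r" using r_pos by simp
  have \<tau>: "0 < \<tau>" "\<tau> \<le> 1" using adm by (auto simp: admissible_def)
  \<comment> \<open>Chosen so that \<open>2 * E * e'\<close> is \<open>e / 4\<close>.\<close>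
  define e' where "e' = e / (8 * E)"
  have e': "e' > 0" unfolding e'_def using \<open>e > 0\<close> E0 by simp
  have uc: "continuous_on {a - r..a + \<tau>} u" using u by (simp add: mild_solution_def)
  obtain \<delta> where \<delta>: "\<delta> > 0" "\<And>s \<psi>. s \<in> {a..a + \<tau>} \<Longrightarrow> \<psi> \<in> Cspace r \<Longrightarrow> normC r (\<psi> - seg r u s) < \<delta> \<Longrightarrow>
      norm (B s \<psi> - B s (seg r u s)) < e'"
    using B_uniform_along[OF uc e'] by blast
  \<comment> \<open>The three entries ensure \<open>d \<le> 1\<close>, closeness to the trajectory,
    and a contribution of at most \<open>e / 4\<close> from the initial difference. The total
    \<open>e / 2\<close> leaves room for the passage to a supremum.\<close>
  define \<delta>' where "\<delta>' = min 1 (min \<delta> (e / (4 * (2 * E + 3))))"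
  have \<delta>': "\<delta>' > 0" unfolding \<delta>'_def using \<delta>(1) \<open>e > 0\<close> E0 by simp
  have "\<forall>\<^sub>F n in sequentially. normC r (\<phi>s n - \<phi>) < \<delta>'" using order_tendstoD(2)[OF lim \<delta>'] .
  with us show "\<forall>\<^sub>F n in sequentially. dist (normC r (seg r (us n) t - seg r u t)) 0 < e"
  proof eventually_elim
    case (elim n)
    let ?d = "normC r (\<phi>s n - \<phi>)"
    have d: "?d \<le> 1" "?d < \<delta>" "?d < e / (4 * (2 * E + 3))" using elim unfolding \<delta>'_def by auto
    have "norm (us n x - u x) \<le> (2 * E + 3) * ?d + 2 * E * e'" if "x \<in> {a - r..a + \<tau>}" for x
    proof (rule stability_estimate[OF adm \<phi>(1) \<phi>(2) u _ _ refl d(1) _ _ that])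
      show "norm (B s \<psi> - B s (seg r u s)) \<le> e'" if "s \<in> {a..a + \<tau>}" "\<psi> \<in> Cspace r" "normC r (\<psi> - seg r u s) \<le> ?d" for s \<psi>
        using \<delta>(2)[OF that(1,2)] that(3) d(2) by simp
    qed (use elim e' in auto)
    moreover have "(2 * E + 3) * ?d \<le> (2 * E + 3) * (e / (4 * (2 * E + 3)))"
      using d E0 by (intro mult_left_mono) auto
    moreover have "(2 * E + 3) * (e / (4 * (2 * E + 3))) = e / 4" using E0 by (simp add: field_simps)
    moreover have "2 * E * e' = e / 4" unfolding e'_def using E0 by simp
    ultimately have le: "norm (us n x - u x) \<le> e / 2" if "x \<in> {a - r..a + \<tau>}" for x using that by fastforce
    have "normC r (seg r (us n) t - seg r u t) \<le> e / 2"
      by (rule normC_seg_diff_le[OF r0]) (use le t in auto)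
    moreover have "0 \<le> normC r (seg r (us n) t - seg r u t)"
      using elim by (intro normC_nonneg[OF r0] Cspace_diff seg_in_Cspace_of_solution[OF _ t] uc)
        (simp add: mild_solution_def)
    ultimately show ?case using \<open>e > 0\<close> by (simp add: dist_real_def)
  qed
qed

text \<open>The existence time is chosen to depend only on the integer part of the norm of the initial function,
  and antitonely; this makes \<open>b\<close> lower semicontinuous.\<close>

theorem well_posed:
  "\<exists>(b :: (real \<Rightarrow> 'x) \<Rightarrow> ereal) (sol :: (real \<Rightarrow> 'x) \<Rightarrow> real \<Rightarrow> 'x).
     (\<forall>\<phi>\<in>Cspace r.
        ereal a < b \<phi> \<and> mild_solution_on S B r a \<phi> (b \<phi>) (sol \<phi>) \<and>
        (\<forall>v. mild_solution_on S B r a \<phi> (b \<phi>) v \<longrightarrow>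
              (\<forall>s. a - r \<le> s \<and> ereal s < b \<phi> \<longrightarrow> v s = sol \<phi> s))) \<and>
     (\<forall>\<phi> \<phi>s. \<phi> \<in> Cspace r \<and> (\<forall>n. \<phi>s n \<in> Cspace r) \<and>
        (\<lambda>n. normC r (\<phi>s n - \<phi>)) \<longlonglongrightarrow> 0 \<longrightarrow>
        (\<forall>t. a \<le> t \<and> ereal t < b \<phi> \<longrightarrow>
           (\<forall>\<^sub>F n in sequentially. ereal t < b (\<phi>s n)) \<and>
           (\<lambda>n. normC r (seg r (sol (\<phi>s n)) t - seg r (sol \<phi>) t)) \<longlonglongrightarrow> 0))"
proof -
  have r0: "0 \<le> r" using r_pos by simp
  obtain \<tau>0 where \<tau>0: "\<And>N::nat. admissible (real N) (\<tau>0 N)" using choice[of "\<lambda>N::nat. admissible (real N)"] admissible_exists by blast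
  \<comment> \<open>The minimum over all smaller indices makes the step antitone in \<open>N\<close>
    while it remains positive.\<close>
  define \<tau> where "\<tau> = (\<lambda>N::nat. Min (\<tau>0 ` {..N}))"
  have pos0: "0 < \<tau>0 N" for N using \<tau>0[of N] by (simp add: admissible_def)
  have pos: "0 < \<tau> N" for N unfolding \<tau>_def using pos0 by (subst Min_gr_iff) auto
  have adm: "admissible (real N) (\<tau> N)" for N
    by (rule admissible_antimono[OF \<tau>0 pos]) (auto simp: \<tau>_def)
  have anti: "\<tau> M \<le> \<tau> N" if "N \<le> M" for M N
    unfolding \<tau>_def using that by (intro Min_antimono) auto
  have \<tau>1: "\<tau> N \<le> 1" "\<tau> N \<le> \<rho>" for N using adm[of N] by (auto simp: admissible_def)
  \<comment> \<open>The norm lies strictly below this integer, so it remains a bound for all initial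
    functions close enough to \<open>\<phi>\<close>.\<close>
  define N where "N = (\<lambda>\<phi>::real \<Rightarrow> 'x. nat \<lfloor>normC r \<phi>\<rfloor> + 1)"
  have N: "normC r \<phi> \<le> real (N \<phi>)" for \<phi>
    unfolding N_def by linarith
  \<comment> \<open>The choice includes the norm bound, which the stability estimate requires of the
    solutions that it compares.\<close>
  define sol where "sol = (\<lambda>\<phi>. SOME u. mild_solution S B r a \<phi> (a + \<tau> (N \<phi>)) u \<and>
     (\<forall>t\<in>{a - r..a + \<tau> (N \<phi>)}. norm (u t) \<le> E * real (N \<phi>) + 1))"
  have sol: "mild_solution S B r a \<phi> (a + \<tau> (N \<phi>)) (sol \<phi>)"
    "\<And>t. t \<in> {a - r..a + \<tau> (N \<phi>)} \<Longrightarrow> norm (sol \<phi> t) \<le> E * real (N \<phi>) + 1" if "\<phi> \<in> Cspace r" for \<phi>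
  proof -
    have "mild_solution S B r a \<phi> (a + \<tau> (N \<phi>)) (sol \<phi>) \<and>
     (\<forall>t\<in>{a - r..a + \<tau> (N \<phi>)}. norm (sol \<phi> t) \<le> E * real (N \<phi>) + 1)"
      unfolding sol_def by (rule someI_ex[OF local_existence[OF adm that N]])
    then show "mild_solution S B r a \<phi> (a + \<tau> (N \<phi>)) (sol \<phi>)"
      "\<And>t. t \<in> {a - r..a + \<tau> (N \<phi>)} \<Longrightarrow> norm (sol \<phi> t) \<le> E * real (N \<phi>) + 1" by auto
  qed
  define b where "b = (\<lambda>\<phi>. ereal (a + \<tau> (N \<phi>)))"
  have part1: "ereal a < b \<phi> \<and> mild_solution_on S B r a \<phi> (b \<phi>) (sol \<phi>) \<and>
        (\<forall>v. mild_solution_on S B r a \<phi> (b \<phi>) v \<longrightarrow>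
              (\<forall>s. a - r \<le> s \<and> ereal s < b \<phi> \<longrightarrow> v s = sol \<phi> s))" if \<phi>: "\<phi> \<in> Cspace r" for \<phi>
  proof (intro conjI allI impI)
    show "ereal a < b \<phi>" unfolding b_def using pos by simp
    show on: "mild_solution_on S B r a \<phi> (b \<phi>) (sol \<phi>)"
      unfolding mild_solution_on_def b_def using mild_solution_restrict[OF sol(1)[OF \<phi>]] by auto
    fix v s assume v: "mild_solution_on S B r a \<phi> (b \<phi>) v" and s: "a - r \<le> s \<and> ereal s < b \<phi>"
    \<comment> \<open>\<open>s\<close> may lie in the history interval, whereas the final time of a
      mild solution is at least \<open>a\<close>.\<close>
    have T: "a \<le> max a s \<and> ereal (max a s) < b \<phi>" using s pos[of "N \<phi>"] by (auto simp: b_def max_def)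
    show "v s = sol \<phi> s"
    proof (rule uniqueness)
      show "mild_solution S B r a \<phi> (max a s) v" "mild_solution S B r a \<phi> (max a s) (sol \<phi>)"
        using v on T unfolding mild_solution_on_def by blast+
      show "max a s \<le> a + 1" "max a s \<le> a + \<rho>" "s \<in> {a - r..max a s}"
        using T \<tau>1[of "N \<phi>"] s unfolding b_def by auto
    qed
  qed
  have part2: "(\<forall>\<^sub>F n in sequentially. ereal t < b (\<phi>s n)) \<and>
           (\<lambda>n. normC r (seg r (sol (\<phi>s n)) t - seg r (sol \<phi>) t)) \<longlonglongrightarrow> 0"
    if \<phi>: "\<phi> \<in> Cspace r" "\<And>n. \<phi>s n \<in> Cspace r" and lim: "(\<lambda>n. normC r (\<phi>s n - \<phi>)) \<longlonglongrightarrow> 0"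
      and t: "a \<le> t" "ereal t < b \<phi>" for \<phi> \<phi>s t
  proof -
    have n0: "0 \<le> normC r \<phi>" using normC_nonneg[OF r0 \<phi>(1)] .
    \<comment> \<open>The gap between the norm of \<open>\<phi>\<close> and the next integer: a
      smaller perturbation cannot raise \<open>N\<close>.\<close>
    have "0 < real_of_int \<lfloor>normC r \<phi>\<rfloor> + 1 - normC r \<phi>" by linarith
    from order_tendstoD(2)[OF lim this]
    have ev: "\<forall>\<^sub>F n in sequentially. N (\<phi>s n) \<le> N \<phi>"
    proof eventually_elim
      case (elim n)
      have "normC r (\<phi>s n) < real_of_int \<lfloor>normC r \<phi>\<rfloor> + 1"
        using normC_triangle[OF r0 \<phi>(1) \<phi>(2)[of n]] elim by linarith
      then have "\<lfloor>normC r (\<phi>s n)\<rfloor> \<le> \<lfloor>normC r \<phi>\<rfloor>" by linarith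
      then show ?case unfolding N_def by simp
    qed
    have "\<forall>\<^sub>F n in sequentially. ereal t < b (\<phi>s n)"
      using ev
    proof eventually_elim
      case (elim n)
      then show ?case using anti[OF elim] t unfolding b_def by simp
    qed
    moreover have "(\<lambda>n. normC r (seg r (sol (\<phi>s n)) t - seg r (sol \<phi>) t)) \<longlonglongrightarrow> 0"
    proof (rule continuous_dependence[OF adm \<phi> sol[OF \<phi>(1)] _ lim])
      show "\<forall>\<^sub>F n in sequentially. mild_solution S B r a (\<phi>s n) (a + \<tau> (N \<phi>)) (sol (\<phi>s n)) \<and>
        (\<forall>t\<in>{a - r..a + \<tau> (N \<phi>)}. norm (sol (\<phi>s n) t) \<le> E * real (N \<phi>) + 1)"
        using ev
      proof eventually_elim
        case (elim n)
        \<comment> \<open>A smaller index means a longer interval and a smaller bound, so the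
          solution for \<open>\<phi>s n\<close>, restricted to the interval of
          \<open>\<phi>\<close>, meets the requirements for the radius
          \<open>N \<phi>\<close>.\<close>
        have "E * real (N (\<phi>s n)) \<le> E * real (N \<phi>)" using elim E_ge_1 by (intro mult_left_mono) auto
        then show ?case
          using mild_solution_restrict[OF sol(1)[OF \<phi>(2)[of n]], of "a + \<tau> (N \<phi>)"] anti[OF elim] pos[of "N \<phi>"]
            sol(2)[OF \<phi>(2)[of n]] by fastforce
      qed
    qed (use t in \<open>auto simp: b_def\<close>)
    ultimately show ?thesis by blast
  qed
  show ?thesis
    by (intro exI[of _ b] exI[of _ sol] conjI ballI allI impI) (use part1 part2 in blast)+
qed

end

section \<open>Well-posedness\<close>

theorem theorem4:
  fixes S :: "real \<Rightarrow> 'x::banach \<Rightarrow> 'x"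
    and \<omega> r a M_Vg L_Vgc L_p C\<^sub>1 C\<^sub>2 :: real
    and g :: "real \<Rightarrow> real \<Rightarrow> (real \<Rightarrow> 'x) \<Rightarrow> real"
    and \<eta> h :: "nat \<Rightarrow> real \<Rightarrow> (real \<Rightarrow> 'x) \<Rightarrow> real"
    and \<eta>_ign :: "real \<Rightarrow> real"
    and p :: "real \<Rightarrow> 'x \<Rightarrow> 'x"
    and G :: "real \<Rightarrow> 'x \<Rightarrow> 'x \<Rightarrow> 'x"
    and B :: "real \<Rightarrow> (real \<Rightarrow> 'x) \<Rightarrow> 'x"
  assumes r_pos: "r > 0"
    and semigroup: "compact_C0_semigroup S \<omega>"
    \<comment> \<open>(A1)\<close>
    and A1: "\<And>t \<phi>. \<phi> \<in> Cspace r \<Longrightarrow> variation_le (\<lambda>\<theta>. g \<theta> t \<phi>) (-r) 0 M_Vg"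
    \<comment> \<open>(A2)\<close>
    and A2: "\<And>\<theta>. \<theta> \<in> {-r..0} \<Longrightarrow> contRC r (\<lambda>t \<phi>. cont_part (-r) (\<lambda>\<sigma>. g \<sigma> t \<phi>) \<theta>)"
    \<comment> \<open>(A3)\<close>
    and A3_cont: "\<And>k. contRC r (\<eta> k) \<and> contRC r (h k)"
    and A3_range: "\<And>k t \<phi>. \<phi> \<in> Cspace r \<Longrightarrow> \<eta> k t \<phi> \<in> {0..r}"
    and A3_jumps: "\<And>t \<phi> \<theta>. \<phi> \<in> Cspace r \<Longrightarrow> \<theta> \<in> {-r..0} \<Longrightarrow>
        jump_at (-r) 0 (jump_part (-r) (\<lambda>\<sigma>. g \<sigma> t \<phi>)) \<theta>
          = (\<Sum>k. if - \<eta> k t \<phi> = \<theta> then h k t \<phi> else 0)"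
    and A3_summable: "\<And>t \<phi>. \<phi> \<in> Cspace r \<Longrightarrow> summable (\<lambda>k. \<bar>h k t \<phi>\<bar>)"
    and A3_uniform: "\<And>R \<epsilon>. \<epsilon> > 0 \<Longrightarrow> \<exists>N. \<forall>n\<ge>N. \<forall>t \<phi>. \<phi> \<in> Cspace r \<and> \<bar>t\<bar> \<le> R \<and> normC r \<phi> \<le> R
        \<longrightarrow> (\<Sum>k. \<bar>h (k + n) t \<phi>\<bar>) < \<epsilon>"
    \<comment> \<open>(A4)\<close>
    and A4_nonneg: "L_Vgc \<ge> 0"
    and A4: "\<And>t\<^sub>1 t\<^sub>2 \<phi> \<psi>. t\<^sub>1 \<ge> a \<Longrightarrow> t\<^sub>2 \<ge> a \<Longrightarrow> \<phi> \<in> Cspace r \<Longrightarrow> \<psi> \<in> Cspace r \<Longrightarrow>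
        variation_le (\<lambda>\<theta>. cont_part (-r) (\<lambda>\<sigma>. g \<sigma> t\<^sub>1 \<phi>) \<theta> - cont_part (-r) (\<lambda>\<sigma>. g \<sigma> t\<^sub>2 \<psi>) \<theta>)
          (-r) 0 (L_Vgc * (\<bar>t\<^sub>1 - t\<^sub>2\<bar> + normC r (\<phi> - \<psi>)))"
    \<comment> \<open>(A5)\<close>
    and A5_cont: "continuous_on {a..} \<eta>_ign"
    and A5_pos: "\<And>t. t \<ge> a \<Longrightarrow> \<eta>_ign t > 0"
    and A5: "\<And>t \<phi>\<^sub>1 \<phi>\<^sub>2 k. t \<ge> a \<Longrightarrow> \<phi>\<^sub>1 \<in> Cspace r \<Longrightarrow> \<phi>\<^sub>2 \<in> Cspace r \<Longrightarrow>
        (\<forall>\<theta>\<in>{-r..-\<eta>_ign t}. \<phi>\<^sub>1 \<theta> = \<phi>\<^sub>2 \<theta>) \<Longrightarrow>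
        \<eta> k t \<phi>\<^sub>1 = \<eta> k t \<phi>\<^sub>2 \<and> h k t \<phi>\<^sub>1 = h k t \<phi>\<^sub>2"
    \<comment> \<open>hypotheses on p\<close>
    and Lp_nonneg: "L_p \<ge> 0"
    and p_lip: "\<And>t s u v. norm (p t u - p s v) \<le> L_p * (\<bar>s - t\<bar> + norm (u - v))"
    and C_nonneg: "C\<^sub>1 \<ge> 0" "C\<^sub>2 \<ge> 0"
    and p_growth: "\<And>s u. norm (p s u) \<le> C\<^sub>1 * norm u + C\<^sub>2"
    \<comment> \<open>hypotheses on G\<close>
    and G_cont: "continuous_on UNIV (\<lambda>(t, u, v). G t u v)"
    and G_loclip: "\<And>R. R > 0 \<Longrightarrow> \<exists>L>0. \<forall>t u\<^sub>1 u\<^sub>2 v\<^sub>1 v\<^sub>2. t > a \<and> norm u\<^sub>1 \<le> R \<and> norm u\<^sub>2 \<le> R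
        \<and> norm v\<^sub>1 \<le> R \<and> norm v\<^sub>2 \<le> R \<longrightarrow>
        norm (G t u\<^sub>1 v\<^sub>1 - G t u\<^sub>2 v\<^sub>2) \<le> L * (norm (u\<^sub>1 - u\<^sub>2) + norm (v\<^sub>1 - v\<^sub>2))"
    \<comment> \<open>the nonlinearity\<close>
    and B_def: "\<And>t \<psi>. B t \<psi> = G t (\<psi> 0) (RS_integral (\<lambda>\<theta>. p t (\<psi> \<theta>)) (\<lambda>\<theta>. g \<theta> t \<psi>) (-r) 0)"
  shows "\<exists>(b :: (real \<Rightarrow> 'x) \<Rightarrow> ereal) (sol :: (real \<Rightarrow> 'x) \<Rightarrow> real \<Rightarrow> 'x).
     (\<forall>\<phi>\<in>Cspace r.
        ereal a < b \<phi> \<and> mild_solution_on S B r a \<phi> (b \<phi>) (sol \<phi>) \<and>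
        (\<forall>v. mild_solution_on S B r a \<phi> (b \<phi>) v \<longrightarrow>
              (\<forall>s. a - r \<le> s \<and> ereal s < b \<phi> \<longrightarrow> v s = sol \<phi> s))) \<and>
     (\<forall>\<phi> \<phi>s. \<phi> \<in> Cspace r \<and> (\<forall>n. \<phi>s n \<in> Cspace r) \<and>
        (\<lambda>n. normC r (\<phi>s n - \<phi>)) \<longlonglongrightarrow> 0 \<longrightarrow>
        (\<forall>t. a \<le> t \<and> ereal t < b \<phi> \<longrightarrow>
           (\<forall>\<^sub>F n in sequentially. ereal t < b (\<phi>s n)) \<and>
           (\<lambda>n. normC r (seg r (sol (\<phi>s n)) t - seg r (sol \<phi>) t)) \<longlonglongrightarrow> 0))"
proof -
  interpret D: delay_nonlinearity r a M_Vg L_Vgc L_p C\<^sub>1 C\<^sub>2 g \<eta> h \<eta>_ign p G B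
    by (rule delay_nonlinearity.intro; fact)
  have "continuous_on {a..a + 1} \<eta>_ign" using A5_cont by (rule continuous_on_subset) auto
  \<comment> \<open>The positive minimum \<open>\<eta>_ign m\<close> over the unit window serves as
    \<open>\<rho>\<close>: agreement up to \<open>- \<eta>_ign m\<close> includes agreement up to
    \<open>- \<eta>_ign t\<close> for each \<open>t\<close> in the window.\<close>
  then obtain m where m: "m \<in> {a..a + 1}" "\<And>t. t \<in> {a..a + 1} \<Longrightarrow> \<eta>_ign m \<le> \<eta>_ign t"
    using continuous_attains_inf[of "{a..a + 1}" \<eta>_ign] by auto
  interpret P: mild_problem S \<omega> r a "\<eta>_ign m" B
  proof
    show "\<eta>_ign m > 0" using A5_pos m(1) by simp
    fix R
    obtain L where L: "0 \<le> L" "\<And>t \<phi> \<psi>. t \<ge> a \<Longrightarrow> \<phi> \<in> Cspace r \<Longrightarrow> \<psi> \<in> Cspace r \<Longrightarrow> normC r \<phi> \<le> R \<Longrightarrow>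
        normC r \<psi> \<le> R \<Longrightarrow> \<forall>\<theta>\<in>{-r..-\<eta>_ign t}. \<phi> \<theta> = \<psi> \<theta> \<Longrightarrow> norm (B t \<phi> - B t \<psi>) \<le> L * normC r (\<phi> - \<psi>)"
      using D.B_lipschitz_same_past[of R] by blast
    show "\<exists>L\<ge>0. \<forall>t\<in>{a..a + 1}. \<forall>\<phi>\<in>Cspace r. \<forall>\<psi>\<in>Cspace r. normC r \<phi> \<le> R \<longrightarrow> normC r \<psi> \<le> R \<longrightarrow>
      (\<forall>\<theta>\<in>{-r..-\<eta>_ign m}. \<phi> \<theta> = \<psi> \<theta>) \<longrightarrow> norm (B t \<phi> - B t \<psi>) \<le> L * normC r (\<phi> - \<psi>)"
    proof (intro exI[of _ L] conjI ballI impI L)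
      fix t :: real and \<phi> \<psi> :: "real \<Rightarrow> 'x" and \<theta> :: real
      assume "t \<in> {a..a + 1}" "\<forall>\<theta>\<in>{-r..-\<eta>_ign m}. \<phi> \<theta> = \<psi> \<theta>" "\<theta> \<in> {-r..-\<eta>_ign t}"
      then show "\<phi> \<theta> = \<psi> \<theta>" using m(2)[of t] by auto
    qed auto
  qed (use r_pos semigroup D.B_tendsto D.B_bounded in auto)
  show ?thesis by (rule P.well_posed)
qed

end
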